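(* Let $p$ and $q$ be two distinct odd primes. Assume that $G$ is a finite group of minimal order with respect to the property that $\Omega_{p\cdot q}(G)\neq\emptyset$ but $\Omega^{**}_{p,q}(G)=\emptyset$ (that is, $G$ has this property and no finite group of smaller order has it, for the same $p$ and $q$). Then there exists a $(p,q)$-Frattini triple $(S,P,Q)$ such that $G$ is a Frattini extension of $P\times Q$ by $S$.
   Context: For a finite group $G$, $\mathrm{Frat}(G)$ denotes its Frattini subgroup (the intersection of all maximal subgroups, with $\mathrm{Frat}(1)=1$). For distinct primes $p,q$, let $\Omega_{p\cdot q}(G)=\{g\in G : p\cdot q \text{ divides } |g|\}$, and $\Omega^*_{p\cdot q}(G)=\Omega_{p\cdot q}(G)\setminus\mathrm{Frat}(G)$. Let $\Omega^{**}_{p,q}(G)$ be the set of those $g\in\Omega^*_{p\cdot q}(G)$ whose order is not divisible by any prime different from $p$ and $q$. Let $S$ be a finite nonabelian simple group, $P$ a faithful irreducible $S$-module (a finite abelian group with an $S$-action) of $p$-power order, and $Q$ a faithful irreducible $S$-module of $q$-power order. The triple $(S,P,Q)$ is called a $(p,q)$-Frattini triple if: (1) $\Omega_{p\cdot q}(S)=\emptyset$; (2) $H^2(S,P)\neq 0$; (3) $H^2(S,Q)\neq 0$; (4) $C_P(s)=0$ for every nontrivial element $s\in S$ of $q$-power order; (5) $C_Q(s)=0$ for every nontrivial element $s\in S$ of $p$-power order. Here $C_P(s)$ denotes the set of elements of $P$ fixed by $s$, and similarly for $C_Q(s)$. A Frattini extension of $P\times Q$ by $S$ is a finite group $G$ with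 a normal subgroup $N$ such that $N\le\mathrm{Frat}(G)$, $G/N\cong S$, and $N$, with the action of $G/N\cong S$ induced by conjugation, is isomorphic to $P\times Q$ as an $S$-module. *)

theory Defs
  imports "HOL-Algebra.Algebra"
begin

text \<open>Makes \<open>prime\<close> refer to the type-class notion, not the one for monoids.\<close>

hide_const (open) Divisibility.prime

section \<open>Frattini subgroup and elements of order divisible by two primes\<close>

definition maximal_subgroup :: "'a set \<Rightarrow> ('a, 'm) monoid_scheme \<Rightarrow> bool" where
  "maximal_subgroup M G \<longleftrightarrow> subgroup M G \<and> M \<noteq> carrier G \<and>
     (\<forall>K. subgroup K G \<and> M \<subseteq> K \<longrightarrow> K = M \<or> K = carrier G)"

text \<open>The intersection with \<open>carrier G\<close> only matters when there are no maximal subgroups;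
  for finite \<open>G\<close> this happens only if \<open>G\<close> is trivial, and then the result is \<open>{\<one>}\<close>.\<close>

definition Frat :: "('a, 'm) monoid_scheme \<Rightarrow> 'a set" where
  "Frat G = carrier G \<inter> \<Inter> {M. maximal_subgroup M G}"

definition Omega :: "nat \<Rightarrow> nat \<Rightarrow> ('a, 'm) monoid_scheme \<Rightarrow> 'a set" where
  "Omega p q G = {g \<in> carrier G. p * q dvd group.ord G g}"

definition Omega_star :: "nat \<Rightarrow> nat \<Rightarrow> ('a, 'm) monoid_scheme \<Rightarrow> 'a set" where
  "Omega_star p q G = Omega p q G - Frat G"

definition Omega_star_star :: "nat \<Rightarrow> nat \<Rightarrow> ('a, 'm) monoid_scheme \<Rightarrow> 'a set" where
  "Omega_star_star p q G =
     {g \<in> Omega_star p q G. \<forall>r. prime r \<and> r dvd group.ord G g \<longrightarrow> r = p \<or> r = q}"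

section \<open>Modules over a group\<close>

text \<open>Modules are written multiplicatively, so the zero of the module \<open>A\<close> is \<open>\<one>\<^bsub>A\<^esub>\<close>.
  The action is on the left, since multiplication in \<^const>\<open>AutoGroup\<close> is
  composition of functions.\<close>

definition group_module ::
    "('s, 'm) monoid_scheme \<Rightarrow> ('a, 'n) monoid_scheme \<Rightarrow> ('s \<Rightarrow> 'a \<Rightarrow> 'a) \<Rightarrow> bool" where
  "group_module S A \<alpha> \<longleftrightarrow> group S \<and> comm_group A \<and> \<alpha> \<in> hom S (AutoGroup A)"

definition faithful_module ::
    "('s, 'm) monoid_scheme \<Rightarrow> ('a, 'n) monoid_scheme \<Rightarrow> ('s \<Rightarrow> 'a \<Rightarrow> 'a) \<Rightarrow> bool" where
  "faithful_module S A \<alpha> \<longleftrightarrow> group_module S A \<alpha> \<and> inj_on \<alpha> (carrier S)"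

definition submodule_of ::
    "'a set \<Rightarrow> ('s, 'm) monoid_scheme \<Rightarrow> ('a, 'n) monoid_scheme \<Rightarrow> ('s \<Rightarrow> 'a \<Rightarrow> 'a) \<Rightarrow> bool" where
  "submodule_of B S A \<alpha> \<longleftrightarrow> subgroup B A \<and> (\<forall>s\<in>carrier S. \<alpha> s ` B \<subseteq> B)"

definition irreducible_module ::
    "('s, 'm) monoid_scheme \<Rightarrow> ('a, 'n) monoid_scheme \<Rightarrow> ('s \<Rightarrow> 'a \<Rightarrow> 'a) \<Rightarrow> bool" where
  "irreducible_module S A \<alpha> \<longleftrightarrow> group_module S A \<alpha> \<and> carrier A \<noteq> {\<one>\<^bsub>A\<^esub>} \<and>
     (\<forall>B. submodule_of B S A \<alpha> \<longrightarrow> B = {\<one>\<^bsub>A\<^esub>} \<or> B = carrier A)"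

definition module_fixed ::
    "('a, 'n) monoid_scheme \<Rightarrow> ('s \<Rightarrow> 'a \<Rightarrow> 'a) \<Rightarrow> 's \<Rightarrow> 'a set" where
  "module_fixed A \<alpha> s = {a \<in> carrier A. \<alpha> s a = a}"

definition prod_action ::
    "('a, 'm) monoid_scheme \<Rightarrow> ('s \<Rightarrow> 'a \<Rightarrow> 'a) \<Rightarrow> ('b, 'n) monoid_scheme \<Rightarrow> ('s \<Rightarrow> 'b \<Rightarrow> 'b)
      \<Rightarrow> 's \<Rightarrow> 'a \<times> 'b \<Rightarrow> 'a \<times> 'b" where
  "prod_action A \<alpha> B \<beta> s = (\<lambda>(a, b)\<in>carrier A \<times> carrier B. (\<alpha> s a, \<beta> s b))"

section \<open>Second cohomology\<close>

text \<open>\<open>H\<^sup>2(S, A)\<close> is computed from the inhomogeneous (bar) cochain complex. In additive notation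
  the cocycle condition is \<open>s f(t,u) + f(s,tu) = f(st,u) + f(s,t)\<close>, and the coboundary of a
  1-cochain \<open>c\<close> is \<open>s c(t) - c(st) + c(s)\<close>.\<close>

definition cocycles2 ::
    "('s, 'm) monoid_scheme \<Rightarrow> ('a, 'n) monoid_scheme \<Rightarrow> ('s \<Rightarrow> 'a \<Rightarrow> 'a) \<Rightarrow> ('s \<times> 's \<Rightarrow> 'a) monoid"
  where
  "cocycles2 S A \<alpha> =
     \<lparr>carrier = {f \<in> carrier S \<times> carrier S \<rightarrow>\<^sub>E carrier A.
        \<forall>s\<in>carrier S. \<forall>t\<in>carrier S. \<forall>u\<in>carrier S.
          \<alpha> s (f (t, u)) \<otimes>\<^bsub>A\<^esub> f (s, t \<otimes>\<^bsub>S\<^esub> u) = f (s \<otimes>\<^bsub>S\<^esub> t, u) \<otimes>\<^bsub>A\<^esub> f (s, t)},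
      monoid.mult = (\<lambda>f g. \<lambda>x\<in>carrier S \<times> carrier S. f x \<otimes>\<^bsub>A\<^esub> g x),
      monoid.one = (\<lambda>x\<in>carrier S \<times> carrier S. \<one>\<^bsub>A\<^esub>)\<rparr>"

definition coboundary2 ::
    "('s, 'm) monoid_scheme \<Rightarrow> ('a, 'n) monoid_scheme \<Rightarrow> ('s \<Rightarrow> 'a \<Rightarrow> 'a) \<Rightarrow> ('s \<Rightarrow> 'a)
      \<Rightarrow> 's \<times> 's \<Rightarrow> 'a" where
  "coboundary2 S A \<alpha> c =
     (\<lambda>(s, t)\<in>carrier S \<times> carrier S. \<alpha> s (c t) \<otimes>\<^bsub>A\<^esub> inv\<^bsub>A\<^esub> c (s \<otimes>\<^bsub>S\<^esub> t) \<otimes>\<^bsub>A\<^esub> c s)"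

definition coboundaries2 ::
    "('s, 'm) monoid_scheme \<Rightarrow> ('a, 'n) monoid_scheme \<Rightarrow> ('s \<Rightarrow> 'a \<Rightarrow> 'a) \<Rightarrow> ('s \<times> 's \<Rightarrow> 'a) set"
  where
  "coboundaries2 S A \<alpha> = coboundary2 S A \<alpha> ` (carrier S \<rightarrow> carrier A)"

definition cohomology2 ::
    "('s, 'm) monoid_scheme \<Rightarrow> ('a, 'n) monoid_scheme \<Rightarrow> ('s \<Rightarrow> 'a \<Rightarrow> 'a)
      \<Rightarrow> ('s \<times> 's \<Rightarrow> 'a) set monoid" where
  "cohomology2 S A \<alpha> = cocycles2 S A \<alpha> Mod coboundaries2 S A \<alpha>"

lemma group_module_actD:
  assumes "group_module S A \<alpha>" "s \<in> carrier S"
  shows group_module_act_closed: "\<And>a. a \<in> carrier A \<Longrightarrow> \<alpha> s a \<in> carrier A"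
    and group_module_act_mult: "\<And>a b. a \<in> carrier A \<Longrightarrow> b \<in> carrier A \<Longrightarrow>
          \<alpha> s (a \<otimes>\<^bsub>A\<^esub> b) = \<alpha> s a \<otimes>\<^bsub>A\<^esub> \<alpha> s b"
    and group_module_act_Bij: "\<alpha> s \<in> Bij (carrier A)"
proof -
  have *: "\<alpha> s \<in> auto A"
    using assms by (auto simp: group_module_def AutoGroup_def hom_def)
  show "\<And>a. a \<in> carrier A \<Longrightarrow> \<alpha> s a \<in> carrier A"
    "\<And>a b. a \<in> carrier A \<Longrightarrow> b \<in> carrier A \<Longrightarrow> \<alpha> s (a \<otimes>\<^bsub>A\<^esub> b) = \<alpha> s a \<otimes>\<^bsub>A\<^esub> \<alpha> s b"
    "\<alpha> s \<in> Bij (carrier A)"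
    using * by (auto simp: auto_def hom_def)
qed

lemma group_module_act_act:
  assumes "group_module S A \<alpha>" "s \<in> carrier S" "t \<in> carrier S" "a \<in> carrier A"
  shows "\<alpha> (s \<otimes>\<^bsub>S\<^esub> t) a = \<alpha> s (\<alpha> t a)"
proof -
  have "\<alpha> (s \<otimes>\<^bsub>S\<^esub> t) = \<alpha> s \<otimes>\<^bsub>AutoGroup A\<^esub> \<alpha> t"
    using assms by (auto simp: group_module_def hom_def)
  then show ?thesis
    using assms group_module_act_Bij[OF assms(1)]
    by (simp add: AutoGroup_def BijGroup_def compose_def)
qed

lemma group_module_act_one:
  assumes "group_module S A \<alpha>" "s \<in> carrier S"
  shows "\<alpha> s \<one>\<^bsub>A\<^esub> = \<one>\<^bsub>A\<^esub>"
proof -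
  interpret A: comm_group A using assms by (simp add: group_module_def)
  have "\<alpha> s \<in> hom A A"
    using group_module_actD[OF assms] by (auto simp: hom_def)
  then show ?thesis
    using A.is_group hom_one by blast
qed

lemma group_module_act_inv:
  assumes "group_module S A \<alpha>" "s \<in> carrier S" "a \<in> carrier A"
  shows "\<alpha> s (inv\<^bsub>A\<^esub> a) = inv\<^bsub>A\<^esub> \<alpha> s a"
proof -
  interpret A: comm_group A using assms by (simp add: group_module_def)
  have "\<alpha> s (inv\<^bsub>A\<^esub> a) \<otimes>\<^bsub>A\<^esub> \<alpha> s a = \<one>\<^bsub>A\<^esub>"
    using assms group_module_act_mult[OF assms(1,2), of "inv\<^bsub>A\<^esub> a" a]
      group_module_act_one[OF assms(1,2)] by simp
  then show ?thesis
    using assms group_module_act_closed[OF assms(1,2)] by (simp add: A.inv_equality)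
qed

lemma comm_group_cocycles2:
  assumes "group_module S A \<alpha>"
  shows "comm_group (cocycles2 S A \<alpha>)"
proof -
  interpret S: group S using assms by (simp add: group_module_def)
  interpret A: comm_group A using assms by (simp add: group_module_def)
  note act = group_module_act_closed[OF assms] group_module_act_mult[OF assms]
    group_module_act_one[OF assms] group_module_act_inv[OF assms]
  have fcl: "f (s, t) \<in> carrier A"
    if "f \<in> carrier S \<times> carrier S \<rightarrow>\<^sub>E carrier A" "s \<in> carrier S" "t \<in> carrier S" for f s t
    using that by auto
  show ?thesis
  proof (rule comm_groupI)
    fix f g assume fg: "f \<in> carrier (cocycles2 S A \<alpha>)" "g \<in> carrier (cocycles2 S A \<alpha>)"
    then have fn: "f \<in> carrier S \<times> carrier S \<rightarrow>\<^sub>E carrier A" "g \<in> carrier S \<times> carrier S \<rightarrow>\<^sub>E carrier A"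
      by (auto simp: cocycles2_def)
    have "\<alpha> s (f (t, u) \<otimes>\<^bsub>A\<^esub> g (t, u)) \<otimes>\<^bsub>A\<^esub> (f (s, t \<otimes>\<^bsub>S\<^esub> u) \<otimes>\<^bsub>A\<^esub> g (s, t \<otimes>\<^bsub>S\<^esub> u)) =
       f (s \<otimes>\<^bsub>S\<^esub> t, u) \<otimes>\<^bsub>A\<^esub> g (s \<otimes>\<^bsub>S\<^esub> t, u) \<otimes>\<^bsub>A\<^esub> (f (s, t) \<otimes>\<^bsub>A\<^esub> g (s, t))"
      if x: "s \<in> carrier S" "t \<in> carrier S" "u \<in> carrier S" for s t u
    proof -
      have "\<alpha> s (f (t, u) \<otimes>\<^bsub>A\<^esub> g (t, u)) \<otimes>\<^bsub>A\<^esub> (f (s, t \<otimes>\<^bsub>S\<^esub> u) \<otimes>\<^bsub>A\<^esub> g (s, t \<otimes>\<^bsub>S\<^esub> u)) =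
         (\<alpha> s (f (t, u)) \<otimes>\<^bsub>A\<^esub> f (s, t \<otimes>\<^bsub>S\<^esub> u)) \<otimes>\<^bsub>A\<^esub> (\<alpha> s (g (t, u)) \<otimes>\<^bsub>A\<^esub> g (s, t \<otimes>\<^bsub>S\<^esub> u))"
        using x fcl[OF fn(1)] fcl[OF fn(2)] by (simp add: act A.m_ac)
      also have "\<dots> = (f (s \<otimes>\<^bsub>S\<^esub> t, u) \<otimes>\<^bsub>A\<^esub> f (s, t)) \<otimes>\<^bsub>A\<^esub> (g (s \<otimes>\<^bsub>S\<^esub> t, u) \<otimes>\<^bsub>A\<^esub> g (s, t))"
        using x fg by (simp add: cocycles2_def)
      also have "\<dots> = f (s \<otimes>\<^bsub>S\<^esub> t, u) \<otimes>\<^bsub>A\<^esub> g (s \<otimes>\<^bsub>S\<^esub> t, u) \<otimes>\<^bsub>A\<^esub> (f (s, t) \<otimes>\<^bsub>A\<^esub> g (s, t))"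
        using x fcl[OF fn(1)] fcl[OF fn(2)] by (simp add: A.m_ac)
      finally show ?thesis .
    qed
    then show "f \<otimes>\<^bsub>cocycles2 S A \<alpha>\<^esub> g \<in> carrier (cocycles2 S A \<alpha>)"
      using fn by (simp add: cocycles2_def PiE_iff)
    show "f \<otimes>\<^bsub>cocycles2 S A \<alpha>\<^esub> g = g \<otimes>\<^bsub>cocycles2 S A \<alpha>\<^esub> f"
      using fn by (simp add: cocycles2_def PiE_iff fun_eq_iff restrict_def A.m_comm)
  next
    show "\<one>\<^bsub>cocycles2 S A \<alpha>\<^esub> \<in> carrier (cocycles2 S A \<alpha>)"
      by (auto simp: cocycles2_def act)
  next
    fix f g h assume "f \<in> carrier (cocycles2 S A \<alpha>)" "g \<in> carrier (cocycles2 S A \<alpha>)"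
      "h \<in> carrier (cocycles2 S A \<alpha>)"
    then show "f \<otimes>\<^bsub>cocycles2 S A \<alpha>\<^esub> g \<otimes>\<^bsub>cocycles2 S A \<alpha>\<^esub> h =
        f \<otimes>\<^bsub>cocycles2 S A \<alpha>\<^esub> (g \<otimes>\<^bsub>cocycles2 S A \<alpha>\<^esub> h)"
      by (simp add: cocycles2_def PiE_iff fun_eq_iff restrict_def A.m_assoc)
  next
    fix f assume f: "f \<in> carrier (cocycles2 S A \<alpha>)"
    then have fn: "f \<in> carrier S \<times> carrier S \<rightarrow>\<^sub>E carrier A"
      by (auto simp: cocycles2_def)
    show "\<one>\<^bsub>cocycles2 S A \<alpha>\<^esub> \<otimes>\<^bsub>cocycles2 S A \<alpha>\<^esub> f = f"
      using fn by (simp add: cocycles2_def PiE_iff fun_eq_iff restrict_def extensional_def)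
    let ?g = "\<lambda>x\<in>carrier S \<times> carrier S. inv\<^bsub>A\<^esub> f x"
    have "\<alpha> s (inv\<^bsub>A\<^esub> f (t, u)) \<otimes>\<^bsub>A\<^esub> inv\<^bsub>A\<^esub> f (s, t \<otimes>\<^bsub>S\<^esub> u) =
       inv\<^bsub>A\<^esub> f (s \<otimes>\<^bsub>S\<^esub> t, u) \<otimes>\<^bsub>A\<^esub> inv\<^bsub>A\<^esub> f (s, t)"
      if x: "s \<in> carrier S" "t \<in> carrier S" "u \<in> carrier S" for s t u
    proof -
      have "\<alpha> s (inv\<^bsub>A\<^esub> f (t, u)) \<otimes>\<^bsub>A\<^esub> inv\<^bsub>A\<^esub> f (s, t \<otimes>\<^bsub>S\<^esub> u) =
         inv\<^bsub>A\<^esub> (\<alpha> s (f (t, u)) \<otimes>\<^bsub>A\<^esub> f (s, t \<otimes>\<^bsub>S\<^esub> u))"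
        using x fcl[OF fn] by (simp add: act A.inv_mult)
      also have "\<dots> = inv\<^bsub>A\<^esub> (f (s \<otimes>\<^bsub>S\<^esub> t, u) \<otimes>\<^bsub>A\<^esub> f (s, t))"
        using x f by (simp add: cocycles2_def)
      finally show ?thesis
        using x fcl[OF fn] by (simp add: A.inv_mult)
    qed
    then have "?g \<in> carrier (cocycles2 S A \<alpha>)"
      using fn by (simp add: cocycles2_def PiE_iff)
    moreover have "?g \<otimes>\<^bsub>cocycles2 S A \<alpha>\<^esub> f = \<one>\<^bsub>cocycles2 S A \<alpha>\<^esub>"
      using fn by (simp add: cocycles2_def PiE_iff fun_eq_iff restrict_def)
    ultimately show "\<exists>g\<in>carrier (cocycles2 S A \<alpha>). g \<otimes>\<^bsub>cocycles2 S A \<alpha>\<^esub> f = \<one>\<^bsub>cocycles2 S A \<alpha>\<^esub>"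
      by blast
  qed
qed

lemma coboundary2_cocycle:
  assumes "group_module S A \<alpha>" "c \<in> carrier S \<rightarrow> carrier A"
  shows "coboundary2 S A \<alpha> c \<in> carrier (cocycles2 S A \<alpha>)"
proof -
  interpret S: group S using assms by (simp add: group_module_def)
  interpret A: comm_group A using assms by (simp add: group_module_def)
  note act = group_module_act_closed[OF assms(1)] group_module_act_mult[OF assms(1)]
    group_module_act_act[OF assms(1)] group_module_act_inv[OF assms(1)]
  have c: "c s \<in> carrier A" if "s \<in> carrier S" for s using assms that by auto
  have cancel: "x \<otimes>\<^bsub>A\<^esub> inv\<^bsub>A\<^esub> y \<otimes>\<^bsub>A\<^esub> z \<otimes>\<^bsub>A\<^esub> (y \<otimes>\<^bsub>A\<^esub> inv\<^bsub>A\<^esub> v \<otimes>\<^bsub>A\<^esub> w) =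
      x \<otimes>\<^bsub>A\<^esub> inv\<^bsub>A\<^esub> v \<otimes>\<^bsub>A\<^esub> k \<otimes>\<^bsub>A\<^esub> (z \<otimes>\<^bsub>A\<^esub> inv\<^bsub>A\<^esub> k \<otimes>\<^bsub>A\<^esub> w)"
    if "x \<in> carrier A" "y \<in> carrier A" "z \<in> carrier A" "v \<in> carrier A" "w \<in> carrier A"
      "k \<in> carrier A" for x y z v w k
  proof -
    have "x \<otimes>\<^bsub>A\<^esub> inv\<^bsub>A\<^esub> y \<otimes>\<^bsub>A\<^esub> z \<otimes>\<^bsub>A\<^esub> (y \<otimes>\<^bsub>A\<^esub> inv\<^bsub>A\<^esub> v \<otimes>\<^bsub>A\<^esub> w) =
        (inv\<^bsub>A\<^esub> y \<otimes>\<^bsub>A\<^esub> y) \<otimes>\<^bsub>A\<^esub> (x \<otimes>\<^bsub>A\<^esub> inv\<^bsub>A\<^esub> v \<otimes>\<^bsub>A\<^esub> z \<otimes>\<^bsub>A\<^esub> w)"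
      using that by (simp only: A.m_ac A.m_closed A.inv_closed)
    also have "\<dots> = (inv\<^bsub>A\<^esub> k \<otimes>\<^bsub>A\<^esub> k) \<otimes>\<^bsub>A\<^esub> (x \<otimes>\<^bsub>A\<^esub> inv\<^bsub>A\<^esub> v \<otimes>\<^bsub>A\<^esub> z \<otimes>\<^bsub>A\<^esub> w)"
      using that by simp
    also have "\<dots> = x \<otimes>\<^bsub>A\<^esub> inv\<^bsub>A\<^esub> v \<otimes>\<^bsub>A\<^esub> k \<otimes>\<^bsub>A\<^esub> (z \<otimes>\<^bsub>A\<^esub> inv\<^bsub>A\<^esub> k \<otimes>\<^bsub>A\<^esub> w)"
      using that by (simp only: A.m_ac A.m_closed A.inv_closed)
    finally show ?thesis .
  qed
  show ?thesis
    by (auto simp: cocycles2_def coboundary2_def act c S.m_assoc intro!: cancel)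
qed

lemma subgroup_coboundaries2:
  assumes "group_module S A \<alpha>"
  shows "subgroup (coboundaries2 S A \<alpha>) (cocycles2 S A \<alpha>)"
proof -
  interpret S: group S using assms by (simp add: group_module_def)
  interpret A: comm_group A using assms by (simp add: group_module_def)
  interpret Z: comm_group "cocycles2 S A \<alpha>" using assms by (rule comm_group_cocycles2)
  note act = group_module_act_closed[OF assms] group_module_act_mult[OF assms]
    group_module_act_inv[OF assms]
  let ?d = "coboundary2 S A \<alpha>"
  have mult: "?d (\<lambda>s. c s \<otimes>\<^bsub>A\<^esub> e s) = ?d c \<otimes>\<^bsub>cocycles2 S A \<alpha>\<^esub> ?d e"
    if ce: "c \<in> carrier S \<rightarrow> carrier A" "e \<in> carrier S \<rightarrow> carrier A" for c e
  proof -
    have "c s \<in> carrier A" "e s \<in> carrier A" if "s \<in> carrier S" for s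
      using ce that by auto
    then show ?thesis
      by (auto simp: coboundary2_def cocycles2_def fun_eq_iff restrict_def act A.inv_mult A.m_ac)
  qed
  show ?thesis
    unfolding coboundaries2_def
  proof (rule Z.subgroupI)
    show "?d ` (carrier S \<rightarrow> carrier A) \<subseteq> carrier (cocycles2 S A \<alpha>)"
      using coboundary2_cocycle[OF assms] by blast
    have "(\<lambda>_. \<one>\<^bsub>A\<^esub>) \<in> carrier S \<rightarrow> carrier A" by simp
    then show "?d ` (carrier S \<rightarrow> carrier A) \<noteq> {}" by blast
  next
    fix f assume "f \<in> ?d ` (carrier S \<rightarrow> carrier A)"
    then obtain c where c: "c \<in> carrier S \<rightarrow> carrier A" "f = ?d c" by blast
    have i: "(\<lambda>s. inv\<^bsub>A\<^esub> c s) \<in> carrier S \<rightarrow> carrier A" using c by auto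
    have cs: "c s \<in> carrier A" if "s \<in> carrier S" for s using c that by auto
    have "?d (\<lambda>s. inv\<^bsub>A\<^esub> c s) \<otimes>\<^bsub>cocycles2 S A \<alpha>\<^esub> ?d c = ?d (\<lambda>s. inv\<^bsub>A\<^esub> c s \<otimes>\<^bsub>A\<^esub> c s)"
      using mult[OF i c(1)] by simp
    also have "\<dots> = \<one>\<^bsub>cocycles2 S A \<alpha>\<^esub>"
      by (auto simp: coboundary2_def cocycles2_def fun_eq_iff restrict_def cs
          group_module_act_one[OF assms])
    finally have "inv\<^bsub>cocycles2 S A \<alpha>\<^esub> f = ?d (\<lambda>s. inv\<^bsub>A\<^esub> c s)"
      using c i coboundary2_cocycle[OF assms] by (intro Z.inv_equality) auto
    then show "inv\<^bsub>cocycles2 S A \<alpha>\<^esub> f \<in> ?d ` (carrier S \<rightarrow> carrier A)"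
      using i by blast
  next
    fix f g assume "f \<in> ?d ` (carrier S \<rightarrow> carrier A)" "g \<in> ?d ` (carrier S \<rightarrow> carrier A)"
    then obtain c e where ce: "c \<in> carrier S \<rightarrow> carrier A" "f = ?d c"
      "e \<in> carrier S \<rightarrow> carrier A" "g = ?d e" by blast
    have "(\<lambda>s. c s \<otimes>\<^bsub>A\<^esub> e s) \<in> carrier S \<rightarrow> carrier A" using ce by auto
    then show "f \<otimes>\<^bsub>cocycles2 S A \<alpha>\<^esub> g \<in> ?d ` (carrier S \<rightarrow> carrier A)"
      unfolding ce(2,4) mult[OF ce(1,3), symmetric] by (rule imageI)
  qed
qed

lemma comm_group_cohomology2:
  assumes "group_module S A \<alpha>"
  shows "comm_group (cohomology2 S A \<alpha>)"
  unfolding cohomology2_def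
  by (rule comm_group.abelian_FactGroup[OF comm_group_cocycles2 subgroup_coboundaries2])
    (use assms in auto)

section \<open>Frattini triples and Frattini extensions\<close>

definition frattini_triple ::
    "nat \<Rightarrow> nat \<Rightarrow> ('s, 'm) monoid_scheme \<Rightarrow> ('a, 'n) monoid_scheme \<Rightarrow> ('s \<Rightarrow> 'a \<Rightarrow> 'a)
      \<Rightarrow> ('b, 'k) monoid_scheme \<Rightarrow> ('s \<Rightarrow> 'b \<Rightarrow> 'b) \<Rightarrow> bool" where
  "frattini_triple p q S P \<phi> Q \<psi> \<longleftrightarrow>
     simple_group S \<and> finite (carrier S) \<and> \<not> comm_group S \<and>
     faithful_module S P \<phi> \<and> irreducible_module S P \<phi> \<and> (\<exists>k. order P = p ^ k) \<and>
     finite (carrier P) \<and>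
     faithful_module S Q \<psi> \<and> irreducible_module S Q \<psi> \<and> (\<exists>k. order Q = q ^ k) \<and>
     finite (carrier Q) \<and>
     Omega p q S = {} \<and>
     \<not> trivial_group (cohomology2 S P \<phi>) \<and>
     \<not> trivial_group (cohomology2 S Q \<psi>) \<and>
     (\<forall>s\<in>carrier S. s \<noteq> \<one>\<^bsub>S\<^esub> \<and> (\<exists>k. group.ord S s = q ^ k) \<longrightarrow> module_fixed P \<phi> s = {\<one>\<^bsub>P\<^esub>}) \<and>
     (\<forall>s\<in>carrier S. s \<noteq> \<one>\<^bsub>S\<^esub> \<and> (\<exists>k. group.ord S s = p ^ k) \<longrightarrow> module_fixed Q \<psi> s = {\<one>\<^bsub>Q\<^esub>})"

text \<open>The isomorphism \<open>\<theta>\<close> identifies \<open>G/N\<close> with \<open>S\<close>; the last conjunct says that \<open>f\<close> carries the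
  conjugation action of \<open>G/N\<close> on \<open>N\<close> to the action \<open>\<alpha>\<close> of \<open>S\<close> on \<open>A\<close>.\<close>

definition frattini_extension ::
    "('g, 'l) monoid_scheme \<Rightarrow> ('s, 'm) monoid_scheme \<Rightarrow> ('a, 'n) monoid_scheme
      \<Rightarrow> ('s \<Rightarrow> 'a \<Rightarrow> 'a) \<Rightarrow> bool" where
  "frattini_extension G S A \<alpha> \<longleftrightarrow> group G \<and> finite (carrier G) \<and>
     (\<exists>N \<theta> f. N \<lhd> G \<and> N \<subseteq> Frat G \<and> \<theta> \<in> iso (G Mod N) S \<and> f \<in> iso (G\<lparr>carrier := N\<rparr>) A \<and>
        (\<forall>g\<in>carrier G. \<forall>n\<in>N.
           f (g \<otimes>\<^bsub>G\<^esub> n \<otimes>\<^bsub>G\<^esub> inv\<^bsub>G\<^esub> g) = \<alpha> (\<theta> (N #>\<^bsub>G\<^esub> g)) (f n)))"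

text \<open>Every finite group has an isomorphic copy whose elements are natural numbers, so a
  statement about all finite groups up to isomorphism may quantify over \<open>nat monoid\<close>.\<close>

lemma finite_group_iso_nat_monoid:
  fixes G :: "('a, 'm) monoid_scheme"
  assumes "group G" "finite (carrier G)"
  shows "\<exists>H :: nat monoid. group H \<and> G \<cong> H"
proof -
  interpret G: group G by fact
  obtain h :: "'a \<Rightarrow> nat" where inj: "inj_on h (carrier G)"
    using assms(2) finite_imp_inj_to_nat_seg by blast
  let ?k = "the_inv_into (carrier G) h"
  have k [simp]: "?k (h x) = x" if "x \<in> carrier G" for x
    using inj that by (rule the_inv_into_f_f)
  let ?H = "\<lparr>carrier = h ` carrier G, monoid.mult = \<lambda>x y. h (?k x \<otimes>\<^bsub>G\<^esub> ?k y), monoid.one = h \<one>\<^bsub>G\<^esub>\<rparr>"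
  have "group ?H"
  proof (rule groupI)
    fix x assume "x \<in> carrier ?H"
    then obtain a where a: "a \<in> carrier G" "x = h a" by auto
    then have "h (inv\<^bsub>G\<^esub> a) \<in> carrier ?H" "h (inv\<^bsub>G\<^esub> a) \<otimes>\<^bsub>?H\<^esub> x = \<one>\<^bsub>?H\<^esub>" by simp_all
    then show "\<exists>y\<in>carrier ?H. y \<otimes>\<^bsub>?H\<^esub> x = \<one>\<^bsub>?H\<^esub>" by blast
  qed (auto simp: G.m_assoc)
  moreover have "h \<in> iso G ?H"
    using inj by (auto simp: iso_def hom_def bij_betw_def)
  ultimately show ?thesis
    unfolding is_iso_def by blast
qed

end

theory Submission
  imports Defs "HOL-Number_Theory.Residues"
begin

text \<open>Let \<open>F\<close> be the Frattini subgroup of \<open>G\<close>. A \<open>{p, q}\<close>-element of order divisible by \<open>p q\<close> in a quotient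
  lifts to such an element of \<open>G\<close>, so by minimality proper quotients contain none. Hence \<open>F = P \<times> Q\<close> for its
  Sylow subgroups \<open>P\<close>, \<open>Q\<close>, which are minimal normal in \<open>G\<close>, and \<open>p\<close>-elements outside \<open>F\<close> act
  fixed-point-freely on \<open>Q\<close>, \<open>q\<close>-elements on \<open>P\<close>. As \<open>P\<close> lies in \<open>F\<close> it has no complement; averaging
  arguments (crossed homomorphisms built from coset representatives) would provide one if a normal
  \<open>p'\<close>-section acted on \<open>P\<close> without fixed points, or if \<open>P\<close> had a complement in a subgroup of index prime to
  \<open>p\<close>. This gives \<open>C\<^sub>G(P) = F = C\<^sub>G(Q)\<close> and excludes normal subgroups \<open>L\<close> with \<open>F < L < G\<close>: for \<open>p\<close> odd, the
  Sylow \<open>p\<close>-subgroups of \<open>G / F\<close> are cyclic because they act fixed-point-freely, which forces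
  \<open>|G : L|\<close> to be prime to \<open>p q\<close>, and then \<open>F\<close> lies in the Frattini subgroup of \<open>L\<close>, against minimality.
  A vanishing second cohomology group would again split off \<open>P\<close> or \<open>Q\<close>.\<close>

text \<open>Emptiness of \<open>Omega_star_star\<close> means that every {p, q}-element of order
  divisible by p q lies in F. As \<open>Omega\<close> is nonempty, some power of an element has
  order exactly p q, so F contains commuting elements of orders p and q. All Sylow subgroups of F
  are normal in G, and for a third prime r these two elements would survive in the quotient by the
  Sylow r-subgroup; this is why F = P x Q. Minimality enters twice: for proper quotients, and for a
  proper normal subgroup L above F, where it yields a {p, q}-element that lies in F but not in
  Frat(L). To contradict the latter one needs P and Q inside Frat(L). Now P meets Frat(L) in 1 or P,
  and 1 would give a complement of P in L, which Gaschuetz's theorem carries up to G only if |G : L|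
  is prime to p. This obstacle forces the detour through Sylow subgroups, and it is where oddness
  enters: generalized quaternion groups can act fixed-point-freely without being cyclic.\<close>

context group
begin

definition conj_by :: "'a \<Rightarrow> 'a \<Rightarrow> 'a" where
  "conj_by g x = g \<otimes> x \<otimes> inv g"

lemma conj_by_closed [simp]: "g \<in> carrier G \<Longrightarrow> x \<in> carrier G \<Longrightarrow> conj_by g x \<in> carrier G"
  by (simp add: conj_by_def)

lemma mult_cancel_inv [simp]:
  assumes "x \<in> carrier G" "y \<in> carrier G"
  shows "inv x \<otimes> (x \<otimes> y) = y" "x \<otimes> (inv x \<otimes> y) = y"
  using assms by (simp_all flip: m_assoc)

lemma conj_by_mult:
  "g \<in> carrier G \<Longrightarrow> x \<in> carrier G \<Longrightarrow> y \<in> carrier G \<Longrightarrow>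
     conj_by g (x \<otimes> y) = conj_by g x \<otimes> conj_by g y"
  by (simp add: conj_by_def m_assoc)

lemma conj_by_one [simp]: "g \<in> carrier G \<Longrightarrow> conj_by g \<one> = \<one>"
  by (simp add: conj_by_def)

lemma one_conj_by [simp]: "x \<in> carrier G \<Longrightarrow> conj_by \<one> x = x"
  by (simp add: conj_by_def)

lemma conj_by_mult_left:
  "g \<in> carrier G \<Longrightarrow> h \<in> carrier G \<Longrightarrow> x \<in> carrier G \<Longrightarrow>
     conj_by (g \<otimes> h) x = conj_by g (conj_by h x)"
  by (simp add: conj_by_def m_assoc inv_mult_group)

lemma conj_by_inv:
  "g \<in> carrier G \<Longrightarrow> x \<in> carrier G \<Longrightarrow> conj_by g (inv x) = inv (conj_by g x)"
  by (simp add: conj_by_def m_assoc inv_mult_group)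

lemma conj_by_inv_conj_by [simp]:
  "g \<in> carrier G \<Longrightarrow> x \<in> carrier G \<Longrightarrow> conj_by (inv g) (conj_by g x) = x"
  "g \<in> carrier G \<Longrightarrow> x \<in> carrier G \<Longrightarrow> conj_by g (conj_by (inv g) x) = x"
  by (simp_all add: conj_by_def m_assoc)

lemma mult_eq_conj_by:
  "g \<in> carrier G \<Longrightarrow> x \<in> carrier G \<Longrightarrow> g \<otimes> x = conj_by g x \<otimes> g"
  by (simp add: conj_by_def m_assoc)

lemma conj_by_eq_iff:
  "g \<in> carrier G \<Longrightarrow> x \<in> carrier G \<Longrightarrow> conj_by g x = x \<longleftrightarrow> g \<otimes> x = x \<otimes> g"
  by (metis conj_by_closed mult_eq_conj_by right_cancel)

lemma conj_by_inj:
  "g \<in> carrier G \<Longrightarrow> x \<in> carrier G \<Longrightarrow> y \<in> carrier G \<Longrightarrow> conj_by g x = conj_by g y \<longleftrightarrow> x = y"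
  by (metis conj_by_inv_conj_by(1))

lemma conj_by_pow:
  "g \<in> carrier G \<Longrightarrow> x \<in> carrier G \<Longrightarrow> conj_by g x [^] (n::nat) = conj_by g (x [^] n)"
  by (induction n) (simp_all add: conj_by_mult)

lemma normal_conj_by:
  "N \<lhd> G \<Longrightarrow> g \<in> carrier G \<Longrightarrow> x \<in> N \<Longrightarrow> conj_by g x \<in> N"
  unfolding conj_by_def by (rule normal.inv_op_closed2)

lemma normal_conj_byI:
  "subgroup N G \<Longrightarrow> (\<And>g x. g \<in> carrier G \<Longrightarrow> x \<in> N \<Longrightarrow> conj_by g x \<in> N) \<Longrightarrow> N \<lhd> G"
  unfolding conj_by_def by (rule normal_invI)

end

lemma (in comm_group) hom_finprod:
  assumes "comm_group H" "h \<in> hom G H" "f \<in> A \<rightarrow> carrier G"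
  shows "h (finprod G f A) = finprod H (\<lambda>x. h (f x)) A"
proof -
  interpret H: comm_group H by fact
  have one: "h \<one> = \<one>\<^bsub>H\<^esub>" using assms(2) by (simp add: hom_one)
  show ?thesis
  proof (cases "finite A")
    case True
    then show ?thesis using assms(3)
    proof (induction A)
      case empty
      then show ?case using one by simp
    next
      case (insert a A)
      have "(\<lambda>x. h (f x)) \<in> A \<rightarrow> carrier H" "h (f a) \<in> carrier H"
        using insert.prems assms(2) by (auto simp: hom_def)
      then show ?case
        using insert assms(2) by (simp add: hom_mult Pi_iff)
    qed
  qed (simp add: one)
qed

section \<open>Complements from crossed homomorphisms\<close>

definition is_complement :: "('a, 'm) monoid_scheme \<Rightarrow> 'a set \<Rightarrow> 'a set \<Rightarrow> bool" where
  "is_complement G P H \<longleftrightarrow> subgroup H G \<and> P \<inter> H = {\<one>\<^bsub>G\<^esub>} \<and>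
     (\<forall>g\<in>carrier G. \<exists>a\<in>P. \<exists>h\<in>H. g = a \<otimes>\<^bsub>G\<^esub> h)"

text \<open>These are the 1-cocycles of the conjugation action. The two factors stand in the order
  in which the P-components of products arise below; for abelian P the order is immaterial.\<close>

definition crossed_hom :: "('a, 'm) monoid_scheme \<Rightarrow> 'a set \<Rightarrow> ('a \<Rightarrow> 'a) \<Rightarrow> bool" where
  "crossed_hom G P c \<longleftrightarrow> c \<in> carrier G \<rightarrow> P \<and>
     (\<forall>g\<in>carrier G. \<forall>h\<in>carrier G. c (g \<otimes>\<^bsub>G\<^esub> h) = group.conj_by G g (c h) \<otimes>\<^bsub>G\<^esub> c g)"

locale abelian_normal = normal P G for P and G (structure) +
  assumes finite_carrier: "finite (carrier G)"
    and commute: "\<And>a b. a \<in> P \<Longrightarrow> b \<in> P \<Longrightarrow> a \<otimes> b = b \<otimes> a"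
begin

lemma finite_P: "finite P"
  using finite_carrier subset finite_subset by blast

lemma comm_group_P: "comm_group (G\<lparr>carrier := P\<rparr>)"
  by (rule group.group_comm_groupI[OF subgroup_is_group[OF is_group]]) (simp add: commute)

lemma conj_P [simp]: "g \<in> carrier G \<Longrightarrow> a \<in> P \<Longrightarrow> conj_by g a \<in> P"
  using normal_conj_by normal_axioms by blast

lemma conj_P_trivial [simp]: "g \<in> P \<Longrightarrow> a \<in> P \<Longrightarrow> conj_by g a = a"
  by (simp add: conj_by_eq_iff commute)

lemma conj_hom: "g \<in> carrier G \<Longrightarrow> conj_by g \<in> hom (G\<lparr>carrier := P\<rparr>) (G\<lparr>carrier := P\<rparr>)"
  by (auto simp: hom_def conj_by_mult)

text \<open>The quotient of two elements with equal m-th powers has an order dividing both m and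
  |P|.\<close>

lemma pow_inj_on:
  assumes "coprime m (card P)"
  shows "inj_on (\<lambda>a. a [^] (m::nat)) P"
proof (rule inj_onI)
  fix a b assume ab: "a \<in> P" "b \<in> P" "a [^] m = b [^] m"
  let ?d = "a \<otimes> inv b"
  have dP: "?d \<in> P" using ab by simp
  have "?d [^] m = a [^] m \<otimes> inv b [^] m"
    using ab by (intro pow_mult_distrib) (simp_all add: commute)
  also have "\<dots> = \<one>"
    using ab by (simp add: nat_pow_inv)
  finally have "ord ?d dvd m"
    using ab pow_eq_id[of ?d m] by simp
  moreover have "?d [^] card P = \<one>"
    using group.pow_order_eq_1[OF subgroup_is_group[OF is_group], of ?d] dP
    by (simp add: order_def flip: nat_pow_consistent)
  then have "ord ?d dvd card P"
    using ab pow_eq_id[of ?d "card P"] by simp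
  ultimately have "ord ?d = 1"
    using assms coprime_common_divisor_nat[of m "card P" "ord ?d"] by simp
  then have "?d = \<one>" using ab ord_eq_1[of ?d] by simp
  moreover have "a = ?d \<otimes> b" using ab by (simp add: m_assoc)
  ultimately show "a = b" using ab by simp
qed

text \<open>On P the conjugation action is trivial, so c restricts to an endomorphism of the finite
  group P, and injectivity makes it bijective there. The complement is the kernel {g | c g = 1}, a
  subgroup although c need not be a homomorphism.\<close>

lemma crossed_hom_complement:
  assumes c: "crossed_hom G P c" and inj: "inj_on c P"
  shows "\<exists>H. is_complement G P H"
proof -
  have cl: "c g \<in> P" if "g \<in> carrier G" for g
    using c that by (auto simp: crossed_hom_def)
  have cm: "c (g \<otimes> h) = conj_by g (c h) \<otimes> c g" if "g \<in> carrier G" "h \<in> carrier G" for g h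
    using c that by (auto simp: crossed_hom_def)
  have c1: "c \<one> = \<one>"
    using cm[of \<one> \<one>, symmetric] cl[of \<one>] by simp
  let ?H = "{g \<in> carrier G. c g = \<one>}"
  have sub: "subgroup ?H G"
  proof (rule subgroupI)
    fix a assume a: "a \<in> ?H"
    have "conj_by (inv a) (c a) \<otimes> c (inv a) = \<one>"
      using cm[of "inv a" a, symmetric] a c1 by simp
    then show "inv a \<in> ?H" using a cl[of "inv a"] by simp
  next
    show "?H \<noteq> {}" using c1 by auto
  next
    fix a b assume "a \<in> ?H" "b \<in> ?H"
    then show "a \<otimes> b \<in> ?H" by (simp add: cm)
  qed blast
  have surj: "c ` P = P"
  proof (rule endo_inj_surj[OF finite_P _ inj])
    show "c ` P \<subseteq> P"
      using cl mem_carrier by blast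
  qed
  have "P \<inter> ?H = {\<one>}"
  proof -
    have "x = \<one>" if "x \<in> P" "c x = \<one>" for x
      using inj_onD[OF inj, of x \<one>] that c1 by simp
    then have "P \<inter> ?H \<subseteq> {\<one>}" by fast
    then show ?thesis using c1 subgroup.one_closed[OF subgroup_axioms] by fast
  qed
  moreover have "\<exists>a\<in>P. \<exists>h\<in>?H. g = a \<otimes> h" if g: "g \<in> carrier G" for g
  proof -
    \<comment> \<open>Multiplying g on the left by a in P multiplies c g by c a, so choosing c a
      inverse to c g moves g into the kernel.\<close>
    obtain a where a: "a \<in> P" "c a = inv (c g)"
      using surj m_inv_closed[OF cl[OF g]] by (metis imageE)
    have "c (a \<otimes> g) = \<one>"
      using a g cl[OF g] by (simp add: cm)
    moreover have "g = inv a \<otimes> (a \<otimes> g)" using a g by simp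
    ultimately show ?thesis
      using a g by (intro bexI[of _ "inv a"] bexI[of _ "a \<otimes> g"]) auto
  qed
  ultimately show ?thesis using sub unfolding is_complement_def by blast
qed

text \<open>The factors \<open>b g (act h i)\<close> are the factors \<open>b g i\<close> in another
  order, since h permutes I; commutativity of P lets the product absorb the permutation.\<close>

lemma crossed_hom_prod:
  assumes fin: "finite I"
    and act: "\<And>g i. g \<in> carrier G \<Longrightarrow> i \<in> I \<Longrightarrow> act g i \<in> I"
      "\<And>i. i \<in> I \<Longrightarrow> act \<one> i = i"
      "\<And>g h i. g \<in> carrier G \<Longrightarrow> h \<in> carrier G \<Longrightarrow> i \<in> I \<Longrightarrow> act (g \<otimes> h) i = act g (act h i)"
    and b: "\<And>g i. g \<in> carrier G \<Longrightarrow> i \<in> I \<Longrightarrow> b g i \<in> P"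
      "\<And>g h i. g \<in> carrier G \<Longrightarrow> h \<in> carrier G \<Longrightarrow> i \<in> I \<Longrightarrow>
         b (g \<otimes> h) i = conj_by g (b h i) \<otimes> b g (act h i)"
  shows "crossed_hom G P (\<lambda>g. finprod (G\<lparr>carrier := P\<rparr>) (b g) I)"
proof -
  interpret P: comm_group "G\<lparr>carrier := P\<rparr>" by (rule comm_group_P)
  have "finprod (G\<lparr>carrier := P\<rparr>) (b (g \<otimes> h)) I =
      conj_by g (finprod (G\<lparr>carrier := P\<rparr>) (b h) I) \<otimes> finprod (G\<lparr>carrier := P\<rparr>) (b g) I"
    if gh: "g \<in> carrier G" "h \<in> carrier G" for g h
  proof -
    have bij: "inj_on (act h) I" "act h ` I = I"
    proof -
      have "act (inv h) (act h i) = i" if "i \<in> I" for i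
        using gh that act(3)[of "inv h" h i] by (simp add: act(2))
      then show inj: "inj_on (act h) I" by (rule inj_on_inverseI)
      show "act h ` I = I"
        using inj fin gh act(1) by (intro endo_inj_surj) auto
    qed
    have "finprod (G\<lparr>carrier := P\<rparr>) (b (g \<otimes> h)) I =
        finprod (G\<lparr>carrier := P\<rparr>) (\<lambda>i. conj_by g (b h i) \<otimes>\<^bsub>G\<lparr>carrier := P\<rparr>\<^esub> b g (act h i)) I"
      by (rule P.finprod_cong') (use gh act b in auto)
    also have "\<dots> = finprod (G\<lparr>carrier := P\<rparr>) (\<lambda>i. conj_by g (b h i)) I \<otimes>
        finprod (G\<lparr>carrier := P\<rparr>) (\<lambda>i. b g (act h i)) I"
      using gh act b P.finprod_multf[of "\<lambda>i. conj_by g (b h i)" I "\<lambda>i. b g (act h i)"] by auto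
    also have "finprod (G\<lparr>carrier := P\<rparr>) (\<lambda>i. conj_by g (b h i)) I =
        conj_by g (finprod (G\<lparr>carrier := P\<rparr>) (b h) I)"
      using P.hom_finprod[OF comm_group_P conj_hom[OF gh(1)], of "b h" I] gh b by auto
    also have "finprod (G\<lparr>carrier := P\<rparr>) (\<lambda>i. b g (act h i)) I = finprod (G\<lparr>carrier := P\<rparr>) (b g) I"
      using P.finprod_reindex[of "b g" "act h" I] bij gh act b by auto
    finally show ?thesis .
  qed
  moreover have "finprod (G\<lparr>carrier := P\<rparr>) (b g) I \<in> P" if "g \<in> carrier G" for g
    using P.finprod_closed[of "b g" I] b that by auto
  ultimately show ?thesis unfolding crossed_hom_def by blast
qed

end

text \<open>Representatives are chosen for all of G, but counted only within Y, so that one lemma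
  serves transversals in G and in a subgroup.\<close>

lemma (in group) left_transversal:
  assumes U: "subgroup U G" and Y: "subgroup Y G" "U \<subseteq> Y" and fin: "finite Y"
  obtains rep where
    "\<And>x. x \<in> carrier G \<Longrightarrow> rep x \<in> carrier G" "\<And>x. x \<in> carrier G \<Longrightarrow> inv (rep x) \<otimes> x \<in> U"
    "\<And>x h. x \<in> carrier G \<Longrightarrow> h \<in> U \<Longrightarrow> rep (x \<otimes> h) = rep x"
    "card (rep ` Y) * card U = card Y"
proof -
  interpret U: subgroup U G by fact
  interpret Y: subgroup Y G by fact
  \<comment> \<open>The choice depends on the coset alone, which makes \<open>rep\<close> constant
    on left cosets of U.\<close>
  define rep where "rep x = (SOME y. y \<in> x <# U)" for x
  have rep: "rep x \<in> x <# U" if "x \<in> carrier G" for x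
  proof -
    have "x \<otimes> \<one> \<in> x <# U" unfolding l_coset_def using U.one_closed by fast
    then show ?thesis unfolding rep_def by (rule someI)
  qed
  have ex: "\<exists>h\<in>U. rep x = x \<otimes> h" if "x \<in> carrier G" for x
    using rep[OF that] by (auto simp: l_coset_def)
  have cl: "rep x \<in> carrier G" if "x \<in> carrier G" for x
    using ex[OF that] that by auto
  have inU: "inv (rep x) \<otimes> x \<in> U" if "x \<in> carrier G" for x
    using ex[OF that] that by (auto simp: inv_mult_group m_assoc)
  have const: "rep (x \<otimes> h) = rep x" if "x \<in> carrier G" "h \<in> U" for x h
  proof -
    have "(x \<otimes> h) <# U = x <# (h <# U)"
      using that by (simp add: lcos_m_assoc U.subset)
    also have "h <# U = U" using that U by (simp add: coset_join3)
    finally show ?thesis by (simp add: rep_def)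
  qed
  have repY: "rep y \<in> Y" if "y \<in> Y" for y
    using ex[of y] that Y(2) by auto
  have rep_rep: "rep (rep x) = rep x" if "x \<in> carrier G" for x
    using ex[OF that] const that by metis
  have "bij_betw (\<lambda>(i, h). i \<otimes> h) (rep ` Y \<times> U) Y"
    unfolding bij_betw_def
  proof
    show "inj_on (\<lambda>(i, h). i \<otimes> h) (rep ` Y \<times> U)"
    proof (rule inj_onI, clarsimp)
      fix y h y' h' assume *: "y \<in> Y" "h \<in> U" "y' \<in> Y" "h' \<in> U" "rep y \<otimes> h = rep y' \<otimes> h'"
      then have "rep y = rep y'"
        using const[of "rep y" h] const[of "rep y'" h'] cl by (simp add: rep_rep)
      then show "rep y = rep y' \<and> h = h'" using * cl by simp
    qed
    show "(\<lambda>(i, h). i \<otimes> h) ` (rep ` Y \<times> U) = Y"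
    proof (intro equalityI subsetI)
      fix y assume y: "y \<in> Y"
      then have "y = rep y \<otimes> (inv (rep y) \<otimes> y)" using cl by simp
      then show "y \<in> (\<lambda>(i, h). i \<otimes> h) ` (rep ` Y \<times> U)"
        using y inU by (intro image_eqI[of _ _ "(rep y, inv (rep y) \<otimes> y)"]) auto
    next
      fix z assume "z \<in> (\<lambda>(i, h). i \<otimes> h) ` (rep ` Y \<times> U)"
      then obtain y h where "y \<in> Y" "h \<in> U" "z = rep y \<otimes> h" by auto
      then show "z \<in> Y" using Y.m_closed[OF repY subsetD[OF Y(2)]] by simp
    qed
  qed
  then have "card (rep ` Y \<times> U) = card Y" by (rule bij_betw_same_card)
  then have "card (rep ` Y) * card U = card Y" by (simp add: card_cartesian_product)
  with cl inU const show ?thesis by (rule that)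
qed

context abelian_normal
begin

lemma card_P_pos: "0 < card P"
  using finite_imp_card_positive[OF finite_carrier] .

text \<open>For coset representatives \<open>k\<close> of \<open>P\<close> in \<open>L\<close> write \<open>g k g\<^sup>-\<^sup>1 = b(g, k) k'\<close> with \<open>k'\<close> again a representative.
  The product over \<open>k\<close> of \<open>b(g, k)\<close> is a crossed homomorphism; on \<open>a \<in> P\<close> its value is
  \<open>a\<^sup>m\<close>, \<open>m = |L : P|\<close>, times a norm of \<open>a\<^sup>-\<^sup>1\<close>, which is fixed by \<open>L\<close> and therefore trivial.\<close>

lemma complement_of_no_fixed_points:
  assumes L: "L \<lhd> G" "P \<subseteq> L" and cop: "coprime (card L div card P) (card P)"
    and fixed: "\<And>a. a \<in> P \<Longrightarrow> (\<And>l. l \<in> L \<Longrightarrow> conj_by l a = a) \<Longrightarrow> a = \<one>"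
  shows "\<exists>H. is_complement G P H"
proof -
  interpret P: comm_group "G\<lparr>carrier := P\<rparr>" by (rule comm_group_P)
  have subL: "subgroup L G" using L(1) by (rule normal_imp_subgroup)
  interpret L: subgroup L G by (rule subL)
  have finL: "finite L" using finite_carrier L.subset finite_subset by blast
  obtain rep where cl: "\<And>x. x \<in> carrier G \<Longrightarrow> rep x \<in> carrier G"
    and inP: "\<And>x. x \<in> carrier G \<Longrightarrow> inv (rep x) \<otimes> x \<in> P"
    and const: "\<And>x h. x \<in> carrier G \<Longrightarrow> h \<in> P \<Longrightarrow> rep (x \<otimes> h) = rep x"
    and card: "card (rep ` L) * card P = card L"
    using left_transversal[OF subgroup_axioms subL L(2) finL] by metis
  \<comment> \<open>The component of x to the left of its representative; normality of P turns the
    left transversal into a right one.\<close>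
  define b where "b x = x \<otimes> inv (rep x)" for x
  have b: "b x \<in> P" if "x \<in> carrier G" for x
  proof -
    have "b x = conj_by (rep x) (inv (rep x) \<otimes> x)"
      using that cl by (simp add: b_def conj_by_def m_assoc)
    then show ?thesis using inP cl that by simp
  qed
  have brep: "x = b x \<otimes> rep x" if "x \<in> carrier G" for x
    using that cl by (simp add: b_def m_assoc)
  have constl: "rep (a \<otimes> x) = rep x" if "x \<in> carrier G" "a \<in> P" for a x
  proof -
    have "a \<otimes> x = x \<otimes> conj_by (inv x) a"
      using that by (simp add: conj_by_def m_assoc)
    then show ?thesis using const that by simp
  qed
  have rep_rep: "rep (rep x) = rep x" if "x \<in> carrier G" for x
    using constl[of "rep x" "b x"] brep[OF that] b cl that by simp
  have uniq: "b (a \<otimes> rep x) = a" if "x \<in> carrier G" "a \<in> P" for a x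
    using that cl constl[of "rep x" a] by (simp add: b_def rep_rep m_assoc)
  have repL: "rep x \<in> L" if "x \<in> L" for x
  proof -
    have "rep x = inv (b x) \<otimes> x" using that brep[of x] b[of x] cl[of x]
      by (metis L.mem_carrier inv_solve_left mem_carrier)
    then show ?thesis using that b[of x] L(2) by auto
  qed
  define I where "I = rep ` L"
  \<comment> \<open>G permutes the representatives of P in L by conjugating and then discarding the
    P-component.\<close>
  define act where "act g k = rep (conj_by g k)" for g k
  define c where "c g = finprod (G\<lparr>carrier := P\<rparr>) (\<lambda>k. b (conj_by g k)) I" for g
  have I: "k \<in> L" "rep k = k" "k \<in> carrier G" if "k \<in> I" for k
    using that repL rep_rep by (auto simp: I_def)
  have actI: "act g k \<in> I" if "g \<in> carrier G" "k \<in> I" for g k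
    using that I(1) normal_conj_by[OF L(1)] by (auto simp: act_def I_def)
  have split: "conj_by g k = b (conj_by g k) \<otimes> act g k" if "g \<in> carrier G" "k \<in> carrier G" for g k
    using brep[of "conj_by g k"] that by (simp add: act_def)
  have mult: "conj_by (g \<otimes> h) k =
      (conj_by g (b (conj_by h k)) \<otimes> b (conj_by g (act h k))) \<otimes> act g (act h k)"
    if "g \<in> carrier G" "h \<in> carrier G" "k \<in> I" for g h k
  proof -
    have a: "act h k \<in> carrier G" using that actI I(3) by blast
    have "conj_by (g \<otimes> h) k = conj_by g (b (conj_by h k) \<otimes> act h k)"
      using that I(3) by (simp add: conj_by_mult_left flip: split)
    also have "\<dots> = conj_by g (b (conj_by h k)) \<otimes> conj_by g (act h k)"
      using that I(3) a b by (simp add: conj_by_mult)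
    also have "conj_by g (act h k) = b (conj_by g (act h k)) \<otimes> act g (act h k)"
      using split[OF that(1) a] .
    finally show ?thesis
      using that I(3) a b actI by (simp add: m_assoc)
  qed
  have act_mult: "act (g \<otimes> h) k = act g (act h k)"
    and b_mult: "b (conj_by (g \<otimes> h) k) = conj_by g (b (conj_by h k)) \<otimes> b (conj_by g (act h k))"
    if "g \<in> carrier G" "h \<in> carrier G" "k \<in> I" for g h k
  proof -
    let ?p = "conj_by g (b (conj_by h k)) \<otimes> b (conj_by g (act h k))"
    have p: "?p \<in> P" using that I(3) actI b by simp
    have "act g (act h k) \<in> I" using that actI by simp
    then have r: "act g (act h k) = rep (act g (act h k))" "act g (act h k) \<in> carrier G" using I by simp_all
    show "act (g \<otimes> h) k = act g (act h k)"
      unfolding act_def[of "g \<otimes> h" k] mult[OF that] using constl[OF r(2) p] r(1) by simp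
    show "b (conj_by (g \<otimes> h) k) = ?p"
      unfolding mult[OF that] using uniq[OF r(2) p] r(1) by simp
  qed
  have crossed: "crossed_hom G P c"
    unfolding c_def
  proof (rule crossed_hom_prod[where act = act])
    show "finite I" using finL by (simp add: I_def)
    show "act \<one> k = k" if "k \<in> I" for k using I that by (simp add: act_def)
  qed (use actI act_mult b_mult b I in auto)
  have cP: "c a = a [^] card I" if a: "a \<in> P" for a
  proof -
    let ?t = "finprod (G\<lparr>carrier := P\<rparr>) (\<lambda>k. conj_by k (inv a)) I"
    have clos: "(\<lambda>k. conj_by k (inv a)) \<in> I \<rightarrow> P"
      using a I by auto
    have t: "?t \<in> P" using P.finprod_closed[of "\<lambda>k. conj_by k (inv a)" I] clos by simp
    \<comment> \<open>Left multiplication by l permutes the cosets of P in L, and the P-components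
      that this produces act trivially because P is abelian; so \<open>?t\<close> is fixed by
      L.\<close>
    have "?t = \<one>"
    proof (rule fixed[OF t])
      fix l assume l: "l \<in> L"
      have lk: "conj_by (rep (l \<otimes> k)) (inv a) = conj_by l (conj_by k (inv a))" if "k \<in> I" for k
      proof -
        have k: "l \<otimes> k \<in> carrier G" "k \<in> carrier G" using that l I by auto
        have "conj_by (l \<otimes> k) (inv a) = conj_by (b (l \<otimes> k)) (conj_by (rep (l \<otimes> k)) (inv a))"
          using brep[OF k(1)] conj_by_mult_left[of "b (l \<otimes> k)" "rep (l \<otimes> k)" "inv a"] b[OF k(1)] cl[OF k(1)] a
          by simp
        also have "\<dots> = conj_by (rep (l \<otimes> k)) (inv a)"
          using b[OF k(1)] cl[OF k(1)] a by simp
        finally show ?thesis using k l a by (simp add: conj_by_mult_left)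
      qed
      have inj: "inj_on (\<lambda>k. rep (l \<otimes> k)) I"
      proof (rule inj_on_inverseI[of _ "\<lambda>k. rep (inv l \<otimes> k)"])
        fix k assume k: "k \<in> I"
        then have lk: "l \<otimes> k \<in> carrier G" using l I by auto
        have "rep (inv l \<otimes> rep (l \<otimes> k)) = rep (inv l \<otimes> (inv (b (l \<otimes> k)) \<otimes> (b (l \<otimes> k) \<otimes> rep (l \<otimes> k))))"
          using b[OF lk] cl[OF lk] by simp
        also have "\<dots> = rep (inv l \<otimes> (inv (b (l \<otimes> k)) \<otimes> (l \<otimes> k)))"
          by (simp flip: brep[OF lk])
        also have "\<dots> = rep (conj_by (inv l) (inv (b (l \<otimes> k))) \<otimes> k)"
          using k l I b[OF lk] by (simp add: conj_by_def m_assoc)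
        also have "\<dots> = k"
          using k l I b[OF lk] by (simp add: constl)
        finally show "rep (inv l \<otimes> rep (l \<otimes> k)) = k" .
      qed
      have sub: "(\<lambda>k. rep (l \<otimes> k)) ` I \<subseteq> I"
      proof (rule image_subsetI)
        fix k assume "k \<in> I"
        then have "l \<otimes> k \<in> L" using l I(1) by simp
        then show "rep (l \<otimes> k) \<in> I" unfolding I_def by (rule imageI)
      qed
      have img: "(\<lambda>k. rep (l \<otimes> k)) ` I = I"
        using endo_inj_surj[OF _ sub inj] finL by (simp add: I_def)
      have "conj_by l ?t = finprod (G\<lparr>carrier := P\<rparr>) (\<lambda>k. conj_by l (conj_by k (inv a))) I"
        using P.hom_finprod[OF comm_group_P conj_hom, of l "\<lambda>k. conj_by k (inv a)" I] clos l by simp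
      also have "\<dots> = finprod (G\<lparr>carrier := P\<rparr>) (\<lambda>k. conj_by (rep (l \<otimes> k)) (inv a)) I"
      proof (rule P.finprod_cong')
        show "(\<lambda>k. conj_by (rep (l \<otimes> k)) (inv a)) \<in> I \<rightarrow> carrier (G\<lparr>carrier := P\<rparr>)"
          using clos sub by (simp add: Pi_iff image_subset_iff)
      qed (auto simp: lk)
      also have "\<dots> = ?t"
        using P.finprod_reindex[of "\<lambda>k. conj_by k (inv a)" "\<lambda>k. rep (l \<otimes> k)" I] inj img clos by simp
      finally show "conj_by l ?t = ?t" .
    qed
    \<comment> \<open>This is a k a^-1 = (a (k a^-1 k^-1)) k, where k is already a
      representative.\<close>
    have "b (conj_by a k) = a \<otimes> conj_by k (inv a)" if "k \<in> I" for k
    proof -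
      have "conj_by a k = (a \<otimes> conj_by k (inv a)) \<otimes> rep k"
        using a I[OF that] by (simp add: conj_by_def m_assoc)
      then show ?thesis using uniq[of k "a \<otimes> conj_by k (inv a)"] a I[OF that] by simp
    qed
    then have "c a = finprod (G\<lparr>carrier := P\<rparr>) (\<lambda>k. a \<otimes>\<^bsub>G\<lparr>carrier := P\<rparr>\<^esub> conj_by k (inv a)) I"
      unfolding c_def by (intro P.finprod_cong') (use a I clos in auto)
    also have "\<dots> = finprod (G\<lparr>carrier := P\<rparr>) (\<lambda>k. a) I \<otimes> ?t"
      using P.finprod_multf[of "\<lambda>_. a" I "\<lambda>k. conj_by k (inv a)"] a clos by simp
    also have "finprod (G\<lparr>carrier := P\<rparr>) (\<lambda>k. a) I = a [^] card I"
      using P.finprod_const[of a I] a by (simp flip: nat_pow_consistent)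
    finally show ?thesis using \<open>?t = \<one>\<close> a by simp
  qed
  have "card I = card L div card P"
    using card card_P_pos by (metis I_def div_mult_self_is_m)
  then have "inj_on (\<lambda>a. a [^] card I) P" using cop pow_inj_on by simp
  then have "inj_on c P" using cP by (simp cong: inj_on_cong)
  with crossed show ?thesis by (rule crossed_hom_complement)
qed

text \<open>Here \<open>g r = b(g, r) r' k\<close> with \<open>r, r'\<close> representatives of the left cosets of \<open>U\<close> in \<open>G\<close> and \<open>k \<in> K\<close>, and the
  crossed homomorphism that is the product of the \<open>b(g, r)\<close> takes the value \<open>a\<^sup>m\<close>, \<open>m = |G : U|\<close>, on \<open>a \<in> P\<close>.\<close>

theorem gaschuetz_complement:
  assumes U: "subgroup U G" "P \<subseteq> U" and cop: "coprime (order G div card U) (card P)"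
    and K: "is_complement (G\<lparr>carrier := U\<rparr>) P K"
  shows "\<exists>H. is_complement G P H"
proof -
  interpret P: comm_group "G\<lparr>carrier := P\<rparr>" by (rule comm_group_P)
  interpret U: subgroup U G by (rule U(1))
  have subK: "subgroup K G" and PK: "P \<inter> K = {\<one>}"
    and UPK: "\<And>x. x \<in> U \<Longrightarrow> \<exists>a\<in>P. \<exists>k\<in>K. x = a \<otimes> k"
    using K incl_subgroup[OF U(1)] by (simp_all add: is_complement_def)
  interpret K: subgroup K G by (rule subK)

  obtain rep where cl: "\<And>x. x \<in> carrier G \<Longrightarrow> rep x \<in> carrier G"
    and inU: "\<And>x. x \<in> carrier G \<Longrightarrow> inv (rep x) \<otimes> x \<in> U"
    and const: "\<And>x h. x \<in> carrier G \<Longrightarrow> h \<in> U \<Longrightarrow> rep (x \<otimes> h) = rep x"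
    and card: "card (rep ` carrier G) * card U = order G"
    using left_transversal[OF U(1) subgroup_self U.subset finite_carrier] unfolding order_def by metis
  \<comment> \<open>\<open>R x a\<close> says that a is the P-component of x, relative to the
    representative to its right and a last factor in K. Existence comes from U = P K and normality
    of P, uniqueness from P meeting K trivially.\<close>
  define R where "R x a \<longleftrightarrow> a \<in> P \<and> (\<exists>k\<in>K. x = a \<otimes> rep x \<otimes> k)" for x a
  have uniq: "a = a'" if R: "R x a" "R x a'" "x \<in> carrier G" for x a a'
  proof -
    obtain k k' where k: "k \<in> K" "k' \<in> K" "x = a \<otimes> rep x \<otimes> k" "x = a' \<otimes> rep x \<otimes> k'"
      and a: "a \<in> P" "a' \<in> P" using R by (auto simp: R_def)
    have r: "rep x \<in> carrier G" using cl that by simp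
    have "inv (rep x) \<otimes> inv a' \<otimes> x = conj_by (inv (rep x)) (inv a' \<otimes> a) \<otimes> k"
      by (subst k(3)) (use k(1,2) a r in \<open>simp add: conj_by_def m_assoc\<close>)
    moreover have "inv (rep x) \<otimes> inv a' \<otimes> x = k'"
      by (subst k(4)) (use k(1,2) a r in \<open>simp add: m_assoc\<close>)
    ultimately have "conj_by (inv (rep x)) (inv a' \<otimes> a) = k' \<otimes> inv k"
      using k(1,2) a r by (metis K.mem_carrier conj_by_closed inv_closed inv_solve_right m_closed mem_carrier)
    moreover have "conj_by (inv (rep x)) (inv a' \<otimes> a) \<in> P" using a r by simp
    ultimately have "conj_by (inv (rep x)) (inv a' \<otimes> a) \<in> P \<inter> K"
      using k(1,2) by simp
    then have "inv a' \<otimes> a = \<one>"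
      using PK a r conj_by_inj[of "inv (rep x)" "inv a' \<otimes> a" \<one>] by simp
    then show ?thesis using a by (metis inv_solve_left' mem_carrier one_closed r_one)
  qed
  have ex: "\<exists>a. R x a" if x: "x \<in> carrier G" for x
  proof -
    obtain a k where ak: "a \<in> P" "k \<in> K" "inv (rep x) \<otimes> x = a \<otimes> k"
      using UPK[OF inU[OF x]] by blast
    have "x = rep x \<otimes> (inv (rep x) \<otimes> x)" using that cl by simp
    also have "\<dots> = conj_by (rep x) a \<otimes> rep x \<otimes> k"
      using ak cl that by (simp add: conj_by_def m_assoc)
    finally show ?thesis using ak cl that unfolding R_def by (meson conj_P)
  qed
  define b where "b x = (THE a. R x a)" for x
  have Rb: "R x (b x)" if "x \<in> carrier G" for x
    unfolding b_def using ex[OF that] uniq that by (metis theI)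
  have b_eq: "b x = a" if "R x a" "x \<in> carrier G" for x a
    using uniq[OF Rb that(1)] that by simp
  have b: "b x \<in> P" if "x \<in> carrier G" for x using Rb[OF that] by (simp add: R_def)
  define I where "I = rep ` carrier G"
  define c where "c g = finprod (G\<lparr>carrier := P\<rparr>) (\<lambda>i. b (g \<otimes> i)) I" for g
  have rep_rep: "rep (rep x) = rep x" if "x \<in> carrier G" for x
    using const[OF cl[OF that] inU[OF that]] that cl by simp
  have I: "i \<in> carrier G" "rep i = i" if "i \<in> I" for i
    using that cl rep_rep by (auto simp: I_def)
  have repI: "rep x \<in> I" if "x \<in> carrier G" for x using that by (simp add: I_def)
  have constl: "rep (g \<otimes> rep x) = rep (g \<otimes> x)" if "g \<in> carrier G" "x \<in> carrier G" for g x
    using const[OF _ inU[OF that(2)], of "g \<otimes> rep x"] that cl by (simp add: m_assoc)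
  have crossed: "crossed_hom G P c"
    unfolding c_def
  proof (rule crossed_hom_prod[where act = "\<lambda>g i. rep (g \<otimes> i)"])
    show "finite I" using finite_carrier by (simp add: I_def)
    fix g h i assume gh: "g \<in> carrier G" "h \<in> carrier G" and i: "i \<in> I"
    then show "rep (g \<otimes> h \<otimes> i) = rep (g \<otimes> rep (h \<otimes> i))"
      using I(1) by (simp add: constl m_assoc)
    obtain k where k: "k \<in> K" "h \<otimes> i = b (h \<otimes> i) \<otimes> rep (h \<otimes> i) \<otimes> k"
      using Rb[of "h \<otimes> i"] gh i I(1) by (auto simp: R_def)
    obtain k' where k': "k' \<in> K"
      "g \<otimes> rep (h \<otimes> i) = b (g \<otimes> rep (h \<otimes> i)) \<otimes> rep (g \<otimes> rep (h \<otimes> i)) \<otimes> k'"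
      using Rb[of "g \<otimes> rep (h \<otimes> i)"] gh i I(1) cl by (auto simp: R_def)
    have cls: "i \<in> carrier G" "rep (h \<otimes> i) \<in> carrier G" "b (h \<otimes> i) \<in> P"
      "b (g \<otimes> rep (h \<otimes> i)) \<in> P" "rep (g \<otimes> h \<otimes> i) \<in> carrier G"
      using gh i I(1) cl b by auto
    have "g \<otimes> h \<otimes> i = g \<otimes> (b (h \<otimes> i) \<otimes> rep (h \<otimes> i) \<otimes> k)"
      using gh cls by (simp add: m_assoc flip: k(2))
    also have "\<dots> = conj_by g (b (h \<otimes> i)) \<otimes> (g \<otimes> rep (h \<otimes> i)) \<otimes> k"
      using gh cls k(1) by (simp add: conj_by_def m_assoc)
    also have "\<dots> = conj_by g (b (h \<otimes> i)) \<otimes> (b (g \<otimes> rep (h \<otimes> i)) \<otimes> rep (g \<otimes> h \<otimes> i) \<otimes> k') \<otimes> k"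
      using k'(2) gh cls by (simp add: constl m_assoc)
    also have "\<dots> = conj_by g (b (h \<otimes> i)) \<otimes> b (g \<otimes> rep (h \<otimes> i)) \<otimes> rep (g \<otimes> h \<otimes> i) \<otimes> (k' \<otimes> k)"
      using gh cls k(1) k'(1) by (simp add: m_assoc)
    finally have "R (g \<otimes> h \<otimes> i) (conj_by g (b (h \<otimes> i)) \<otimes> b (g \<otimes> rep (h \<otimes> i)))"
      unfolding R_def using gh cls k(1) k'(1) by (intro conjI bexI[of _ "k' \<otimes> k"]) simp_all
    then show "b (g \<otimes> h \<otimes> i) = conj_by g (b (h \<otimes> i)) \<otimes> b (g \<otimes> rep (h \<otimes> i))"
      using gh cls by (intro b_eq) auto
  qed (use I repI b in auto)
  have cP: "c a = a [^] card I" if a: "a \<in> P" for a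
  proof -
    have "b (a \<otimes> i) = a" if i: "i \<in> I" for i
    proof (rule b_eq)
      \<comment> \<open>Left multiplication by a fixes the coset of i, because P is normal and
        contained in U; hence the P-component of a i is a, with K-factor 1.\<close>
      have "a \<otimes> i = i \<otimes> conj_by (inv i) a"
        using a I(1)[OF i] by (simp add: conj_by_def m_assoc)
      then have "rep (a \<otimes> i) = i"
        using const[OF I(1)[OF i] subsetD[OF U(2)], of "conj_by (inv i) a"] a I[OF i] by simp
      then show "R (a \<otimes> i) a" unfolding R_def using a I(1)[OF i] by (intro conjI bexI[of _ \<one>]) auto
    qed (use a I(1)[OF i] in auto)
    then have "c a = finprod (G\<lparr>carrier := P\<rparr>) (\<lambda>_. a) I"
      unfolding c_def by (intro P.finprod_cong') (use a in auto)
    also have "\<dots> = a [^] card I"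
      using P.finprod_const[of a I] a by (simp flip: nat_pow_consistent)
    finally show ?thesis .
  qed
  have "0 < card U" using finite_carrier U.finite_imp_card_positive by simp
  then have "card I = order G div card U"
    using card by (metis I_def div_mult_self_is_m)
  then have "inj_on (\<lambda>a. a [^] card I) P" using cop pow_inj_on by simp
  then have "inj_on c P" using cP by (simp cong: inj_on_cong)
  with crossed show ?thesis by (rule crossed_hom_complement)
qed

text \<open>The case U = P, where the trivial group is a complement of P in U.\<close>

corollary schur_zassenhaus_complement:
  assumes "coprime (order G div card P) (card P)"
  shows "\<exists>H. is_complement G P H"
proof (rule gaschuetz_complement[OF subgroup_axioms subset_refl assms])
  interpret P: group "G\<lparr>carrier := P\<rparr>" by (rule subgroup_is_group[OF is_group])
  show "is_complement (G\<lparr>carrier := P\<rparr>) P {\<one>}"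
    unfolding is_complement_def using P.triv_subgroup by auto
qed

end

section \<open>Groups of prime power order\<close>

text \<open>Orbit sizes divide p^k, so every orbit that is not a single fixed point contributes a
  multiple of p. The action is a plain function, so that multiplication of cosets and conjugation
  can be inserted directly.\<close>

lemma (in group) p_group_fixed_points:
  fixes act :: "'a \<Rightarrow> 'c \<Rightarrow> 'c"
  assumes p: "prime p" and ord: "order G = p ^ k" and fin: "finite E"
    and act: "\<And>g x. g \<in> carrier G \<Longrightarrow> x \<in> E \<Longrightarrow> act g x \<in> E" "\<And>x. x \<in> E \<Longrightarrow> act \<one> x = x"
      "\<And>g h x. g \<in> carrier G \<Longrightarrow> h \<in> carrier G \<Longrightarrow> x \<in> E \<Longrightarrow> act (g \<otimes> h) x = act g (act h x)"
  shows "card E mod p = card {x \<in> E. \<forall>g\<in>carrier G. act g x = x} mod p"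
proof -
  define \<phi> where "\<phi> g = (\<lambda>x\<in>E. act g x)" for g
  have bij: "\<phi> g \<in> Bij E" if g: "g \<in> carrier G" for g
  proof -
    have 1: "act (inv g) (act g x) = x" "act g (act (inv g) x) = x" if "x \<in> E" for x
      using act(2)[OF that] act(3)[of "inv g" g x] act(3)[of g "inv g" x] g that by simp_all
    have "bij_betw (act g) E E"
      by (rule bij_betw_byWitness[of _ "act (inv g)"]) (use 1 g act in auto)
    then show ?thesis by (simp add: Bij_def \<phi>_def)
  qed
  have "\<phi> \<in> hom G (BijGroup E)"
  proof (rule homI)
    fix g h assume gh: "g \<in> carrier G" "h \<in> carrier G"
    then show "\<phi> (g \<otimes> h) = \<phi> g \<otimes>\<^bsub>BijGroup E\<^esub> \<phi> h"
      using bij act by (auto simp: BijGroup_def \<phi>_def compose_def fun_eq_iff)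
  qed (simp add: bij BijGroup_def)
  then interpret group_action G E \<phi>
    by (simp add: group_action_def group_hom_def group_hom_axioms_def group_BijGroup)
  let ?Orb = "orbits G E \<phi>" and ?F = "{x \<in> E. \<forall>g\<in>carrier G. act g x = x}"
  have finO: "finite ?Orb" using fin by (simp add: orbits_def)
  have div: "card B = 1 \<or> p dvd card B" if "B \<in> ?Orb" for B
  proof -
    obtain x where x: "x \<in> E" "B = orbit G \<phi> x" using \<open>B \<in> ?Orb\<close> by (auto simp: orbits_def)
    have "card B dvd p ^ k"
      using orbit_stabilizer_theorem[OF x(1)] ord x(2) by (metis dvd_triv_left)
    then obtain i where "card B = p ^ i" using p by (auto simp: divides_primepow_nat)
    then show ?thesis by (cases i) auto
  qed
  have "card E = (\<Sum>B\<in>?Orb. card B)"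
    using disjoint_sum[OF fin, of "\<lambda>_. 1::nat"] by simp
  also have "\<dots> = (\<Sum>B\<in>{B \<in> ?Orb. card B = 1}. card B) + (\<Sum>B\<in>{B \<in> ?Orb. card B \<noteq> 1}. card B)"
    using finO by (subst sum.union_disjoint[symmetric]) (auto intro: sum.cong)
  also have "(\<Sum>B\<in>{B \<in> ?Orb. card B = 1}. card B) = card {B \<in> ?Orb. card B = 1}" by simp
  also have "{B \<in> ?Orb. card B = 1} = (\<lambda>x. {x}) ` ?F"
  proof (intro equalityI subsetI)
    fix B assume B: "B \<in> {B \<in> ?Orb. card B = 1}"
    then obtain x where x: "x \<in> E" "B = orbit G \<phi> x" by (auto simp: orbits_def)
    have "x \<in> B" using x orbit_refl by simp
    then have Bx: "B = {x}" using B by (auto simp: card_1_singleton_iff)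
    have "act g x = x" if "g \<in> carrier G" for g
    proof -
      have "act g x \<in> B" using x that by (auto simp: orbit_def \<phi>_def)
      then show ?thesis using Bx by simp
    qed
    then show "B \<in> (\<lambda>x. {x}) ` ?F" using Bx x by blast
  next
    fix B assume "B \<in> (\<lambda>x. {x}) ` ?F"
    then obtain x where x: "x \<in> E" "\<forall>g\<in>carrier G. act g x = x" "B = {x}" by blast
    then have "orbit G \<phi> x = {x}" using orbit_refl[OF x(1)] by (auto simp: orbit_def \<phi>_def)
    then show "B \<in> {B \<in> ?Orb. card B = 1}" using x by (auto simp: orbits_def)
  qed
  also have "card ((\<lambda>x. {x}) ` ?F) = card ?F" by (rule card_image) simp
  finally have eq: "card E = card ?F + (\<Sum>B\<in>{B \<in> ?Orb. card B \<noteq> 1}. card B)" .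
  have "p dvd (\<Sum>B\<in>{B \<in> ?Orb. card B \<noteq> 1}. card B)" using div by (intro dvd_sum) auto
  then show ?thesis unfolding eq by (auto elim!: dvdE)
qed

section \<open>p-subgroups acting on cosets\<close>

context group
begin

lemma lcosetE:
  assumes "C \<in> lcosets A"
  obtains g where "g \<in> carrier G" "C = g <# A"
  using assms by (auto simp: LCOSETS_def)

lemma lcoset_fixed_iff:
  assumes A: "subgroup A G" and g: "g \<in> carrier G" and h: "h \<in> carrier G"
  shows "h <# (g <# A) = g <# A \<longleftrightarrow> conj_by (inv g) h \<in> A"
proof
  interpret A: subgroup A G by fact
  assume eq: "h <# (g <# A) = g <# A"
  have "h \<otimes> g \<in> (h \<otimes> g) <# A" using g h A by (intro lcos_self) auto
  then have "h \<otimes> g \<in> g <# A" using eq g h A.subset by (simp add: lcos_m_assoc)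
  then obtain a where "a \<in> A" "h \<otimes> g = g \<otimes> a" by (auto simp: l_coset_def)
  then have "conj_by (inv g) h = a" using g h by (simp add: conj_by_def m_assoc)
  then show "conj_by (inv g) h \<in> A" using \<open>a \<in> A\<close> by simp
next
  interpret A: subgroup A G by fact
  assume a: "conj_by (inv g) h \<in> A"
  have "h <# (g <# A) = (h \<otimes> g) <# A" using g h A.subset by (simp add: lcos_m_assoc)
  also have "h \<otimes> g = g \<otimes> conj_by (inv g) h" using g h by (simp add: conj_by_def m_assoc)
  also have "\<dots> <# A = g <# (conj_by (inv g) h <# A)"
    using g h A.subset by (simp add: lcos_m_assoc)
  also have "conj_by (inv g) h <# A = A" using a A g h by (simp add: coset_join3)
  finally show "h <# (g <# A) = g <# A" .
qed

lemma finite_subgroup: "finite (carrier G) \<Longrightarrow> subgroup H G \<Longrightarrow> finite H"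
  using finite_subset subgroup.subset by blast

lemma card_lcosets:
  assumes "finite (carrier G)" "subgroup A G"
  shows "card (lcosets A) = order G div card A" "finite (lcosets A)"
proof -
  have "0 < card A" using assms subgroup.finite_imp_card_positive by blast
  then show "card (lcosets A) = order G div card A"
    using l_lagrange[OF assms] by (metis div_mult_self_is_m)
  show "finite (lcosets A)"
    using lcosets_subset_PowG[OF assms(2)] assms(1) by (simp add: finite_subset)
qed

lemma p_subgroup_lcosets_fixed:
  assumes p: "prime p" and fin: "finite (carrier G)" and A: "subgroup A G"
    and H: "subgroup H G" "card H = p ^ k"
  shows "(order G div card A) mod p =
    card {C \<in> lcosets A. \<forall>h\<in>H. h <# C = C} mod p"
proof -
  interpret A: subgroup A G by fact
  interpret H: subgroup H G by fact
  interpret HG: group "G\<lparr>carrier := H\<rparr>" by (rule H.subgroup_is_group[OF is_group])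
  have "card (lcosets A) mod p =
      card {C \<in> lcosets A. \<forall>h\<in>carrier (G\<lparr>carrier := H\<rparr>). h <# C = C} mod p"
  proof (rule HG.p_group_fixed_points[where act = "l_coset G" and k = k])
    show "prime p" by fact
    show "order (G\<lparr>carrier := H\<rparr>) = p ^ k" using H(2) by (simp add: order_def)
    show "finite (lcosets A)" using card_lcosets(2)[OF fin A] .
  next
    fix h C assume h: "h \<in> carrier (G\<lparr>carrier := H\<rparr>)" and C: "C \<in> lcosets A"
    obtain g where g: "g \<in> carrier G" "C = g <# A" using C by (rule lcosetE)
    then have "h <# C = (h \<otimes> g) <# A" using h A.subset by (simp add: lcos_m_assoc)
    then show "h <# C \<in> lcosets A" using g h by (auto simp: LCOSETS_def)
  next
    fix C assume "C \<in> lcosets A"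
    then obtain g where "g \<in> carrier G" "C = g <# A" by (rule lcosetE)
    then show "\<one>\<^bsub>G\<lparr>carrier := H\<rparr>\<^esub> <# C = C" using A.subset by (simp add: lcos_mult_one l_coset_subset_G)
  next
    fix h h' C assume h: "h \<in> carrier (G\<lparr>carrier := H\<rparr>)" "h' \<in> carrier (G\<lparr>carrier := H\<rparr>)"
      and C: "C \<in> lcosets A"
    have "C \<subseteq> carrier G" using C lcosets_subset_PowG[OF A] by auto
    then show "(h \<otimes>\<^bsub>G\<lparr>carrier := H\<rparr>\<^esub> h') <# C = h <# (h' <# C)"
      using h by (simp add: lcos_m_assoc)
  qed
  then show ?thesis by (simp add: card_lcosets[OF fin A])
qed

text \<open>H acts on the cosets of A, whose number is prime to p, so some coset is fixed, and a
  fixed coset conjugates H into A. This is Sylow conjugacy, except that A need not be a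
  p-group.\<close>

lemma p_subgroup_conj_into:
  assumes p: "prime p" and fin: "finite (carrier G)" and A: "subgroup A G"
    and H: "subgroup H G" "card H = p ^ k" and ndvd: "\<not> p dvd order G div card A"
  obtains g where "g \<in> carrier G" "\<And>h. h \<in> H \<Longrightarrow> conj_by g h \<in> A"
proof -
  have ne: "card {C \<in> lcosets A. \<forall>h\<in>H. h <# C = C} \<noteq> 0"
    using p_subgroup_lcosets_fixed[OF p fin A H] ndvd by (metis dvd_eq_mod_eq_0 mod_0)
  have "{C \<in> lcosets A. \<forall>h\<in>H. h <# C = C} \<noteq> {}"
    using ne by (metis card.empty)
  then obtain C where C: "C \<in> lcosets A" "\<And>h. h \<in> H \<Longrightarrow> h <# C = C" by blast
  obtain g where g: "g \<in> carrier G" "C = g <# A" using C(1) by (rule lcosetE)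
  have "conj_by (inv g) h \<in> A" if "h \<in> H" for h
    using C(2)[OF that] lcoset_fixed_iff[OF A g(1)] subgroup.mem_carrier[OF H(1) that] g(2) by simp
  then show ?thesis using that[of "inv g"] g(1) by simp
qed

text \<open>M acts on its own p left cosets. The number of fixed cosets is a multiple of p and
  positive, as M itself is fixed; hence all are fixed, which says that conjugation by every element
  of G carries M into M.\<close>

lemma p_group_index_p_normal:
  assumes p: "prime p" and ord: "order G = p ^ Suc n" and M: "subgroup M G" "card M = p ^ n"
  shows "M \<lhd> G"
proof -
  interpret M: subgroup M G by fact
  have fin: "finite (carrier G)"
    using ord p by (metis order_gt_0_iff_finite prime_gt_0_nat zero_less_power)
  let ?F = "{C \<in> lcosets M. \<forall>h\<in>M. h <# C = C}"
  have idx: "order G div card M = p" using ord M(2) p by (simp add: prime_gt_0_nat)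
  have finL: "finite (lcosets M)" and cardL: "card (lcosets M) = p"
    using card_lcosets[OF fin M(1)] idx by simp_all
  have "p dvd card ?F"
    using p_subgroup_lcosets_fixed[OF p fin M(1) M] idx by (auto simp: dvd_eq_mod_eq_0)
  moreover have "\<one> <# M \<in> ?F"
    using lcoset_fixed_iff[OF M(1) one_closed] by (auto simp: LCOSETS_def)
  then have "card ?F \<noteq> 0" using finL by auto
  ultimately have "p \<le> card ?F" by (auto dest: dvd_imp_le)
  then have "?F = lcosets M"
    using card_seteq[OF finL, of ?F] cardL by auto
  then have *: "h <# (g <# M) = g <# M" if "g \<in> carrier G" "h \<in> M" for g h
  proof -
    have "g <# M \<in> lcosets M" using that(1) by (auto simp: LCOSETS_def)
    then have "g <# M \<in> ?F" using \<open>?F = lcosets M\<close> by simp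
    then show ?thesis using that(2) by simp
  qed
  show ?thesis
  proof (rule normal_conj_byI[OF M(1)])
    fix g h assume gh: "g \<in> carrier G" "h \<in> M"
    then show "conj_by g h \<in> M"
      using *[of "inv g" h] lcoset_fixed_iff[OF M(1), of "inv g" h] by simp
  qed
qed

text \<open>The center is the fixed-point set of conjugation; its size is congruent to |G|, hence
  divisible by p, and it is positive because of the unit.\<close>

lemma p_group_center_nontrivial:
  assumes p: "prime p" and ord: "order G = p ^ k" and nt: "carrier G \<noteq> {\<one>}"
  obtains z where "z \<in> carrier G" "z \<noteq> \<one>" "\<And>g. g \<in> carrier G \<Longrightarrow> g \<otimes> z = z \<otimes> g"
proof -
  have fin: "finite (carrier G)"
    using ord p by (metis order_gt_0_iff_finite prime_gt_0_nat zero_less_power)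
  let ?F = "{x \<in> carrier G. \<forall>g\<in>carrier G. conj_by g x = x}"
  have "order G \<noteq> 1" using nt order_one_triv_iff by blast
  then have "k \<noteq> 0" using ord by (metis power_0)
  then have "order G mod p = 0" using ord by simp
  moreover have "order G mod p = card ?F mod p"
    unfolding order_def by (rule p_group_fixed_points[OF p ord fin]) (auto simp: conj_by_mult_left)
  ultimately have "p dvd card ?F" by auto
  moreover have "\<one> \<in> ?F" by simp
  then have "card ?F \<noteq> 0" using fin by auto
  ultimately have "p \<le> card ?F" by (intro dvd_imp_le) linarith+
  then have "1 < card ?F" using prime_gt_1_nat[OF p] by linarith
  then have "\<not> ?F \<subseteq> {\<one>}" using card_mono[of "{\<one>}" ?F] by auto
  then obtain z where z: "z \<in> carrier G" "z \<noteq> \<one>" "\<And>g. g \<in> carrier G \<Longrightarrow> conj_by g z = z"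
    by fast
  have "g \<otimes> z = z \<otimes> g" if "g \<in> carrier G" for g
    using z(3)[OF that] conj_by_eq_iff[OF that z(1)] by simp
  with z(1,2) show ?thesis by (rule that)
qed

end

section \<open>Odd p-groups with at most one subgroup of order p\<close>

lemma power_one_plus_mult: "\<exists>w::nat. (1 + p * t) ^ i = 1 + i * p * t + p\<^sup>2 * w"
proof (induction i)
  case (Suc i)
  then obtain w where w: "(1 + p * t) ^ i = 1 + i * p * t + p\<^sup>2 * w" by blast
  have "(1 + p * t) ^ Suc i = 1 + Suc i * p * t + p\<^sup>2 * (i * t * t + w * (1 + p * t))"
    unfolding power_Suc w by (simp add: algebra_simps power2_eq_square)
  then show ?case by blast
qed simp

text \<open>With r = 1 + p t the power r^i is 1 + i p t modulo p^2, and the sum of the i below p is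
  p (p - 1) / 2, a multiple of p because p is odd. So the sum is p modulo p^2. For p = 2 and r = 3
  it would be 4.\<close>

lemma sum_powers_odd_prime:
  fixes p r :: nat
  assumes p: "prime p" "odd p" and r: "r mod p = 1"
  obtains u where "(\<Sum>i<p. r ^ i) = p * u" "coprime u p"
proof -
  obtain t where t: "r = 1 + p * t" using r by (metis mod_mult_div_eq)
  have "\<forall>i. \<exists>w. r ^ i = 1 + i * p * t + p\<^sup>2 * w" unfolding t using power_one_plus_mult by blast
  then obtain w where w: "\<And>i. r ^ i = 1 + i * p * t + p\<^sup>2 * w i" by metis
  obtain h where h: "p = 2 * h + 1" using p(2) by (auto elim: oddE)
  have "(\<Sum>i<p. i) = p * h"
  proof -
    have "2 * (\<Sum>i<Suc (2 * h). i) = 2 * h * Suc (2 * h)" by (induction h) auto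
    then show ?thesis using h by simp
  qed
  then have "(\<Sum>i<p. i * p * t) = p * (p * h * t)"
    by (simp flip: sum_distrib_right)
  then have "(\<Sum>i<p. r ^ i) = p * (1 + p * (h * t + (\<Sum>i<p. w i)))"
    unfolding w sum.distrib by (simp add: algebra_simps power2_eq_square flip: sum_distrib_left)
  moreover have "coprime (1 + p * (h * t + (\<Sum>i<p. w i))) p"
    by (metis coprime_1_left coprime_mod_left_iff mod_mult_self2 p(1) not_prime_0)
  ultimately show ?thesis using that by blast
qed

text \<open>By Fermat r^p is congruent to r; the assumption itself excludes that p divides
  r.\<close>

lemma mod_prime_eq_one_of_pow:
  fixes p r :: nat
  assumes p: "prime p" and r: "r ^ p mod p = 1"
  shows "r mod p = 1"
proof -
  have p1: "p = Suc (p - 1)" using prime_gt_0_nat[OF p] by simp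
  have "\<not> p dvd r"
  proof
    assume "p dvd r"
    then have "p dvd r ^ p" using prime_gt_0_nat[OF p] by (simp add: dvd_power_same dvd_trans)
    then show False using r by simp
  qed
  then have "[r ^ (p - 1) * r = 1 * r] (mod p)" using p by (intro cong_mult fermat_theorem) simp_all
  moreover have "r ^ (p - 1) * r = r ^ p" by (subst (2) p1) simp
  ultimately show ?thesis using r by (simp add: cong_def)
qed

context group
begin

lemma ord_eq_order_generates:
  assumes fin: "finite (carrier G)" and d: "d \<in> carrier G" "ord d = order G"
    and x: "x \<in> carrier G"
  shows "\<exists>i::nat. x = d [^] i"
proof -
  have "card ((\<lambda>i. d [^] i) ` {0..ord d - 1}) = ord d"
    using card_image[OF ord_inj[OF d(1)]] ord_ge_1[OF fin d(1)] by simp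
  moreover have "(\<lambda>i. d [^] i) ` {0..ord d - 1} \<subseteq> carrier G" using d by auto
  ultimately have "(\<lambda>i. d [^] i) ` {0..ord d - 1} = carrier G"
    using fin d by (intro card_seteq) (auto simp: order_def)
  then show ?thesis using x by blast
qed

lemma subgroup_nat_pow_closed:
  "subgroup H G \<Longrightarrow> x \<in> H \<Longrightarrow> x [^] (n::nat) \<in> H"
  by (induction n) (auto simp: subgroup.one_closed subgroup.m_closed)

lemma conj_by_pow_left:
  assumes "d \<in> carrier G" "x \<in> carrier G" "conj_by d x = x [^] (r::nat)"
  shows "conj_by (d [^] (i::nat)) x = x [^] (r ^ i)"
proof (induction i)
  case (Suc i)
  have "conj_by (d [^] Suc i) x = conj_by (d [^] i) (conj_by d x)"
    using assms by (simp add: conj_by_mult_left)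
  also have "\<dots> = conj_by (d [^] i) x [^] r"
    using assms conj_by_pow[of "d [^] i" x r] by simp
  finally show ?case using Suc assms by (simp add: nat_pow_pow mult.commute)
qed (use assms in simp)

text \<open>Moving x^a to the left past d^n multiplies its exponent by r^n, so a geometric sum
  collects.\<close>

lemma twisted_power:
  assumes d: "d \<in> carrier G" and x: "x \<in> carrier G" and r: "conj_by d x = x [^] (r::nat)"
  shows "(x [^] (a::nat) \<otimes> d) [^] (n::nat) = x [^] (a * (\<Sum>i<n. r ^ i)) \<otimes> d [^] n"
proof (induction n)
  case (Suc n)
  have "(x [^] a \<otimes> d) [^] Suc n = x [^] (a * (\<Sum>i<n. r ^ i)) \<otimes> (d [^] n \<otimes> x [^] a) \<otimes> d"
    using Suc d x by (simp add: m_assoc)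
  also have "d [^] n \<otimes> x [^] a = conj_by (d [^] n) (x [^] a) \<otimes> d [^] n"
    by (rule mult_eq_conj_by) (use d x in simp_all)
  also have "conj_by (d [^] n) (x [^] a) = x [^] (r ^ n * a)"
    using conj_by_pow[of "d [^] n" x a] conj_by_pow_left[OF d x r, of n] d x by (simp add: nat_pow_pow)
  also have "x [^] (a * (\<Sum>i<n. r ^ i)) \<otimes> (x [^] (r ^ n * a) \<otimes> d [^] n) \<otimes> d
      = x [^] (a * (\<Sum>i<n. r ^ i) + r ^ n * a) \<otimes> (d [^] n \<otimes> d)"
    using d x by (simp add: m_assoc flip: nat_pow_mult)
  finally show ?case by (simp add: algebra_simps)
qed (use d x in simp)

lemma normal_index_pow:
  assumes fin: "finite (carrier G)" and N: "N \<lhd> G" and g: "g \<in> carrier G"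
  shows "g [^] (order G div card N) \<in> N"
proof -
  interpret normal N G by fact
  interpret Q: group "G Mod N" by (rule factorgroup_is_group)
  have "0 < card N" using fin finite_imp_card_positive by blast
  then have "card (rcosets N) = order G div card N"
    using lagrange[OF subgroup_axioms] by (metis div_mult_self_is_m)
  then have "order (G Mod N) = order G div card N"
    by (simp add: order_def FactGroup_def)
  moreover have "(N #> g) [^]\<^bsub>G Mod N\<^esub> order (G Mod N) = \<one>\<^bsub>G Mod N\<^esub>"
    using g by (intro Q.pow_order_eq_1) (simp add: FactGroup_def rcosetsI subset)
  ultimately have "N #> (g [^] (order G div card N)) = N"
    using FactGroup_pow[OF g] by simp
  then show ?thesis using g by (metis coset_join1 nat_pow_closed subset is_subgroup)
qed

text \<open>If \<open>d \<notin> M\<close> does not generate \<open>G\<close>, then \<open>d\<^sup>p\<close> is a \<open>p\<close>-th power in \<open>M\<close>. Since \<open>p\<close> is odd, \<open>1 + r + \<dots> + r\<^sup>p\<^sup>-\<^sup>1\<close>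
  is \<open>p\<close> times a unit, so some \<open>x\<^sup>a d\<close> has order \<open>p\<close>, although all such elements lie in \<open>M\<close>.\<close>

lemma p_group_cyclic_step:
  assumes p: "prime p" "odd p" and ordG: "order G = p ^ Suc n"
    and uniq: "\<And>x y. x \<in> carrier G \<Longrightarrow> y \<in> carrier G \<Longrightarrow> x [^] p = \<one> \<Longrightarrow> y [^] p = \<one> \<Longrightarrow>
      y \<noteq> \<one> \<Longrightarrow> \<exists>i::nat. x = y [^] i"
    and M: "subgroup M G" "card M = p ^ n"
    and x: "x \<in> M" "\<And>y. y \<in> M \<Longrightarrow> \<exists>i::nat. y = x [^] i"
  shows "\<exists>g\<in>carrier G. \<forall>x\<in>carrier G. \<exists>i::nat. x = g [^] i"
proof -
  have fin: "finite (carrier G)"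
    using ordG p by (metis order_gt_0_iff_finite prime_gt_0_nat zero_less_power)
  interpret M: subgroup M G by (rule M(1))
  interpret MG: group "G\<lparr>carrier := M\<rparr>" by (rule M.subgroup_is_group[OF is_group])
  have normM: "M \<lhd> G" by (rule p_group_index_p_normal[OF p(1) ordG M])
  have xG: "x \<in> carrier G" using x(1) by simp
  have p1: "1 < p" using p(1) by (rule prime_gt_1_nat)
  have "M \<noteq> carrier G"
    using M(2) ordG p1 by (auto simp: order_def)
  then obtain d where d: "d \<in> carrier G" "d \<notin> M" using M.subset by blast
  have "order G div card M = p" using ordG M(2) p1 by simp
  then have "d [^] p \<in> M" using normal_index_pow[OF fin normM d(1)] by simp
  then obtain j where j: "d [^] p = x [^] (j::nat)" using x(2) by blast
  have "card M dvd ord x"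
  proof -
    have "M \<subseteq> (\<lambda>i. x [^] i) ` {0..ord x - 1}"
    proof
      fix y assume "y \<in> M"
      then have "y \<in> {x [^] i |i. i \<in> (UNIV :: nat set)}" using x(2) by auto
      then show "y \<in> (\<lambda>i. x [^] i) ` {0..ord x - 1}"
        unfolding ord_elems[OF fin xG] by blast
    qed
    then have "card M \<le> ord x"
      using card_mono[of "(\<lambda>i. x [^] i) ` {0..ord x - 1}" M] card_image_le[of "{0..ord x - 1}" "\<lambda>i. x [^] i"]
        ord_ge_1[OF fin xG] by simp
    moreover have "ord x dvd card M"
      using MG.pow_order_eq_1[of x] x(1) xG by (simp add: order_def pow_eq_id flip: nat_pow_consistent)
    moreover have "0 < card M" using M(2) p1 by simp
    ultimately show ?thesis by (metis dvd_imp_le le_antisym dvd_refl)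
  qed
  moreover have "ord x dvd card M"
    using MG.pow_order_eq_1[of x] x(1) xG by (simp add: order_def pow_eq_id flip: nat_pow_consistent)
  ultimately have ordx: "ord x = p ^ n" using M(2) by (simp add: dvd_antisym)
  show ?thesis
  proof (cases "n = 0")
    case True
    have "y [^] p = \<one>" if "y \<in> carrier G" for y
      using pow_order_eq_1[OF that] ordG True by simp
    moreover have "d \<noteq> \<one>" using d by auto
    ultimately show ?thesis using uniq d(1) by blast
  next
    case False
    show ?thesis
    proof (cases "p dvd j")
      \<comment> \<open>If d had order at most p^n, then 1 = d^(p^n) = x^(j p^(n-1)), and the order
        p^n of x would divide j p^(n-1). So d has order p^(n+1) and generates G.\<close>
      case False
      have "ord d dvd p ^ Suc n" using ord_dvd_group_order[OF d(1)] ordG by simp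
      then obtain i where i: "i \<le> Suc n" "ord d = p ^ i"
        using divides_primepow_nat[OF p(1), of "ord d" "Suc n"] by blast
      have "i = Suc n"
      proof (rule ccontr)
        assume "i \<noteq> Suc n"
        then have "p ^ i dvd p * p ^ (n - 1)"
          using i(1) \<open>n \<noteq> 0\<close> by (simp add: le_imp_power_dvd flip: power_Suc)
        then have "d [^] (p * p ^ (n - 1)) = \<one>"
          using pow_eq_id[OF d(1), of "p * p ^ (n - 1)"] i(2) by simp
        then have "x [^] (j * p ^ (n - 1)) = \<one>"
          using d xG by (simp add: j flip: nat_pow_pow)
        then have "p ^ n dvd j * p ^ (n - 1)"
          using pow_eq_id[OF xG, of "j * p ^ (n - 1)"] ordx by simp
        moreover have "p ^ n = p * p ^ (n - 1)" using \<open>n \<noteq> 0\<close> by (simp flip: power_Suc)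
        ultimately show False using False p1 by simp
      qed
      then show ?thesis
        using ord_eq_order_generates[OF fin d(1)] i(2) ordG d(1) by auto
    next
      case True
      then obtain k where k: "j = p * k" by blast
      obtain r where r: "conj_by d x = x [^] (r::nat)"
        using x normal_conj_by[OF normM d(1) x(1)] by blast
      \<comment> \<open>d^p is the power x^j and so commutes with x; this makes r^p congruent to 1
        modulo p^n, and then r congruent to 1 modulo p.\<close>
      have "x [^] (r ^ p) = conj_by (x [^] j) x"
        using conj_by_pow_left[OF d(1) xG r, of p] j by simp
      also have "\<dots> = x [^] (1::nat)"
        using xG conj_by_eq_iff[of "x [^] j" x] by (simp add: nat_pow_comm[of x j 1, simplified])
      finally have xr: "x [^] (r ^ p) = x" using xG by simp
      \<comment> \<open>Adding p^n - 1 stands for subtracting 1 within the natural numbers.\<close>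
      have "x [^] (r ^ p + (p ^ n - 1)) = x [^] Suc (p ^ n - 1)"
        using xG xr nat_pow_Suc2[OF xG, of "p ^ n - 1"] by (simp flip: nat_pow_mult)
      also have "\<dots> = \<one>" using p1 ordx pow_eq_id[OF xG, of "p ^ n"] by simp
      finally have "p ^ n dvd r ^ p + (p ^ n - 1)" using pow_eq_id[OF xG] ordx by simp
      then have "p dvd r ^ p + (p ^ n - 1)" using \<open>n \<noteq> 0\<close> by (meson dvd_power dvd_trans neq0_conv)
      then have "(r ^ p + (p ^ n - 1) + 1) mod p = 1 mod p"
        by (metis add.commute dvd_eq_mod_eq_0 mod_add_left_eq add_0)
      moreover have "r ^ p + (p ^ n - 1) + 1 = r ^ p + p ^ n" using p1 by simp
      ultimately have "r ^ p mod p = 1" using \<open>n \<noteq> 0\<close> p1 by (simp flip: mod_add_right_eq)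
      then have "r mod p = 1" by (rule mod_prime_eq_one_of_pow[OF p(1)])
      then obtain u where u: "(\<Sum>i<p. r ^ i) = p * u" "coprime u p"
        using sum_powers_odd_prime[OF p] by blast
      have "coprime u (p ^ n)" using u(2) by simp
      moreover have "u \<noteq> 0"
      proof
        assume "u = 0"
        then show False using u(2) p1 by simp
      qed
      ultimately obtain v w where "u * v = p ^ n * w + 1" using bezout_nat[of u "p ^ n"] by auto
      then have v: "(u * v) mod (p ^ n) = 1 mod (p ^ n)" by (metis mod_mult_self4)
      \<comment> \<open>v is inverse to u modulo p^n and p^n - 1 stands for -1, so a is congruent to
        -k / u. This makes the exponent p (a u + k) of (x^a d)^p divisible by the order of
        x.\<close>
      define a where "a = v * k * (p ^ n - 1)"
      let ?y = "x [^] a \<otimes> d"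
      have "p ^ n dvd a * u + k"
      proof -
        have "a * u + k = (u * v) * (k * (p ^ n - 1)) + k"
          by (simp add: a_def ac_simps)
        then have "(a * u + k) mod p ^ n = (((u * v) mod p ^ n) * (k * (p ^ n - 1)) + k) mod p ^ n"
          by (metis mod_add_left_eq mod_mult_left_eq)
        also have "\<dots> = (1 * (k * (p ^ n - 1)) + k) mod p ^ n"
          unfolding v by (metis mod_add_left_eq mod_mult_left_eq)
        also have "1 * (k * (p ^ n - 1)) + k = k * (p ^ n - 1) + k" by simp
        also have "k * (p ^ n - 1) + k = k * p ^ n"
          using p1 by (simp add: algebra_simps)
        finally show ?thesis by auto
      qed
      then have *: "ord x dvd p * (a * u + k)" using ordx by (simp add: dvd_mult)
      have "?y [^] p = x [^] (a * (p * u)) \<otimes> x [^] (p * k)"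
        using twisted_power[OF d(1) xG r, of a p] u(1) j k by simp
      also have "\<dots> = x [^] (p * (a * u + k))"
        using xG by (simp add: nat_pow_mult algebra_simps)
      also have "\<dots> = \<one>" using * pow_eq_id[OF xG] by blast
      finally have yp: "?y [^] p = \<one>" .
      \<comment> \<open>An element of order p inside M; the uniqueness assumption makes
        \<open>?y\<close> a power of it, so \<open>?y\<close> and with it d would lie in M.\<close>
      let ?z = "x [^] (p ^ (n - 1))"
      have pn: "p ^ n = p ^ (n - 1) * p" using \<open>n \<noteq> 0\<close> by (metis power_minus_mult neq0_conv)
      have "?z [^] p = \<one>"
        using xG ordx pow_eq_id[OF xG, of "p ^ n"] unfolding nat_pow_pow[OF xG] pn by simp
      moreover have "?z \<noteq> \<one>"
      proof
        assume "?z = \<one>"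
        then have "p ^ n dvd p ^ (n - 1)" using pow_eq_id[OF xG] ordx by simp
        then have "p ^ n \<le> p ^ (n - 1)" using p1 by (intro dvd_imp_le) auto
        then show False using p1 pn by simp
      qed
      ultimately obtain i where "?y = ?z [^] (i::nat)"
        using uniq[of ?y ?z] yp xG d(1) by auto
      then have "?y \<in> M" using x(1) by (simp add: subgroup_nat_pow_closed[OF M(1)])
      moreover have "x [^] a \<in> M" using x(1) by (simp add: subgroup_nat_pow_closed[OF M(1)])
      ultimately have "inv (x [^] a) \<otimes> ?y \<in> M" by (meson M.m_closed M.m_inv_closed)
      then have "d \<in> M" using xG d(1) by simp
      then show ?thesis using d(2) by simp
    qed
  qed
qed

end

text \<open>The assumption says that there is at most one subgroup of order p. It passes to a
  subgroup of index p, which is cyclic by induction. Generalized quaternion groups are the reason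
  for excluding p = 2.\<close>

theorem p_group_cyclic:
  fixes G :: "('a, 'm) monoid_scheme"
  assumes p: "prime p" "odd p" and "group G" and "order G = p ^ n"
    and "\<And>x y. x \<in> carrier G \<Longrightarrow> y \<in> carrier G \<Longrightarrow> x [^]\<^bsub>G\<^esub> p = \<one>\<^bsub>G\<^esub> \<Longrightarrow>
      y [^]\<^bsub>G\<^esub> p = \<one>\<^bsub>G\<^esub> \<Longrightarrow> y \<noteq> \<one>\<^bsub>G\<^esub> \<Longrightarrow> \<exists>i::nat. x = y [^]\<^bsub>G\<^esub> i"
  shows "\<exists>g\<in>carrier G. \<forall>x\<in>carrier G. \<exists>i::nat. x = g [^]\<^bsub>G\<^esub> i"
  using assms(3-)
proof (induction n arbitrary: G)
  case 0
  then interpret group G by simp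
  have "carrier G = {\<one>\<^bsub>G\<^esub>}" using 0 order_one_triv_iff by simp
  then show ?case by auto
next
  case (Suc n)
  interpret group G by (rule Suc.prems)
  have fin: "finite (carrier G)"
    using Suc.prems(2) p by (metis order_gt_0_iff_finite prime_gt_0_nat zero_less_power)
  obtain M where M: "subgroup M G" "card M = p ^ n"
    using sylow_thm[OF p(1) is_group, of n p] Suc.prems(2) fin by (auto simp: mult.commute)
  interpret M: subgroup M G by (rule M(1))
  interpret MG: group "G\<lparr>carrier := M\<rparr>" by (rule M.subgroup_is_group[OF is_group])
  have "\<exists>g\<in>carrier (G\<lparr>carrier := M\<rparr>). \<forall>x\<in>carrier (G\<lparr>carrier := M\<rparr>).
      \<exists>i::nat. x = g [^]\<^bsub>G\<lparr>carrier := M\<rparr>\<^esub> i"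
  proof (rule Suc.IH)
    fix x y assume "x \<in> carrier (G\<lparr>carrier := M\<rparr>)" "y \<in> carrier (G\<lparr>carrier := M\<rparr>)"
      "x [^]\<^bsub>G\<lparr>carrier := M\<rparr>\<^esub> p = \<one>\<^bsub>G\<lparr>carrier := M\<rparr>\<^esub>"
      "y [^]\<^bsub>G\<lparr>carrier := M\<rparr>\<^esub> p = \<one>\<^bsub>G\<lparr>carrier := M\<rparr>\<^esub>" "y \<noteq> \<one>\<^bsub>G\<lparr>carrier := M\<rparr>\<^esub>"
    then show "\<exists>i::nat. x = y [^]\<^bsub>G\<lparr>carrier := M\<rparr>\<^esub> i"
      using Suc.prems(3)[of x y] by (simp flip: nat_pow_consistent)
  qed (use M in \<open>simp_all add: order_def MG.is_group\<close>)
  then obtain x where "x \<in> M" "\<And>y. y \<in> M \<Longrightarrow> \<exists>i::nat. y = x [^]\<^bsub>G\<^esub> i"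
    by (auto simp flip: nat_pow_consistent)
  then show ?case using p_group_cyclic_step[OF p Suc.prems(2,3) M] by blast
qed

text \<open>For a generator g, every g^i with gcd(j, p^n) dividing i is a power of g^j; the gcds of
  i and of j with p^n are powers of p, so one divides the other.\<close>

lemma (in group) cyclic_p_group_comparable:
  assumes p: "prime p" and ord: "order G = p ^ n"
    and g: "g \<in> carrier G" "\<And>x. x \<in> carrier G \<Longrightarrow> \<exists>i::nat. x = g [^] i"
    and ab: "a \<in> carrier G" "b \<in> carrier G"
  shows "(\<exists>k::nat. a = b [^] k) \<or> (\<exists>k::nat. b = a [^] k)"
proof -
  have gn: "g [^] (p ^ n * y) = \<one>" for y
    using pow_order_eq_1[OF g(1)] ord g(1) by (simp flip: nat_pow_pow)
  have *: "\<exists>k::nat. g [^] i = (g [^] j) [^] k" if dvd: "gcd j (p ^ n) dvd i" for i j :: nat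
  proof (cases "j = 0")
    case True
    then have "p ^ n dvd i" using dvd by simp
    then have "g [^] i = \<one>" using gn by auto
    then show ?thesis using True by simp
  next
    case False
    then obtain x y where xy: "j * x = p ^ n * y + gcd j (p ^ n)" using bezout_nat by blast
    obtain q where q: "i = gcd j (p ^ n) * q" using dvd by blast
    have "(g [^] j) [^] (x * q) = g [^] (p ^ n * (y * q) + i)"
      unfolding nat_pow_pow[OF g(1)] q mult.assoc[symmetric] xy by (simp add: algebra_simps)
    also have "\<dots> = g [^] i" using gn g(1) by (simp flip: nat_pow_mult)
    finally show ?thesis by metis
  qed
  obtain i j where ij: "a = g [^] (i::nat)" "b = g [^] (j::nat)" using g(2) ab by metis
  obtain s where s: "gcd i (p ^ n) = p ^ s" using divides_primepow_nat[OF p] gcd_dvd2 by metis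
  obtain t where t: "gcd j (p ^ n) = p ^ t" using divides_primepow_nat[OF p] gcd_dvd2 by metis
  have "p ^ s dvd i" "p ^ t dvd j" using s t gcd_dvd1 by metis+
  moreover have "p ^ s dvd p ^ t \<or> p ^ t dvd p ^ s" by (meson le_imp_power_dvd nat_le_linear)
  ultimately have "gcd i (p ^ n) dvd j \<or> gcd j (p ^ n) dvd i"
    unfolding s t by (meson dvd_trans)
  then show ?thesis using * unfolding ij by blast
qed

section \<open>Norms and fixed-point-free actions on an abelian group\<close>

lemma (in comm_monoid) finprod_swap:
  assumes "finite A" "\<And>i j. i \<in> A \<Longrightarrow> j \<in> B \<Longrightarrow> f i j \<in> carrier G"
  shows "finprod G (\<lambda>i. finprod G (f i) B) A = finprod G (\<lambda>j. finprod G (\<lambda>i. f i j) A) B"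
  using assms
proof (induction A)
  case (insert a A)
  have "finprod G (\<lambda>i. finprod G (f i) B) (insert a A) =
      finprod G (f a) B \<otimes> finprod G (\<lambda>j. finprod G (\<lambda>i. f i j) A) B"
    using insert by (subst finprod_insert) (auto simp: Pi_iff)
  also have "\<dots> = finprod G (\<lambda>j. f a j \<otimes> finprod G (\<lambda>i. f i j) A) B"
    using insert.prems by (subst finprod_multf) (auto simp: Pi_iff)
  also have "\<dots> = finprod G (\<lambda>j. finprod G (\<lambda>i. f i j) (insert a A)) B"
    using insert by (intro finprod_cong') (auto simp: Pi_iff)
  finally show ?case .
qed simp

lemma (in comm_monoid) finprod_shift:
  assumes "\<And>i. f i \<in> carrier G"
  shows "f 0 \<otimes> finprod G (\<lambda>i. f (Suc i)) {..<n} = finprod G f {..<n} \<otimes> f n"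
proof (induction n)
  case (Suc n)
  have "f 0 \<otimes> finprod G (\<lambda>i. f (Suc i)) {..<Suc n} =
      (f 0 \<otimes> finprod G (\<lambda>i. f (Suc i)) {..<n}) \<otimes> f (Suc n)"
    using assms by (simp add: lessThan_Suc m_ac)
  also have "\<dots> = finprod G f {..<Suc n} \<otimes> f (Suc n)"
    unfolding Suc using assms by (simp add: lessThan_Suc m_ac)
  finally show ?case .
qed (use assms in simp)

context abelian_normal
begin

text \<open>Conjugation by w shifts the factors by one place, and the factor that leaves the range
  is a again because w^n fixes a.\<close>

lemma norm_fixed:
  assumes w: "w \<in> carrier G" and a: "a \<in> P" and wn: "conj_by (w [^] (n::nat)) a = a"
  shows "conj_by w (finprod (G\<lparr>carrier := P\<rparr>) (\<lambda>j. conj_by (w [^] j) a) {..<n}) =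
    finprod (G\<lparr>carrier := P\<rparr>) (\<lambda>j. conj_by (w [^] j) a) {..<n}" (is "conj_by w ?N = ?N")
proof -
  interpret P: comm_group "G\<lparr>carrier := P\<rparr>" by (rule comm_group_P)
  let ?f = "\<lambda>j::nat. conj_by (w [^] j) a"
  have f: "?f j \<in> P" for j using w a by simp
  have N: "?N \<in> P" using P.finprod_closed[of ?f "{..<n}"] f by simp
  have "conj_by w (?f j) = ?f (Suc j)" for j
    unfolding nat_pow_Suc2[OF w] using w a by (simp add: conj_by_mult_left)
  then have "conj_by w ?N = finprod (G\<lparr>carrier := P\<rparr>) (\<lambda>j. ?f (Suc j)) {..<n}"
    using P.hom_finprod[OF comm_group_P conj_hom[OF w], of ?f "{..<n}"] f
    by (simp del: nat_pow_Suc)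
  then have "a \<otimes> conj_by w ?N = ?N \<otimes> a"
    using P.finprod_shift[of ?f n] f wn a by (simp del: nat_pow_Suc)
  also have "\<dots> = a \<otimes> ?N" using N a commute by simp
  finally show ?thesis using N a w by simp
qed

text \<open>Hence \<open>C\<^sub>p \<times> C\<^sub>p\<close> cannot act on a nontrivial abelian \<open>q\<close>-group with every nontrivial element acting
  fixed-point-freely: the norms of \<open>y z\<^sup>i\<close> and of \<open>z\<^sup>j\<close> are fixed points, hence trivial, and the product
  over \<open>i\<close> of the former is \<open>a\<^sup>p\<close> times conjugates of the latter.\<close>

lemma rank_two_fixed_points:
  assumes z: "z \<in> carrier G" and y: "y \<in> carrier G"
    and comm: "\<And>a. a \<in> P \<Longrightarrow> conj_by z (conj_by y a) = conj_by y (conj_by z a)"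
    and pz: "\<And>a. a \<in> P \<Longrightarrow> conj_by (z [^] (p::nat)) a = a"
    and py: "\<And>a. a \<in> P \<Longrightarrow> conj_by (y [^] (p::nat)) a = a"
    and fz: "\<And>j a. 0 < j \<Longrightarrow> j < p \<Longrightarrow> a \<in> P \<Longrightarrow> conj_by (z [^] (j::nat)) a = a \<Longrightarrow> a = \<one>"
    and fy: "\<And>i a. i < p \<Longrightarrow> a \<in> P \<Longrightarrow> conj_by (y \<otimes> z [^] (i::nat)) a = a \<Longrightarrow> a = \<one>"
    and a: "a \<in> P" and p0: "0 < p"
  shows "a [^] p = \<one>"
proof -
  interpret P: comm_group "G\<lparr>carrier := P\<rparr>" by (rule comm_group_P)
  let ?P = "G\<lparr>carrier := P\<rparr>"
  have comm1: "conj_by (z [^] i) (conj_by y b) = conj_by y (conj_by (z [^] i) b)" if "b \<in> P" for i :: nat and b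
    using that
  proof (induction i arbitrary: b)
    case (Suc i)
    then show ?case using z y by (simp add: conj_by_mult_left comm)
  qed (use y in simp)
  have comm2: "conj_by (z [^] i) (conj_by (y [^] j) b) = conj_by (y [^] j) (conj_by (z [^] i) b)"
    if "b \<in> P" for i j :: nat and b
    using that
  proof (induction j arbitrary: b)
    case (Suc j)
    then show ?case using z y by (simp add: conj_by_mult_left comm1)
  qed (use z in simp)
  have yz: "conj_by ((y \<otimes> z [^] i) [^] j) b = conj_by (y [^] j) (conj_by (z [^] (i * j)) b)"
    if "b \<in> P" for i j :: nat and b
    using that
  proof (induction j arbitrary: b)
    case (Suc j)
    have "conj_by ((y \<otimes> z [^] i) [^] Suc j) b =
        conj_by (y [^] j) (conj_by (z [^] (i * j)) (conj_by y (conj_by (z [^] i) b)))"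
      using Suc z y by (simp add: conj_by_mult_left)
    also have "\<dots> = conj_by (y [^] j) (conj_by y (conj_by (z [^] (i * j)) (conj_by (z [^] i) b)))"
      using Suc z y by (simp add: comm1)
    also have "\<dots> = conj_by (y [^] Suc j) (conj_by (z [^] (i * j) \<otimes> z [^] i) b)"
      using Suc z y by (simp add: conj_by_mult_left)
    also have "z [^] (i * j) \<otimes> z [^] i = z [^] (i * Suc j)"
      using z by (simp add: nat_pow_mult add.commute)
    finally show ?case .
  qed simp
  have pz': "conj_by (z [^] (p * i)) b = b" if "b \<in> P" for i b
  proof (induction i)
    case (Suc i)
    have "z [^] (p * Suc i) = z [^] p \<otimes> z [^] (p * i)" using z by (simp add: nat_pow_mult)
    then show ?case using Suc pz that z by (simp add: conj_by_mult_left)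
  qed (use that in simp)
  \<comment> \<open>A p by p array: row i multiplies to the norm of y z^i, column j > 0 to the
    y^j-conjugate of the norm of z^j, and column 0 to a^p. The product by rows is compared with the
    product by columns.\<close>
  define T where "T i j = conj_by ((y \<otimes> z [^] i) [^] j) a" for i j :: nat
  have T: "T i j \<in> P" for i j using z y a by (simp add: T_def)
  have rows: "finprod ?P (T i) {..<p} = \<one>" if "i < p" for i
  proof (rule fy[OF that])
    show "finprod ?P (T i) {..<p} \<in> P" using P.finprod_closed[of "T i" "{..<p}"] T by simp
    have "conj_by ((y \<otimes> z [^] i) [^] p) a = a"
      using yz[OF a, of i p] pz'[OF a, of i] py[OF a] by (simp add: mult.commute)
    then show "conj_by (y \<otimes> z [^] i) (finprod ?P (T i) {..<p}) = finprod ?P (T i) {..<p}"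
      unfolding T_def using norm_fixed[of "y \<otimes> z [^] i" a p] z y a by simp
  qed
  have cols: "finprod ?P (\<lambda>i. T i j) {..<p} = \<one>" if j: "0 < j" "j < p" for j
  proof -
    let ?N = "finprod ?P (\<lambda>i. conj_by ((z [^] j) [^] i) a) {..<p}"
    have cl: "(\<lambda>i. conj_by ((z [^] j) [^] i) a) \<in> {..<p} \<rightarrow> P" using z a by auto
    have N: "?N \<in> P" using P.finprod_closed[of "\<lambda>i. conj_by ((z [^] j) [^] i) a"] cl by simp
    have "conj_by ((z [^] j) [^] p) a = a"
      using pz'[OF a, of j] z by (simp add: nat_pow_pow mult.commute)
    then have "conj_by (z [^] j) ?N = ?N" using norm_fixed[of "z [^] j" a p] z a by simp
    then have "?N = \<one>" using fz[OF j N] by blast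
    have "finprod ?P (\<lambda>i. T i j) {..<p} = finprod ?P (\<lambda>i. conj_by (y [^] j) (conj_by ((z [^] j) [^] i) a)) {..<p}"
      unfolding T_def using z y a by (intro P.finprod_cong') (auto simp: yz nat_pow_pow mult.commute)
    also have "\<dots> = conj_by (y [^] j) ?N"
      using P.hom_finprod[OF comm_group_P conj_hom, of "y [^] j" "\<lambda>i. conj_by ((z [^] j) [^] i) a" "{..<p}"]
        cl y by simp
    finally show ?thesis using \<open>?N = \<one>\<close> y by simp
  qed
  have "\<one> = finprod ?P (\<lambda>i. finprod ?P (T i) {..<p}) {..<p}"
    using P.finprod_one_eqI[of "{..<p}" "\<lambda>i. finprod ?P (T i) {..<p}"] rows by simp
  also have "\<dots> = finprod ?P (\<lambda>j. finprod ?P (\<lambda>i. T i j) {..<p}) {..<p}"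
    using T by (intro P.finprod_swap) auto
  also have "{..<p} = insert 0 {0<..<p}" using p0 by auto
  then have "finprod ?P (\<lambda>j. finprod ?P (\<lambda>i. T i j) {..<p}) {..<p} =
      finprod ?P (\<lambda>i. T i 0) {..<p} \<otimes> finprod ?P (\<lambda>j. finprod ?P (\<lambda>i. T i j) {..<p}) {0<..<p}"
    using P.finprod_insert[of "{0<..<p}" 0 "\<lambda>j. finprod ?P (\<lambda>i. T i j) {..<p}"]
      P.finprod_closed[of "\<lambda>i. T i _" "{..<p}"] T by (simp add: Pi_iff)
  also have "finprod ?P (\<lambda>j. finprod ?P (\<lambda>i. T i j) {..<p}) {0<..<p} = \<one>"
    using P.finprod_one_eqI[of "{0<..<p}" "\<lambda>j. finprod ?P (\<lambda>i. T i j) {..<p}"] cols by simp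
  also have "finprod ?P (\<lambda>i. T i 0) {..<p} = a [^] p"
    using P.finprod_const[of a "{..<p}"] a z y by (simp add: T_def flip: nat_pow_consistent)
  finally show ?thesis using a by simp
qed

end

section \<open>Frattini subgroup and Sylow subgroups\<close>

context group
begin

lemma maximal_subgroup_exists:
  assumes fin: "finite (carrier G)" and H: "subgroup H G" "H \<noteq> carrier G"
  obtains M where "maximal_subgroup M G" "H \<subseteq> M"
proof -
  let ?S = "{K. subgroup K G \<and> K \<noteq> carrier G}"
  have "?S \<subseteq> Pow (carrier G)" using subgroup.subset by auto
  then have "finite ?S" using fin by (meson finite_Pow_iff finite_subset)
  moreover have "H \<in> ?S" using H by blast
  ultimately have "\<exists>M\<in>?S. H \<subseteq> M \<and> (\<forall>K\<in>?S. M \<subseteq> K \<longrightarrow> M = K)"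
    by (rule finite_has_maximal2)
  then obtain M where M: "M \<in> ?S" "H \<subseteq> M" "\<forall>K\<in>?S. M \<subseteq> K \<longrightarrow> M = K" by (elim bexE conjE)
  then have "maximal_subgroup M G" unfolding maximal_subgroup_def by auto
  then show ?thesis using M(2) by (rule that)
qed

text \<open>Elements of the Frattini subgroup are non-generators: a proper H would lie in a maximal
  subgroup, and that contains N as well.\<close>

lemma Frat_supplement:
  assumes fin: "finite (carrier G)" and N: "N \<subseteq> Frat G" and H: "subgroup H G"
    and NH: "\<And>g. g \<in> carrier G \<Longrightarrow> \<exists>a\<in>N. \<exists>h\<in>H. g = a \<otimes> h"
  shows "H = carrier G"
proof (rule ccontr)
  assume "H \<noteq> carrier G"
  then obtain M where M: "maximal_subgroup M G" "H \<subseteq> M"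
    using maximal_subgroup_exists[OF fin H] by blast
  have "N \<subseteq> M" using N M(1) by (auto simp: Frat_def)
  have sub: "subgroup M G" "M \<noteq> carrier G" using M(1) by (auto simp: maximal_subgroup_def)
  have "g \<in> M" if g: "g \<in> carrier G" for g
  proof -
    obtain a h where ah: "a \<in> N" "h \<in> H" "g = a \<otimes> h" using NH[OF g] by blast
    then show ?thesis using \<open>N \<subseteq> M\<close> M(2) subgroup.m_closed[OF sub(1), of a h] by auto
  qed
  then show False using sub subgroup.subset by blast
qed

lemma Frat_complement_trivial:
  assumes fin: "finite (carrier G)" and N: "N \<subseteq> Frat G" and H: "is_complement G N H"
  shows "N = {\<one>}"
proof -
  have "H = carrier G"
    using Frat_supplement[OF fin N] H by (auto simp: is_complement_def)
  moreover have "N \<subseteq> carrier G" using N by (auto simp: Frat_def)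
  ultimately show ?thesis using H by (auto simp: is_complement_def)
qed

lemma Frat_subgroup: "subgroup (Frat G) G"
proof (rule subgroupI)
  show "Frat G \<subseteq> carrier G" by (auto simp: Frat_def)
  have "\<one> \<in> Frat G" by (auto simp: Frat_def maximal_subgroup_def subgroup.one_closed)
  then show "Frat G \<noteq> {}" by blast
qed (auto simp: Frat_def maximal_subgroup_def subgroup.m_inv_closed subgroup.m_closed)

lemma Frat_proper:
  assumes fin: "finite (carrier G)" and nt: "carrier G \<noteq> {\<one>}"
  shows "Frat G \<noteq> carrier G"
proof -
  obtain M where M: "maximal_subgroup M G"
    using maximal_subgroup_exists[OF fin triv_subgroup] nt by metis
  then have "Frat G \<subseteq> M" "M \<noteq> carrier G" "M \<subseteq> carrier G"
    using subgroup.subset by (auto simp: Frat_def maximal_subgroup_def)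
  then show ?thesis by blast
qed

end

section \<open>Frattini subgroups under isomorphisms, in normal subgroups and in quotients\<close>

lemma iso_maximal_subgroup:
  assumes "group G" "group H" "\<phi> \<in> iso G H" "maximal_subgroup M G"
  shows "maximal_subgroup (\<phi> ` M) H"
proof -
  interpret G: group G by fact
  interpret H: group H by fact
  interpret \<phi>: group_hom G H \<phi>
    using assms(3) by (simp add: group_hom_def group_hom_axioms_def assms iso_imp_homomorphism)
  have bij: "bij_betw \<phi> (carrier G) (carrier H)" using assms(3) by (simp add: iso_def)
  then have inj: "inj_on \<phi> (carrier G)" and img: "\<phi> ` carrier G = carrier H"
    by (auto simp: bij_betw_def)
  have M: "subgroup M G" "M \<noteq> carrier G"
    and max: "\<And>K. subgroup K G \<Longrightarrow> M \<subseteq> K \<Longrightarrow> K = M \<or> K = carrier G"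
    using assms(4) by (auto simp: maximal_subgroup_def)
  have Mc: "M \<subseteq> carrier G" using M(1) by (rule subgroup.subset)
  show ?thesis
    unfolding maximal_subgroup_def
  proof (intro conjI allI impI)
    show "subgroup (\<phi> ` M) H" using \<phi>.subgroup_img_is_subgroup[OF M(1)] .
    show "\<phi> ` M \<noteq> carrier H"
      using inj_on_image_eq_iff[OF inj Mc, of "carrier G"] img M(2) by auto
    fix K assume K: "subgroup K H \<and> \<phi> ` M \<subseteq> K"
    let ?K = "\<phi> -` K \<inter> carrier G"
    have "subgroup ?K G"
    proof (rule G.subgroupI)
      show "?K \<noteq> {}" using K subgroup.one_closed[of K H] \<phi>.hom_one by fastforce
    qed (use K in \<open>auto simp: subgroup.m_inv_closed subgroup.m_closed\<close>)
    moreover have "M \<subseteq> ?K" using K Mc by auto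
    ultimately have "?K = M \<or> ?K = carrier G" by (rule max)
    moreover have "\<phi> ` ?K = K"
    proof (intro equalityI subsetI)
      fix y assume "y \<in> K"
      moreover have "y \<in> \<phi> ` carrier G" using \<open>y \<in> K\<close> K subgroup.subset[of K H] img by blast
      ultimately show "y \<in> \<phi> ` ?K" by blast
    qed blast
    ultimately show "K = \<phi> ` M \<or> K = carrier H" using img by auto
  qed
qed

lemma iso_Frat_closed:
  assumes "group G" "group H" "\<phi> \<in> iso G H" "x \<in> Frat G"
  shows "\<phi> x \<in> Frat H"
proof -
  interpret G: group G by fact
  have bij: "bij_betw \<phi> (carrier G) (carrier H)" using assms(3) by (simp add: iso_def)
  have xG: "x \<in> carrier G" using assms(4) by (simp add: Frat_def)
  have "\<phi> x \<in> M" if M: "maximal_subgroup M H" for M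
  proof -
    let ?\<psi> = "inv_into (carrier G) \<phi>"
    have "maximal_subgroup (?\<psi> ` M) G"
      by (rule iso_maximal_subgroup[OF assms(2,1) G.iso_set_sym[OF assms(3)] M])
    then have "x \<in> ?\<psi> ` M" using assms(4) by (simp add: Frat_def)
    then obtain y where y: "y \<in> M" "x = ?\<psi> y" by blast
    have "y \<in> carrier H"
      using M y(1) subgroup.subset by (fastforce simp: maximal_subgroup_def)
    then show ?thesis using y bij by (simp add: bij_betw_inv_into_right)
  qed
  then show ?thesis using bij xG by (auto simp: Frat_def bij_betw_def)
qed

lemma iso_Frat:
  assumes "group G" "group H" "\<phi> \<in> iso G H"
  shows "\<phi> ` Frat G = Frat H"
proof (intro equalityI subsetI)
  interpret G: group G by fact
  have bij: "bij_betw \<phi> (carrier G) (carrier H)" using assms(3) by (simp add: iso_def)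
  fix y assume y: "y \<in> Frat H"
  then have "inv_into (carrier G) \<phi> y \<in> Frat G"
    by (rule iso_Frat_closed[OF assms(2,1) G.iso_set_sym[OF assms(3)]])
  moreover have "y = \<phi> (inv_into (carrier G) \<phi> y)"
    using bij y by (simp add: bij_betw_inv_into_right Frat_def)
  ultimately show "y \<in> \<phi> ` Frat G" by blast
qed (use iso_Frat_closed[OF assms] in blast)

context group
begin

lemma conj_by_iso:
  assumes L: "L \<lhd> G" and g: "g \<in> carrier G"
  shows "conj_by g \<in> iso (G\<lparr>carrier := L\<rparr>) (G\<lparr>carrier := L\<rparr>)"
proof (rule isoI)
  have sub: "subgroup L G" using L by (rule normal_imp_subgroup)
  note Lc = subgroup.mem_carrier[OF sub]
  show "conj_by g \<in> hom (G\<lparr>carrier := L\<rparr>) (G\<lparr>carrier := L\<rparr>)"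
    using g Lc normal_conj_by[OF L g] by (auto simp: hom_def conj_by_mult)
  show "bij_betw (conj_by g) (carrier (G\<lparr>carrier := L\<rparr>)) (carrier (G\<lparr>carrier := L\<rparr>))"
    by (rule bij_betw_byWitness[of _ "conj_by (inv g)"])
      (use g Lc normal_conj_by[OF L] in auto)
qed

text \<open>The Frattini subgroup is characteristic, and conjugation by g restricts to an
  automorphism of L.\<close>

lemma conj_by_Frat_normal:
  assumes L: "L \<lhd> G" and g: "g \<in> carrier G" and x: "x \<in> Frat (G\<lparr>carrier := L\<rparr>)"
  shows "conj_by g x \<in> Frat (G\<lparr>carrier := L\<rparr>)"
proof -
  have "group (G\<lparr>carrier := L\<rparr>)"
    using L normal_imp_subgroup subgroup.subgroup_is_group is_group by blast
  from iso_Frat[OF this this conj_by_iso[OF L g]] x show ?thesis by blast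
qed

lemma self_normal: "carrier G \<lhd> G"
  by (rule normal_conj_byI[OF subgroup_self]) simp

lemma Frat_normal: "Frat G \<lhd> G"
proof (rule normal_conj_byI[OF Frat_subgroup])
  have "G\<lparr>carrier := carrier G\<rparr> = G" by simp
  then show "conj_by g x \<in> Frat G" if "g \<in> carrier G" "x \<in> Frat G" for g x
    using conj_by_Frat_normal[OF self_normal that(1)] that(2) by metis
qed

lemma rcos_eq_iff:
  assumes N: "N \<lhd> G" and xy: "x \<in> carrier G" "y \<in> carrier G"
  shows "N #> x = N #> y \<longleftrightarrow> x \<otimes> inv y \<in> N"
proof -
  have sub: "subgroup N G" using N by (rule normal_imp_subgroup)
  show ?thesis
  proof
    assume "N #> x = N #> y"
    then have "x \<in> N #> y" using rcos_self[OF xy(1) sub] by simp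
    then show "x \<otimes> inv y \<in> N" using subgroup.rcos_module_imp[OF sub is_group xy(2)] by simp
  next
    assume "x \<otimes> inv y \<in> N"
    then have "x \<in> N #> y" using subgroup.rcos_module_rev[OF sub is_group xy(2,1)] by simp
    then show "N #> x = N #> y" using repr_independence[OF _ xy(2) sub] by simp
  qed
qed

text \<open>The preimage of a maximal subgroup of G / N is maximal in G and therefore contains
  x.\<close>

lemma Frat_factor:
  assumes N: "N \<lhd> G" and x: "x \<in> Frat G"
  shows "N #> x \<in> Frat (G Mod N)"
proof -
  interpret normal N G by fact
  interpret Q: group "G Mod N" by (rule factorgroup_is_group)
  have xG: "x \<in> carrier G" using x by (simp add: Frat_def)
  have carr: "N #> g \<in> carrier (G Mod N)" if "g \<in> carrier G" for g
    using that by (simp add: FactGroup_def rcosetsI subset)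
  have mult: "(N #> g) \<otimes>\<^bsub>G Mod N\<^esub> (N #> h) = N #> (g \<otimes> h)" if "g \<in> carrier G" "h \<in> carrier G" for g h
    using that by (simp add: FactGroup_def rcos_sum)
  have inv: "inv\<^bsub>G Mod N\<^esub> (N #> g) = N #> inv g" if "g \<in> carrier G" for g
    using that carr by (simp add: inv_FactGroup rcos_inv)
  have one: "\<one>\<^bsub>G Mod N\<^esub> = N" by (simp add: FactGroup_def)
  have "N #> x \<in> M" if M: "maximal_subgroup M (G Mod N)" for M
  proof -
    have sM: "subgroup M (G Mod N)" "M \<noteq> carrier (G Mod N)"
      and max: "\<And>K. subgroup K (G Mod N) \<Longrightarrow> M \<subseteq> K \<Longrightarrow> K = M \<or> K = carrier (G Mod N)"
      using M by (auto simp: maximal_subgroup_def)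
    let ?M = "{g \<in> carrier G. N #> g \<in> M}"
    have MI: "\<exists>g\<in>carrier G. C = N #> g" if "C \<in> carrier (G Mod N)" for C
      using that by (auto simp: FactGroup_def RCOSETS_def)
    have "maximal_subgroup ?M G"
      unfolding maximal_subgroup_def
    proof (intro conjI allI impI)
      show "subgroup ?M G"
      proof (rule subgroupI)
        show "?M \<noteq> {}" using subgroup.one_closed[OF sM(1)] one coset_mult_one[OF subset] by auto
      next
        fix a assume "a \<in> ?M"
        then show "inv a \<in> ?M" using subgroup.m_inv_closed[OF sM(1), of "N #> a"] inv by auto
      next
        fix a b assume "a \<in> ?M" "b \<in> ?M"
        then show "a \<otimes> b \<in> ?M" using subgroup.m_closed[OF sM(1), of "N #> a" "N #> b"] mult by auto
      qed auto
      show "?M \<noteq> carrier G"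
      proof
        assume "?M = carrier G"
        then have "carrier (G Mod N) \<subseteq> M" using MI by blast
        then show False using sM subgroup.subset by blast
      qed
      fix K assume K: "subgroup K G \<and> ?M \<subseteq> K"
      let ?K = "(\<lambda>g. N #> g) ` K"
      have Kc: "g \<in> carrier G" if "g \<in> K" for g
        using subgroup.mem_carrier[of K G g] K that by simp
      have NK: "N \<subseteq> K"
      proof
        fix n assume "n \<in> N"
        then have "N #> n = N" using coset_join2[OF _ is_subgroup] by simp
        then have "n \<in> ?M" using \<open>n \<in> N\<close> subgroup.one_closed[OF sM(1)] one by simp
        then show "n \<in> K" using K by blast
      qed
      have "subgroup ?K (G Mod N)"
      proof (rule Q.subgroupI)
        show "?K \<subseteq> carrier (G Mod N)" using carr Kc by blast
        show "?K \<noteq> {}" using NK subgroup.one_closed[OF is_subgroup] by fast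
      next
        fix C assume "C \<in> ?K"
        then obtain c where "c \<in> K" "C = N #> c" by blast
        then have "inv c \<in> K" "inv\<^bsub>G Mod N\<^esub> C = N #> inv c"
          using K inv[of c] Kc subgroup.m_inv_closed[of K G c] by simp_all
        then show "inv\<^bsub>G Mod N\<^esub> C \<in> ?K" by simp
      next
        fix C D assume "C \<in> ?K" "D \<in> ?K"
        then obtain c d where "c \<in> K" "d \<in> K" "C = N #> c" "D = N #> d" by blast
        then have "c \<otimes> d \<in> K" "C \<otimes>\<^bsub>G Mod N\<^esub> D = N #> (c \<otimes> d)"
          using K mult[of c d] Kc subgroup.m_closed[of K G c d] by simp_all
        then show "C \<otimes>\<^bsub>G Mod N\<^esub> D \<in> ?K" by simp
      qed
      moreover have "M \<subseteq> ?K"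
      proof
        fix C assume C: "C \<in> M"
        then have "C \<in> carrier (G Mod N)" using subgroup.subset[OF sM(1)] by (simp add: subset_iff)
        then obtain g where g: "g \<in> carrier G" "C = N #> g" using MI by blast
        then have "g \<in> K" using C K by auto
        then show "C \<in> ?K" using g(2) by simp
      qed
      ultimately consider "?K = M" | "?K = carrier (G Mod N)" using max by blast
      then show "K = ?M \<or> K = carrier G"
      proof cases
        case 1
        then have "K \<subseteq> ?M" using Kc by blast
        then show ?thesis using K by blast
      next
        case 2
        have "g \<in> K" if g: "g \<in> carrier G" for g
        proof -
          obtain k where k: "k \<in> K" "N #> g = N #> k" using 2 carr[OF g] by (metis imageE)
          then have "g \<otimes> inv k \<in> K" using rcos_eq_iff[OF N g Kc[OF k(1)]] NK by (simp add: subset_iff)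
          then have "g \<otimes> inv k \<otimes> k \<in> K" using K k(1) subgroup.m_closed[of K G "g \<otimes> inv k" k] by simp
          then show ?thesis using g k(1) Kc by (simp add: m_assoc)
        qed
        then show ?thesis using K subgroup.subset by blast
      qed
    qed
    then have "x \<in> ?M" using x unfolding Frat_def by blast
    then show ?thesis by simp
  qed
  then show ?thesis using carr[OF xG] by (simp add: Frat_def)
qed

section \<open>The Frattini argument and Sylow subgroups\<close>

definition normalizer_of :: "'a set \<Rightarrow> 'a set" where
  "normalizer_of B = {g \<in> carrier G. \<forall>b\<in>B. conj_by g b \<in> B}"

text \<open>The definition asks only that g carry B into itself; closure under inverses holds
  because an injective self-map of a finite set is onto.\<close>

lemma normalizer_of_subgroup:
  assumes fin: "finite (carrier G)" and B: "B \<subseteq> carrier G"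
  shows "subgroup (normalizer_of B) G"
proof (rule subgroupI)
  have "\<one> \<in> normalizer_of B" using B by (auto simp: normalizer_of_def)
  then show "normalizer_of B \<noteq> {}" by blast
next
  fix g assume g: "g \<in> normalizer_of B"
  then have gc: "g \<in> carrier G" and gB: "\<And>b. b \<in> B \<Longrightarrow> conj_by g b \<in> B" by (auto simp: normalizer_of_def)
  have "inj_on (conj_by g) B" using conj_by_inj[OF gc] B by (auto simp: inj_on_def)
  then have "conj_by g ` B = B"
    using endo_inj_surj[OF finite_subset[OF B fin], of "conj_by g"] image_subsetI[of B "conj_by g" B, OF gB] by simp
  then have "conj_by (inv g) b \<in> B" if "b \<in> B" for b
  proof -
    have "b \<in> conj_by g ` B" using \<open>conj_by g ` B = B\<close> that by simp
    then obtain c where "c \<in> B" "b = conj_by g c" by blast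
    then show ?thesis using gc B by auto
  qed
  then show "inv g \<in> normalizer_of B" using gc by (simp add: normalizer_of_def)
next
  fix g h assume "g \<in> normalizer_of B" "h \<in> normalizer_of B"
  then show "g \<otimes> h \<in> normalizer_of B"
    using B by (auto simp: normalizer_of_def conj_by_mult_left subset_iff)
qed (auto simp: normalizer_of_def)

lemma conj_by_image_subgroup:
  assumes g: "g \<in> carrier G" and B: "subgroup B G"
  shows "subgroup (conj_by g ` B) G" "card (conj_by g ` B) = card B"
proof -
  interpret B: subgroup B G by fact
  interpret group_hom G G "conj_by g"
    by unfold_locales (use g in \<open>simp add: hom_def conj_by_mult\<close>)
  show "subgroup (conj_by g ` B) G" by (rule subgroup_img_is_subgroup[OF B])
  show "card (conj_by g ` B) = card B"
    using conj_by_inj[OF g] by (intro card_image) (auto simp: inj_on_def)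
qed

text \<open>The conjugate of B by g lies again in L, where some l conjugates it back into B; so l g
  normalizes B.\<close>

lemma frattini_argument:
  assumes q: "prime q" and fin: "finite (carrier G)" and L: "L \<lhd> G"
    and B: "subgroup B G" "B \<subseteq> L" "card B = q ^ b" "\<not> q dvd card L div card B"
    and g: "g \<in> carrier G"
  shows "\<exists>l\<in>L. \<exists>n\<in>normalizer_of B. g = l \<otimes> n"
proof -
  have sub: "subgroup L G" using L by (rule normal_imp_subgroup)
  interpret L: subgroup L G by (rule sub)
  interpret LG: group "G\<lparr>carrier := L\<rparr>" by (rule L.subgroup_is_group[OF is_group])
  interpret B: subgroup B G by (rule B(1))
  have gB: "subgroup (conj_by g ` B) G" "card (conj_by g ` B) = q ^ b"
    using conj_by_image_subgroup[OF g B(1)] B(3) by simp_all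
  have "conj_by g ` B \<subseteq> L" using normal_conj_by[OF L g] B(2) by blast
  then have 1: "subgroup (conj_by g ` B) (G\<lparr>carrier := L\<rparr>)"
    using subgroup_incl[OF gB(1) sub] by blast
  have 2: "subgroup B (G\<lparr>carrier := L\<rparr>)" using subgroup_incl[OF B(1) sub B(2)] .
  have 3: "finite (carrier (G\<lparr>carrier := L\<rparr>))" using finite_subgroup[OF fin sub] by simp
  have 4: "\<not> q dvd order (G\<lparr>carrier := L\<rparr>) div card B" using B(4) by (simp add: order_def)
  obtain l where l: "l \<in> L" "\<And>h. h \<in> conj_by g ` B \<Longrightarrow> LG.conj_by l h \<in> B"
    using LG.p_subgroup_conj_into[OF q 3 2 1 gB(2) 4] by auto
  have "conj_by (l \<otimes> g) h \<in> B" if "h \<in> B" for h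
  proof -
    have "LG.conj_by l (conj_by g h) = conj_by l (conj_by g h)"
      using l(1) m_inv_consistent[OF sub l(1)] by (simp add: LG.conj_by_def conj_by_def)
    then show ?thesis using l(2)[of "conj_by g h"] l(1) that g by (simp add: conj_by_mult_left)
  qed
  then have "l \<otimes> g \<in> normalizer_of B" using l(1) g by (simp add: normalizer_of_def)
  moreover have "g = inv l \<otimes> (l \<otimes> g)" using l(1) g by simp
  ultimately show ?thesis using l(1) by (meson L.m_inv_closed)
qed

lemma sylow_exists:
  assumes p: "prime p" and fin: "finite (carrier G)" and H: "subgroup H G"
  obtains A a where "subgroup A G" "A \<subseteq> H" "card A = p ^ a" "\<not> p dvd card H div card A"
proof -
  interpret H: subgroup H G by fact
  have finH: "finite H" using fin H by (rule finite_subgroup)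
  have pos: "0 < card H" using fin H.finite_imp_card_positive by blast
  obtain m where m: "card H = p ^ multiplicity p (card H) * m" "\<not> p dvd m"
    using multiplicity_decompose'[of "card H" p] pos p by (metis not_prime_unit neq0_conv)
  obtain A where A: "subgroup A (G\<lparr>carrier := H\<rparr>)" "card A = p ^ multiplicity p (card H)"
    using sylow_thm[OF p H.subgroup_is_group[OF is_group], of "multiplicity p (card H)" m] m(1) finH
    by (auto simp: order_def)
  have "0 < p" using p by (rule prime_gt_0_nat)
  then have "card H div card A = m" by (subst m(1)) (simp add: A(2))
  moreover have "A \<subseteq> H" using subgroup.subset[OF A(1)] by simp
  ultimately show ?thesis using that[OF incl_subgroup[OF H A(1)]] A(2) m(2) by simp
qed

text \<open>Every element of G is uniquely a product of a representative of K modulo the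
  intersection and an element of H.\<close>

lemma card_subgroup_product:
  assumes fin: "finite (carrier G)" and H: "subgroup H G" and K: "subgroup K G"
    and KH: "\<And>g. g \<in> carrier G \<Longrightarrow> \<exists>k\<in>K. \<exists>h\<in>H. g = k \<otimes> h"
  shows "order G * card (H \<inter> K) = card H * card K"
proof -
  interpret H: subgroup H G by fact
  interpret K: subgroup K G by fact
  have HK: "subgroup (H \<inter> K) G" using H K by (rule subgroups_Inter_pair)
  obtain rep where rep: "\<And>x. x \<in> carrier G \<Longrightarrow> rep x \<in> carrier G"
    "\<And>x. x \<in> carrier G \<Longrightarrow> inv (rep x) \<otimes> x \<in> H \<inter> K"
    "\<And>x h. x \<in> carrier G \<Longrightarrow> h \<in> H \<inter> K \<Longrightarrow> rep (x \<otimes> h) = rep x"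
    "card (rep ` K) * card (H \<inter> K) = card K"
    using left_transversal[OF HK K _ finite_subgroup[OF fin K]] by (metis Int_lower2)
  have repK: "rep k \<in> K" if "k \<in> K" for k
  proof -
    have k: "k \<in> carrier G" using that by simp
    have i: "inv (rep k) \<otimes> k \<in> K" using rep(2)[OF k] by simp
    have "k \<otimes> inv (inv (rep k) \<otimes> k) \<in> K" using that i by (meson K.m_closed K.m_inv_closed)
    moreover have "k \<otimes> inv (inv (rep k) \<otimes> k) = rep k" using k rep(1)[OF k] by (simp add: inv_mult_group)
    ultimately show ?thesis by simp
  qed
  have "bij_betw (\<lambda>(i, h). i \<otimes> h) (rep ` K \<times> H) (carrier G)"
    unfolding bij_betw_def
  proof
    show "inj_on (\<lambda>(i, h). i \<otimes> h) (rep ` K \<times> H)"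
    proof (rule inj_onI, clarsimp)
      fix k h k' h' assume *: "k \<in> K" "h \<in> H" "k' \<in> K" "h' \<in> H" "rep k \<otimes> h = rep k' \<otimes> h'"
      have c: "rep k \<in> K" "rep k' \<in> K" "rep k \<in> carrier G" "rep k' \<in> carrier G" "h \<in> carrier G" "h' \<in> carrier G"
        "k \<in> carrier G" "k' \<in> carrier G"
        using * repK by auto
      have "inv (rep k') \<otimes> rep k = h' \<otimes> inv h"
        using *(5) c by (metis inv_closed inv_solve_left inv_solve_right m_assoc m_closed)
      moreover have "inv (rep k') \<otimes> rep k \<in> K" using c(1,2) by (meson K.m_closed K.m_inv_closed)
      moreover have "h' \<otimes> inv h \<in> H" using *(2,4) by simp
      ultimately have d: "inv (rep k') \<otimes> rep k \<in> H \<inter> K" by simp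
      have rr: "rep (rep x) = rep x" if "x \<in> carrier G" for x
        using rep(3)[OF rep(1)[OF that] rep(2)[OF that]] that rep(1)[OF that] by simp
      have "rep k = rep k'"
        using rep(3)[OF c(4) d] c rr by simp
      then show "rep k = rep k' \<and> h = h'" using *(5) c by simp
    qed
    show "(\<lambda>(i, h). i \<otimes> h) ` (rep ` K \<times> H) = carrier G"
    proof (intro equalityI subsetI)
      fix g assume "g \<in> carrier G"
      then obtain k h where kh: "k \<in> K" "h \<in> H" "g = k \<otimes> h" using KH by blast
      have k: "k \<in> carrier G" using kh(1) by simp
      have "g = rep k \<otimes> (inv (rep k) \<otimes> k \<otimes> h)" using kh k rep(1)[OF k] by (simp add: m_assoc)
      moreover have "inv (rep k) \<otimes> k \<otimes> h \<in> H" using rep(2)[OF k] kh(2) by (meson H.m_closed IntD1)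
      ultimately show "g \<in> (\<lambda>(i, h). i \<otimes> h) ` (rep ` K \<times> H)"
        using kh(1) by (intro image_eqI[of _ _ "(rep k, inv (rep k) \<otimes> k \<otimes> h)"]) auto
    qed (use rep(1) in auto)
  qed
  then have "card (rep ` K \<times> H) = order G" unfolding order_def by (rule bij_betw_same_card)
  then have "card (rep ` K) * card H = order G" by (simp add: card_cartesian_product)
  then have "order G * card (H \<inter> K) = card H * (card (rep ` K) * card (H \<inter> K))" by (simp add: ac_simps)
  then show ?thesis by (simp add: rep(4))
qed

end

lemma div_dvd_div_of_dvd:
  fixes a b c :: nat
  assumes "a dvd b" "b dvd c" "0 < c"
  shows "c div b dvd c div a"
  using assms by (auto elim!: dvdE)

context group
begin

lemma card_subgroup_dvd:
  assumes "finite (carrier G)" "subgroup H G" "subgroup K G" "H \<subseteq> K"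
  shows "card H dvd card K"
proof -
  interpret K: group "G\<lparr>carrier := K\<rparr>" using assms by (simp add: subgroup.subgroup_is_group is_group)
  have "card (rcosets\<^bsub>G\<lparr>carrier := K\<rparr>\<^esub> H) * card H = order (G\<lparr>carrier := K\<rparr>)"
    by (rule K.lagrange) (rule subgroup_incl[OF assms(2-4)])
  then have "card K = card (rcosets\<^bsub>G\<lparr>carrier := K\<rparr>\<^esub> H) * card H" by (simp add: order_def)
  then show ?thesis by (rule dvdI[OF trans[OF _ mult.commute]])
qed

lemma subgroup_card_pos: "finite (carrier G) \<Longrightarrow> subgroup H G \<Longrightarrow> 0 < card H"
  using subgroup.finite_imp_card_positive by blast

lemma index_dvd_index:
  assumes "finite (carrier G)" "subgroup H G" "subgroup K G" "subgroup L G" "H \<subseteq> K" "K \<subseteq> L"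
  shows "card L div card K dvd card L div card H"
  using assms by (intro div_dvd_div_of_dvd card_subgroup_dvd subgroup_card_pos) auto

lemma pow_card_subgroup:
  assumes "finite (carrier G)" "subgroup H G" "x \<in> H"
  shows "x [^] card H = \<one>"
proof -
  interpret H: group "G\<lparr>carrier := H\<rparr>" using assms by (simp add: subgroup.subgroup_is_group is_group)
  show ?thesis using H.pow_order_eq_1[of x] assms(3) by (simp add: order_def flip: nat_pow_consistent)
qed

lemma coprime_pow_mem:
  assumes H: "subgroup H G" and x: "x \<in> carrier G"
    and mn: "x [^] (m::nat) \<in> H" "x [^] (n::nat) \<in> H" "coprime m n"
  shows "x \<in> H"
proof (cases "m = 0")
  case True
  then show ?thesis using mn x by simp
next
  case False
  then obtain s t where st: "m * s = n * t + 1" using bezout_nat[of m n] mn(3) by auto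
  have "x [^] (n * t) \<otimes> x = x [^] (m * s)" using x by (simp add: st)
  then have "x = inv ((x [^] n) [^] t) \<otimes> (x [^] m) [^] s" using x
    by (metis inv_solve_left nat_pow_closed nat_pow_pow)
  moreover have "(x [^] n) [^] t \<in> H" "(x [^] m) [^] s \<in> H"
    using mn H by (auto simp: subgroup_nat_pow_closed)
  ultimately show ?thesis using H by (metis subgroup.m_closed subgroup.m_inv_closed)
qed

lemma coprime_pow_one:
  assumes "x \<in> carrier G" "x [^] (m::nat) = \<one>" "x [^] (n::nat) = \<one>" "coprime m n"
  shows "x = \<one>"
  using coprime_pow_mem[OF triv_subgroup, of x m n] assms by simp

text \<open>A Sylow p-subgroup of K cannot lie in H, for then |K : H| would divide an index prime to
  p.\<close>

lemma exists_p_element_outside: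
  assumes p: "prime p" and fin: "finite (carrier G)" and HK: "subgroup H G" "subgroup K G" "H \<subseteq> K"
    and dvd: "p dvd card K div card H"
  obtains x i where "x \<in> K" "x \<notin> H" "x [^] (p ^ i) = \<one>"
proof -
  obtain A a where A: "subgroup A G" "A \<subseteq> K" "card A = p ^ a" "\<not> p dvd card K div card A"
    using sylow_exists[OF p fin HK(2)] by metis
  have "\<not> A \<subseteq> H"
  proof
    assume "A \<subseteq> H"
    then have "card K div card H dvd card K div card A"
      using index_dvd_index[OF fin A(1) HK(1,2)] HK(3) by blast
    then show False using dvd A(4) dvd_trans by blast
  qed
  then obtain x where x: "x \<in> A" "x \<notin> H" by blast
  have "x [^] (p ^ a) = \<one>" using pow_card_subgroup[OF fin A(1) x(1)] A(3) by simp
  with subsetD[OF A(2) x(1)] x(2) show ?thesis by (rule that)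
qed

text \<open>A Sylow p-subgroup of L can be conjugated into A and stays in L by normality; so the
  intersection contains a Sylow p-subgroup of L.\<close>

lemma sylow_Int_normal:
  assumes p: "prime p" and fin: "finite (carrier G)" and L: "L \<lhd> G"
    and A: "subgroup A G" "card A = p ^ n" "\<not> p dvd order G div card A"
  shows "\<not> p dvd card L div card (A \<inter> L)"
proof -
  have sL: "subgroup L G" using L by (rule normal_imp_subgroup)
  have sAL: "subgroup (A \<inter> L) G" by (rule subgroups_Inter_pair[OF A(1) sL])
  obtain B b where B: "subgroup B G" "B \<subseteq> L" "card B = p ^ b" "\<not> p dvd card L div card B"
    using sylow_exists[OF p fin sL] by metis
  obtain g where g: "g \<in> carrier G" "\<And>h. h \<in> B \<Longrightarrow> conj_by g h \<in> A"
    using p_subgroup_conj_into[OF p fin A(1) B(1,3) A(3)] by metis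
  have gB: "subgroup (conj_by g ` B) G" "card (conj_by g ` B) = card B"
    by (rule conj_by_image_subgroup[OF g(1) B(1)])+
  have sub: "conj_by g ` B \<subseteq> A \<inter> L" using g normal_conj_by[OF L g(1)] B(2) by blast
  have "card L div card (A \<inter> L) dvd card L div card (conj_by g ` B)"
    by (rule index_dvd_index[OF fin gB(1) sAL sL sub]) simp
  then show ?thesis using B(4) gB(2) dvd_trans by metis
qed

lemma normal_p_subgroup_le_sylow:
  assumes p: "prime p" and fin: "finite (carrier G)" and N: "N \<lhd> G" "card N = p ^ k"
    and A: "subgroup A G" "\<not> p dvd order G div card A"
  shows "N \<subseteq> A"
proof
  fix x assume x: "x \<in> N"
  obtain g where g: "g \<in> carrier G" "\<And>h. h \<in> N \<Longrightarrow> conj_by g h \<in> A"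
    using p_subgroup_conj_into[OF p fin A(1) normal_imp_subgroup[OF N(1)] N(2) A(2)] by metis
  have "conj_by g (conj_by (inv g) x) \<in> A" using g normal_conj_by[OF N(1)] x by simp
  then show "x \<in> A"
    using g(1) subgroup.mem_carrier[OF normal_imp_subgroup[OF N(1)] x] by simp
qed

lemma sylow_containing:
  assumes p: "prime p" and fin: "finite (carrier G)" and x: "x \<in> carrier G" "x [^] (p ^ i) = \<one>"
  obtains A n where "subgroup A G" "card A = p ^ n" "\<not> p dvd order G div card A" "x \<in> A"
proof -
  obtain B n where B: "subgroup B G" "card B = p ^ n" "\<not> p dvd order G div card B"
    using sylow_exists[OF p fin subgroup_self] unfolding order_def by metis
  have "ord x dvd p ^ i" using x pow_eq_id by blast
  then obtain k where k: "ord x = p ^ k" using divides_primepow_nat[OF p] by blast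
  have "card (generate G {x}) = p ^ k" using generate_pow_card[OF x(1)] k by simp
  then obtain g where g: "g \<in> carrier G" "\<And>h. h \<in> generate G {x} \<Longrightarrow> conj_by g h \<in> B"
    using p_subgroup_conj_into[OF p fin B(1) generate_is_subgroup[of "{x}"] _ B(3)] x(1) by (metis empty_subsetI insert_subset)
  have "x \<in> generate G {x}" by (rule generate.incl) simp
  then have "conj_by g x \<in> B" by (rule g(2))
  then have "conj_by (inv g) (conj_by g x) \<in> conj_by (inv g) ` B" by (rule imageI)
  then have "x \<in> conj_by (inv g) ` B" using g(1) x(1) by simp
  moreover have "subgroup (conj_by (inv g) ` B) G" "card (conj_by (inv g) ` B) = card B"
    using conj_by_image_subgroup[OF _ B(1), of "inv g"] g(1) by simp_all
  ultimately show ?thesis using that[of "conj_by (inv g) ` B" n] B(2,3) by simp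
qed

lemma subgroup_product:
  assumes N: "N \<lhd> G" and H: "subgroup H G"
  shows "subgroup {a \<otimes> h | a h. a \<in> N \<and> h \<in> H} G" (is "subgroup ?U G")
proof -
  interpret N: subgroup N G using N by (rule normal_imp_subgroup)
  interpret H: subgroup H G by (rule H)
  show ?thesis
  proof (rule subgroupI)
    show "?U \<noteq> {}" using N.one_closed H.one_closed by blast
  next
    fix x assume "x \<in> ?U"
    then obtain a h where ah: "a \<in> N" "h \<in> H" "x = a \<otimes> h" by blast
    then have "inv x = conj_by (inv h) (inv a) \<otimes> inv h" by (simp add: conj_by_def inv_mult_group m_assoc)
    then show "inv x \<in> ?U" using ah normal_conj_by[OF N, of "inv h" "inv a"] by auto
  next
    fix x y assume "x \<in> ?U" "y \<in> ?U"
    then obtain a h b k where ah: "a \<in> N" "h \<in> H" "x = a \<otimes> h" "b \<in> N" "k \<in> H" "y = b \<otimes> k" by blast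
    then have "x \<otimes> y = (a \<otimes> conj_by h b) \<otimes> (h \<otimes> k)" by (simp add: conj_by_def m_assoc)
    moreover have "a \<otimes> conj_by h b \<in> N" "h \<otimes> k \<in> H" using ah normal_conj_by[OF N, of h b] by auto
    ultimately show "x \<otimes> y \<in> ?U" by blast
  qed auto
qed

lemma trivial_Int_product_eq:
  assumes PQ: "subgroup P G" "subgroup Q G" "P \<inter> Q = {\<one>}"
    and uv: "u \<in> P" "v \<in> Q" "u' \<in> P" "v' \<in> Q" "u \<otimes> v = u' \<otimes> v'"
  shows "u = u' \<and> v = v'"
proof -
  note c = subgroup.mem_carrier[OF PQ(1)] subgroup.mem_carrier[OF PQ(2)]
  have "inv u' \<otimes> u = v' \<otimes> inv v"
    using uv c by (metis inv_closed inv_solve_left inv_solve_right m_assoc m_closed)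
  moreover have "inv u' \<otimes> u \<in> P" using uv PQ(1) by (simp add: subgroup.m_closed subgroup.m_inv_closed)
  moreover have "v' \<otimes> inv v \<in> Q" using uv PQ(2) by (simp add: subgroup.m_closed subgroup.m_inv_closed)
  ultimately have "inv u' \<otimes> u = \<one>" using PQ(3) by auto
  then have "inv u = inv u'" using uv c inv_equality[of "inv u'" u] by simp
  then have "u = u'" using uv c by (metis inv_inv)
  then show ?thesis using uv c by simp
qed

lemma conj_by_consistent [simp]:
  "subgroup H G \<Longrightarrow> g \<in> H \<Longrightarrow> group.conj_by (G\<lparr>carrier := H\<rparr>) g x = conj_by g x"
  by (simp add: conj_by_def group.conj_by_def subgroup.subgroup_is_group is_group)

lemma fixed_by_pow:
  assumes "g \<in> carrier G" "x \<in> carrier G" "conj_by g x = x"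
  shows "conj_by (g [^] (n::nat)) x = x"
  using conj_by_pow_left[OF assms(1,2), of 1 n] assms by simp

end

text \<open>\<open>H\<close> is a minimal supplement of \<open>P\<close>. Then \<open>P \<inter> H\<close> is normal in \<open>G\<close>, as \<open>P\<close> is abelian, and for a maximal
  subgroup \<open>M\<close> not containing it \<open>H \<inter> M\<close> would be a smaller supplement.\<close>

lemma (in abelian_normal) frattini_supplement_exists:
  "\<exists>H. subgroup H G \<and> (\<forall>g\<in>carrier G. \<exists>a\<in>P. \<exists>h\<in>H. g = a \<otimes> h) \<and> P \<inter> H \<subseteq> Frat G"
proof -
  define S where "S = {H. subgroup H G \<and> (\<forall>g\<in>carrier G. \<exists>a\<in>P. \<exists>h\<in>H. g = a \<otimes> h)}"
  have "S \<subseteq> Pow (carrier G)" unfolding S_def using subgroup.subset by auto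
  then have "finite S" using finite_carrier by (meson finite_Pow_iff finite_subset)
  moreover have "carrier G \<in> S"
    unfolding S_def using subgroup_self by (force intro: bexI[of _ \<one>])
  ultimately obtain H where H: "H \<in> S" "\<And>K. K \<in> S \<Longrightarrow> K \<subseteq> H \<Longrightarrow> K = H"
    using finite_has_minimal[of S] by blast
  have sH: "subgroup H G" and PH: "\<And>g. g \<in> carrier G \<Longrightarrow> \<exists>a\<in>P. \<exists>h\<in>H. g = a \<otimes> h"
    using H(1) by (auto simp: S_def)
  interpret H: subgroup H G by (rule sH)
  have D: "conj_by g d \<in> P \<inter> H" if g: "g \<in> carrier G" and d: "d \<in> P \<inter> H" for g d
  proof -
    obtain a h where ah: "a \<in> P" "h \<in> H" "g = a \<otimes> h" using PH[OF g] by blast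
    have hd: "conj_by h d \<in> P" using ah d by simp
    have "conj_by h d \<in> H" unfolding conj_by_def using ah(2) d H.m_closed H.m_inv_closed by auto
    moreover have "conj_by g d = conj_by h d"
      using ah hd d conj_by_mult_left[of a h d] conj_P_trivial[OF ah(1) hd] by simp
    ultimately show ?thesis using hd by simp
  qed
  have "d \<in> M" if d: "d \<in> P \<inter> H" and M: "maximal_subgroup M G" for d M
  proof (rule ccontr)
    assume dM: "d \<notin> M"
    have sM: "subgroup M G" and max: "\<And>K. subgroup K G \<Longrightarrow> M \<subseteq> K \<Longrightarrow> K = M \<or> K = carrier G"
      using M by (auto simp: maximal_subgroup_def)
    interpret M: subgroup M G by (rule sM)
    have Dn: "P \<inter> H \<lhd> G"
      by (rule normal_conj_byI[OF subgroups_Inter_pair[OF subgroup_axioms sH] D])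
    let ?U = "{a \<otimes> h | a h. a \<in> P \<inter> H \<and> h \<in> M}"
    have sU: "subgroup ?U G" by (rule subgroup_product[OF Dn sM])
    have MU: "M \<subseteq> ?U"
    proof
      fix m assume "m \<in> M"
      then have "m = \<one> \<otimes> m" "\<one> \<in> P \<inter> H" by simp_all
      then show "m \<in> ?U" using \<open>m \<in> M\<close> by blast
    qed
    have dU: "d \<in> ?U"
    proof -
      have "d = d \<otimes> \<one>" "\<one> \<in> M" using d by simp_all
      then show ?thesis using d by blast
    qed
    have U_neq: "?U \<noteq> M" using dU dM by (rule_tac notI, simp only:)
    from max[OF sU MU] have U: "?U = carrier G" by (rule disjE) (rule notE[OF U_neq])
    have "H \<inter> M \<in> S"
      unfolding S_def
    proof (intro CollectI conjI ballI)
      show "subgroup (H \<inter> M) G" by (rule subgroups_Inter_pair[OF sH sM])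
      fix g assume "g \<in> carrier G"
      then obtain a h where ah: "a \<in> P" "h \<in> H" "g = a \<otimes> h" using PH by blast
      have "h \<in> ?U" using U ah(2) by simp
      \<comment> \<open>Writing h = e m with e in H puts m into H as well, so the intersection of H
        and M still supplements P.\<close>
      then obtain e m where em: "e \<in> P \<inter> H" "m \<in> M" "h = e \<otimes> m" by blast
      have "m = inv e \<otimes> h" using em by simp
      moreover have "inv e \<otimes> h \<in> H" using em(1) ah(2) by (intro H.m_closed H.m_inv_closed) simp_all
      ultimately have "m \<in> H" by simp
      moreover have "g = (a \<otimes> e) \<otimes> m" using ah em by (simp add: m_assoc)
      moreover have "a \<otimes> e \<in> P" using ah em by simp
      ultimately show "\<exists>a\<in>P. \<exists>h\<in>H \<inter> M. g = a \<otimes> h" using em(2) by blast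
    qed
    then have "H \<inter> M = H" using H(2) by blast
    then show False using d dM by blast
  qed
  then have "P \<inter> H \<subseteq> Frat G" unfolding Frat_def using subset by fast
  with sH PH show ?thesis by blast
qed

section \<open>The structure of the example\<close>

text \<open>All hypotheses are symmetric under exchanging \<open>(p, P)\<close> and \<open>(q, Q)\<close>, so every result below
  comes in two versions.\<close>

locale frattini_pair = group G for G (structure) +
  fixes p q :: nat and P Q :: "'a set" and a b :: nat
  assumes finite: "finite (carrier G)"
    and p: "prime p" "odd p" and q: "prime q" "odd q" and p_neq_q: "p \<noteq> q"
    and P: "P \<lhd> G" "card P = p ^ a" "P \<noteq> {\<one>}"
    and Q: "Q \<lhd> G" "card Q = q ^ b" "Q \<noteq> {\<one>}"
    and Frat_iff: "\<And>x. x \<in> Frat G \<longleftrightarrow> (\<exists>u\<in>P. \<exists>v\<in>Q. x = u \<otimes> v)"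
    and no_commuting: "\<And>N x y i j. N \<lhd> G \<Longrightarrow> N \<noteq> {\<one>} \<Longrightarrow> x \<in> carrier G \<Longrightarrow> y \<in> carrier G \<Longrightarrow>
      x [^] (p ^ i) \<in> N \<Longrightarrow> y [^] (q ^ j) \<in> N \<Longrightarrow> x \<notin> N \<Longrightarrow> y \<notin> N \<Longrightarrow>
      N #> (x \<otimes> y) = N #> (y \<otimes> x) \<Longrightarrow> False"
    and Frat_proper_normal: "\<And>L. L \<lhd> G \<Longrightarrow> Frat G \<subseteq> L \<Longrightarrow> L \<noteq> carrier G \<Longrightarrow>
      \<not> Frat G \<subseteq> Frat (G\<lparr>carrier := L\<rparr>)"
begin

lemma sub_P: "subgroup P G" and sub_Q: "subgroup Q G"
  using P(1) Q(1) by (simp_all add: normal_imp_subgroup)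

lemma mem_P [simp]: "u \<in> P \<Longrightarrow> u \<in> carrier G" and mem_Q [simp]: "v \<in> Q \<Longrightarrow> v \<in> carrier G"
  by (rule subgroup.mem_carrier[OF sub_P], assumption) (rule subgroup.mem_carrier[OF sub_Q])

lemma pow_P: "u \<in> P \<Longrightarrow> u [^] (p ^ a) = \<one>" and pow_Q: "v \<in> Q \<Longrightarrow> v [^] (q ^ b) = \<one>"
  using pow_card_subgroup[OF finite sub_P] pow_card_subgroup[OF finite sub_Q] P(2) Q(2) by simp_all

lemma coprime_pq [simp]: "coprime p q" "coprime q p"
  using p(1) q(1) p_neq_q by (simp_all add: primes_coprime)

lemma Int_PQ: "P \<inter> Q = {\<one>}"
proof -
  have "x = \<one>" if "x \<in> P" "x \<in> Q" for x
    using coprime_pow_one[of x "p ^ a" "q ^ b"] that pow_P pow_Q by simp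
  then show ?thesis using sub_P sub_Q subgroup.one_closed by fast
qed

lemma conj_P_closed [simp]: "g \<in> carrier G \<Longrightarrow> u \<in> P \<Longrightarrow> conj_by g u \<in> P"
  and conj_Q_closed [simp]: "g \<in> carrier G \<Longrightarrow> v \<in> Q \<Longrightarrow> conj_by g v \<in> Q"
  by (rule normal_conj_by[OF P(1)], assumption+) (rule normal_conj_by[OF Q(1)])

lemma conj_PQ [simp]: "u \<in> P \<Longrightarrow> v \<in> Q \<Longrightarrow> conj_by u v = v"
proof -
  assume uv: "u \<in> P" "v \<in> Q"
  \<comment> \<open>The commutator, bracketed in two ways, lies in both normal subgroups.\<close>
  have "conj_by u v \<otimes> inv v = u \<otimes> conj_by v (inv u)"
    using uv by (simp add: conj_by_def m_assoc)
  moreover have "u \<otimes> conj_by v (inv u) \<in> P"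
    using uv sub_P by (simp add: subgroup.m_closed subgroup.m_inv_closed)
  moreover have "conj_by u v \<otimes> inv v \<in> Q"
    using uv sub_Q by (simp add: subgroup.m_closed subgroup.m_inv_closed)
  ultimately have "conj_by u v \<otimes> inv v \<in> P \<inter> Q" by simp
  then have "conj_by u v \<otimes> inv v = \<one>" unfolding Int_PQ by simp
  then show "conj_by u v = v" using uv inv_equality[of "conj_by u v" "inv v"] by simp
qed

lemma comm_PQ: "u \<in> P \<Longrightarrow> v \<in> Q \<Longrightarrow> u \<otimes> v = v \<otimes> u"
  using conj_PQ conj_by_eq_iff[of u v] by simp

lemma conj_QP [simp]: "u \<in> P \<Longrightarrow> v \<in> Q \<Longrightarrow> conj_by v u = u"
  using comm_PQ[of u v, symmetric] conj_by_eq_iff[of v u] by simp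

lemma P_le_Frat: "P \<subseteq> Frat G" and Q_le_Frat: "Q \<subseteq> Frat G"
proof -
  show "P \<subseteq> Frat G"
  proof
    fix u assume "u \<in> P"
    then show "u \<in> Frat G"
      unfolding Frat_iff using subgroup.one_closed[OF sub_Q] by (intro bexI[of _ u] bexI[of _ \<one>]) simp_all
  qed
  show "Q \<subseteq> Frat G"
  proof
    fix v assume "v \<in> Q"
    then show "v \<in> Frat G"
      unfolding Frat_iff using subgroup.one_closed[OF sub_P] by (intro bexI[of _ \<one>] bexI[of _ v]) simp_all
  qed
qed

lemma swap: "frattini_pair G q p Q P b a"
proof (intro frattini_pair.intro frattini_pair_axioms.intro)
  fix x
  show "x \<in> Frat G \<longleftrightarrow> (\<exists>u\<in>Q. \<exists>v\<in>P. x = u \<otimes> v)"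
    unfolding Frat_iff using comm_PQ by metis
next
  fix N x y i j assume "N \<lhd> G" "N \<noteq> {\<one>}" "x \<in> carrier G" "y \<in> carrier G"
      "x [^] (q ^ i) \<in> N" "y [^] (p ^ j) \<in> N" "x \<notin> N" "y \<notin> N" "N #> (x \<otimes> y) = N #> (y \<otimes> x)"
  then show False using no_commuting[of N y x j i] by simp
qed (rule is_group finite p q P Q p_neq_q[symmetric] Frat_proper_normal | assumption)+

lemma P_nontrivial: obtains u where "u \<in> P" "u \<noteq> \<one>"
  using P(3) subgroup.one_closed[OF sub_P] by fast

lemma Q_nontrivial: obtains v where "v \<in> Q" "v \<noteq> \<one>"
  using Q(3) subgroup.one_closed[OF sub_Q] by fast

text \<open>If N lay strictly between 1 and P, an element of P outside N and a nontrivial element of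
  Q would have nontrivial commuting images in G / N.\<close>

lemma minimal_P:
  assumes N: "N \<lhd> G" "N \<subseteq> P"
  shows "N = {\<one>} \<or> N = P"
proof (rule ccontr)
  assume *: "\<not> (N = {\<one>} \<or> N = P)"
  then obtain u where u: "u \<in> P" "u \<notin> N" using N(2) by blast
  obtain v where v: "v \<in> Q" "v \<noteq> \<one>" by (rule Q_nontrivial)
  have "v \<notin> N"
  proof
    assume "v \<in> N"
    then have "v \<in> P \<inter> Q" using N(2) v(1) by blast
    then show False using v(2) unfolding Int_PQ by simp
  qed
  moreover have "\<one> \<in> N" using subgroup.one_closed[OF normal_imp_subgroup[OF N(1)]] .
  ultimately show False
    using no_commuting[OF N(1), of u v a b] * u v comm_PQ[OF u(1) v(1)] pow_P pow_Q by simp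
qed

text \<open>The center of the p-group P is nontrivial and normal in G, hence all of P by
  \<open>minimal_P\<close>.\<close>

lemma abelian_P: "u \<in> P \<Longrightarrow> v \<in> P \<Longrightarrow> u \<otimes> v = v \<otimes> u"
proof -
  interpret PG: group "G\<lparr>carrier := P\<rparr>" using sub_P by (simp add: subgroup.subgroup_is_group is_group)
  define Z where "Z = {z \<in> P. \<forall>u\<in>P. u \<otimes> z = z \<otimes> u}"
  have ZP: "z \<in> P" "\<And>u. u \<in> P \<Longrightarrow> conj_by u z = z" if "z \<in> Z" for z
    using that by (auto simp: Z_def conj_by_eq_iff)
  have ZI: "z \<in> Z" if "z \<in> P" "\<And>u. u \<in> P \<Longrightarrow> conj_by u z = z" for z
    using that conj_by_eq_iff[OF mem_P mem_P] by (simp add: Z_def)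
  have "subgroup Z G"
  proof (rule subgroupI)
    show "Z \<subseteq> carrier G" using ZP(1) mem_P by blast
    have "\<one> \<in> Z" using subgroup.one_closed[OF sub_P] by (intro ZI) simp_all
    then show "Z \<noteq> {}" by blast
  next
    fix z assume z: "z \<in> Z"
    then show "inv z \<in> Z"
      using ZP[OF z] subgroup.m_inv_closed[OF sub_P] by (intro ZI) (simp_all add: conj_by_inv)
  next
    fix z w assume zw: "z \<in> Z" "w \<in> Z"
    show "z \<otimes> w \<in> Z"
      using ZP[OF zw(1)] ZP[OF zw(2)] subgroup.m_closed[OF sub_P] by (intro ZI) (simp_all add: conj_by_mult)
  qed
  then have "Z \<lhd> G"
  proof (rule normal_conj_byI)
    fix g z assume g: "g \<in> carrier G" and z: "z \<in> Z"
    show "conj_by g z \<in> Z"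
    proof (rule ZI)
      show "conj_by g z \<in> P" using g ZP[OF z] by simp
      fix u assume u: "u \<in> P"
      have "conj_by u (conj_by g z) = conj_by g (conj_by (conj_by (inv g) u) z)"
        using g u ZP[OF z] by (simp add: conj_by_def m_assoc inv_mult_group)
      then show "conj_by u (conj_by g z) = conj_by g z" using g u ZP[OF z] by simp
    qed
  qed
  moreover have "Z \<subseteq> P" using ZP(1) by blast
  moreover have "Z \<noteq> {\<one>}"
  proof -
    have "order (G\<lparr>carrier := P\<rparr>) = p ^ a" using P(2) by (simp add: order_def)
    then obtain z where "z \<in> P" "z \<noteq> \<one>" "\<And>g. g \<in> P \<Longrightarrow> g \<otimes> z = z \<otimes> g"
      using PG.p_group_center_nontrivial[OF p(1)] P(3) by auto
    then show ?thesis by (auto simp: Z_def)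
  qed
  ultimately have "Z = P" using minimal_P by blast
  then show "u \<in> P \<Longrightarrow> v \<in> P \<Longrightarrow> u \<otimes> v = v \<otimes> u" by (auto simp: Z_def)
qed

lemma abelian_normal_P: "abelian_normal P G"
  using P(1) finite abelian_P by (simp add: abelian_normal_def abelian_normal_axioms_def)

text \<open>A nontrivial fixed v would stay nontrivial in G / P and commute there with the image of
  x, a nontrivial p-element.\<close>

lemma no_fixed_Q:
  assumes x: "x \<in> carrier G" "x [^] (p ^ i) \<in> P" "x \<notin> P" and v: "v \<in> Q" "conj_by x v = v"
  shows "v = \<one>"
proof (rule ccontr)
  assume "v \<noteq> \<one>"
  then have "v \<notin> P" using v(1) Int_PQ by blast
  moreover have "x \<otimes> v = v \<otimes> x" using v x(1) conj_by_eq_iff[of x v] by simp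
  ultimately show False
    using no_commuting[OF P(1,3) x(1) mem_Q[OF v(1)] x(2), of b] x(3) pow_Q[OF v(1)]
      subgroup.one_closed[OF sub_P] by simp
qed

lemma sub_F: "subgroup (Frat G) G" by (rule Frat_subgroup)

text \<open>Here x is a p-element only modulo F = P Q. Raising it to the power q^b removes the
  Q-component of x^(p^i), so that \<open>no_fixed_Q\<close> applies; the power is not in P, since
  otherwise coprimality of p^i and q^b would put x into F.\<close>

lemma no_fixed_Q_Frat:
  assumes x: "x \<in> carrier G" "x [^] (p ^ i) \<in> Frat G" "x \<notin> Frat G" and v: "v \<in> Q" "conj_by x v = v"
  shows "v = \<one>"
proof (rule no_fixed_Q[of "x [^] (q ^ b)" i])
  obtain u w where uw: "u \<in> P" "w \<in> Q" "x [^] (p ^ i) = u \<otimes> w" using x(2) Frat_iff by auto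
  have "(x [^] (q ^ b)) [^] (p ^ i) = (x [^] (p ^ i)) [^] (q ^ b)"
    using x(1) by (simp add: nat_pow_pow mult.commute)
  also have "\<dots> = u [^] (q ^ b)"
    using uw pow_mult_distrib[OF comm_PQ[OF uw(1,2)]] pow_Q by simp
  finally show "(x [^] (q ^ b)) [^] (p ^ i) \<in> P" using uw(1) sub_P by (simp add: subgroup_nat_pow_closed)
  show "x [^] (q ^ b) \<notin> P"
  proof
    assume "x [^] (q ^ b) \<in> P"
    then have "x [^] (q ^ b) \<in> Frat G" using P_le_Frat by blast
    then have "x \<in> Frat G" using coprime_pow_mem[OF sub_F x(1,2)] by simp
    then show False using x(3) by simp
  qed
  show "conj_by (x [^] (q ^ b)) v = v" using fixed_by_pow x(1) v by simp
qed (use x v in simp_all)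

lemma no_complement_P: "\<not> is_complement G P H"
  using Frat_complement_trivial[OF finite P_le_Frat] P(3) by blast

lemma card_Frat: "card (Frat G) = card P * card Q"
proof -
  have "bij_betw (\<lambda>(u, v). u \<otimes> v) (P \<times> Q) (Frat G)"
    unfolding bij_betw_def
  proof
    show "inj_on (\<lambda>(u, v). u \<otimes> v) (P \<times> Q)"
    proof (rule inj_onI, clarsimp)
      fix u v u' v' assume *: "u \<in> P" "v \<in> Q" "u' \<in> P" "v' \<in> Q" "u \<otimes> v = u' \<otimes> v'"
      show "u = u' \<and> v = v'" by (rule trivial_Int_product_eq[OF sub_P sub_Q Int_PQ *])
    qed
    show "(\<lambda>(u, v). u \<otimes> v) ` (P \<times> Q) = Frat G" unfolding set_eq_iff Frat_iff by force
  qed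
  from bij_betw_same_card[OF this] show ?thesis by (simp add: card_cartesian_product)
qed

lemma index_P:
  assumes "subgroup L G" "Frat G \<subseteq> L"
  shows "card L div card P = (card L div card (Frat G)) * card Q"
proof -
  have "card (Frat G) dvd card L" by (rule card_subgroup_dvd[OF finite sub_F assms])
  then obtain k where k: "card L = card P * card Q * k" using card_Frat by auto
  have "0 < card P" "0 < card Q" using subgroup_card_pos finite sub_P sub_Q by simp_all
  then show ?thesis unfolding card_Frat k by simp
qed

text \<open>The fixed points of L in P form a normal subgroup of G, so they are 1 or P. If they were
  trivial, averaging over L / P would split G over P, since |L : P| = |L : F| |Q| is prime to
  p.\<close>

lemma p'_index_centralizes:
  assumes L: "L \<lhd> G" "Frat G \<subseteq> L" "\<not> p dvd card L div card (Frat G)"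
    and lu: "l \<in> L" "u \<in> P"
  shows "conj_by l u = u"
proof -
  interpret P: abelian_normal P G by (rule abelian_normal_P)
  have sL: "subgroup L G" using L(1) by (rule normal_imp_subgroup)
  note Lc = subgroup.mem_carrier[OF sL]
  define Z where "Z = {u \<in> P. \<forall>l\<in>L. conj_by l u = u}"
  have "subgroup Z G"
  proof (rule subgroupI)
    have "\<one> \<in> Z" using subgroup.one_closed[OF sub_P] Lc by (simp add: Z_def)
    then show "Z \<noteq> {}" by blast
  qed (use Lc sub_P in \<open>auto simp: Z_def conj_by_inv conj_by_mult subgroup.m_closed subgroup.m_inv_closed\<close>)
  then have "Z \<lhd> G"
  proof (rule normal_conj_byI)
    fix g z assume g: "g \<in> carrier G" and z: "z \<in> Z"
    have zP: "z \<in> P" using z by (simp add: Z_def)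
    have "conj_by l (conj_by g z) = conj_by g z" if l: "l \<in> L" for l
    proof -
      have "conj_by l (conj_by g z) = conj_by g (conj_by (conj_by (inv g) l) z)"
        using g Lc[OF l] zP by (simp add: conj_by_def m_assoc inv_mult_group)
      moreover have "conj_by (inv g) l \<in> L" using normal_conj_by[OF L(1)] g l by simp
      ultimately show ?thesis using z by (simp add: Z_def)
    qed
    then show "conj_by g z \<in> Z" using g zP by (simp add: Z_def)
  qed
  moreover have "Z \<subseteq> P" by (auto simp: Z_def)
  ultimately consider "Z = {\<one>}" | "Z = P" using minimal_P by blast
  then show ?thesis
  proof cases
    case 1
    have "\<not> p dvd card L div card P"
    proof
      assume "p dvd card L div card P"
      then have "p dvd q ^ b"
        using L(3) p(1) Q(2) unfolding index_P[OF sL L(2)] by (simp add: prime_dvd_mult_iff)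
      then have "p dvd q" using p(1) prime_dvd_power by blast
      then show False using p(1) q(1) p_neq_q by (simp add: primes_dvd_imp_eq)
    qed
    then have "coprime (card L div card P) (card P)"
      unfolding P(2) using p(1) by (simp add: coprime_commute prime_imp_coprime)
    moreover have "u = \<one>" if "u \<in> P" "\<And>l. l \<in> L \<Longrightarrow> conj_by l u = u" for u
    proof -
      have "u \<in> Z" using that by (simp add: Z_def)
      then show ?thesis using 1 by simp
    qed
    ultimately have "\<exists>H. is_complement G P H"
      by (rule P.complement_of_no_fixed_points[OF L(1) subset_trans[OF P_le_Frat L(2)]])
    then show ?thesis using no_complement_P by blast
  next
    case 2
    then have "u \<in> Z" using lu(2) by simp
    then show ?thesis using lu(1) by (simp add: Z_def)
  qed
qed

lemma normal_Frat: "Frat G \<lhd> G" by (rule Frat_normal)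

lemma Frat_not_carrier: "Frat G \<noteq> carrier G"
proof (rule Frat_proper[OF finite])
  show "carrier G \<noteq> {\<one>}" using P_nontrivial mem_P by (metis singletonD)
qed

lemma conj_Frat_P: "x \<in> Frat G \<Longrightarrow> w \<in> P \<Longrightarrow> conj_by x w = w"
proof -
  assume x: "x \<in> Frat G" and w: "w \<in> P"
  then obtain u v where uv: "u \<in> P" "v \<in> Q" "x = u \<otimes> v" using Frat_iff by auto
  then have "conj_by x w = conj_by u w" using w by (simp add: conj_by_mult_left)
  also have "\<dots> = w" using uv(1) w abelian_P conj_by_eq_iff[of u w] by simp
  finally show ?thesis .
qed

text \<open>The centralizer \<open>C\<close> of \<open>P\<close> has index prime to \<open>p q\<close> over the Frattini subgroup \<open>F\<close>, which is central in it,
  so \<open>C = F \<times> K\<close> with \<open>K\<close> characteristic; modulo \<open>K\<close> there would still be commuting \<open>p\<close>- and \<open>q\<close>-elements.\<close>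

lemma centralizer_P_le_Frat:
  assumes x: "x \<in> carrier G" "\<And>u. u \<in> P \<Longrightarrow> conj_by x u = u"
  shows "x \<in> Frat G"
proof -
  let ?F = "Frat G"
  note sF = sub_F
  have oneF: "\<one> \<in> ?F" using subgroup.one_closed[OF sF] .
  define C where "C = {x \<in> carrier G. \<forall>u\<in>P. conj_by x u = u}"
  have CI: "x \<in> C" if "x \<in> carrier G" "\<And>u. u \<in> P \<Longrightarrow> conj_by x u = u" for x
    using that by (simp add: C_def)
  have CD: "x \<in> carrier G" "\<And>u. u \<in> P \<Longrightarrow> conj_by x u = u" if "x \<in> C" for x
    using that by (simp_all add: C_def)
  have sC: "subgroup C G"
  proof (rule subgroupI)
    have "\<one> \<in> C" by (rule CI) simp_all
    then show "C \<noteq> {}" by blast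
  next
    fix y assume y: "y \<in> C"
    show "inv y \<in> C"
    proof (rule CI)
      fix u assume u: "u \<in> P"
      have "conj_by (inv y) (conj_by y u) = u" using CD(1)[OF y] u by simp
      then show "conj_by (inv y) u = u" using CD(2)[OF y u] by simp
    qed (simp add: CD(1)[OF y])
  next
    fix y z assume yz: "y \<in> C" "z \<in> C"
    show "y \<otimes> z \<in> C" by (rule CI) (use CD[OF yz(1)] CD[OF yz(2)] in \<open>simp_all add: conj_by_mult_left\<close>)
  qed (simp add: C_def)
  have nC: "C \<lhd> G"
  proof (rule normal_conj_byI[OF sC])
    fix g y assume g: "g \<in> carrier G" and y: "y \<in> C"
    show "conj_by g y \<in> C"
    proof (rule CI)
      show "conj_by g y \<in> carrier G" using g CD(1)[OF y] by simp
      fix u assume u: "u \<in> P"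
      have "conj_by (conj_by g y) u = conj_by g (conj_by y (conj_by (inv g) u))"
        using g CD(1)[OF y] u by (simp add: conj_by_def m_assoc inv_mult_group)
      then show "conj_by (conj_by g y) u = u" using g u CD(2)[OF y, of "conj_by (inv g) u"] by simp
    qed
  qed
  have FC: "?F \<subseteq> C"
  proof
    fix y assume y: "y \<in> ?F"
    show "y \<in> C" by (rule CI) (use y conj_Frat_P subgroup.mem_carrier[OF sF] in auto)
  qed
  \<comment> \<open>A q-element of C outside F would act on P without nontrivial fixed points,
    although C centralizes P.\<close>
  have nq: "\<not> q dvd card C div card ?F"
  proof
    assume "q dvd card C div card ?F"
    then obtain y i where y: "y \<in> C" "y \<notin> ?F" "y [^] (q ^ i) = \<one>"
      using exists_p_element_outside[OF q(1) finite sF sC FC] by metis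
    obtain u where u: "u \<in> P" "u \<noteq> \<one>" by (rule P_nontrivial)
    have "u = \<one>"
      by (rule frattini_pair.no_fixed_Q_Frat[OF swap, of y i])
        (use y u CD[OF y(1)] oneF in simp_all)
    then show False using u(2) by simp
  qed
  \<comment> \<open>With |C : F| prime to q, the symmetric form of
    \<open>p'_index_centralizes\<close> makes C centralize Q too; then the argument just used for q
    also excludes p.\<close>
  have cQ: "conj_by y v = v" if "y \<in> C" "v \<in> Q" for y v
    using frattini_pair.p'_index_centralizes[OF swap nC FC nq that] .
  have np: "\<not> p dvd card C div card ?F"
  proof
    assume "p dvd card C div card ?F"
    then obtain y i where y: "y \<in> C" "y \<notin> ?F" "y [^] (p ^ i) = \<one>"
      using exists_p_element_outside[OF p(1) finite sF sC FC] by metis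
    obtain v where v: "v \<in> Q" "v \<noteq> \<one>" by (rule Q_nontrivial)
    have "v = \<one>"
      by (rule no_fixed_Q_Frat[of y i]) (use y v cQ CD(1)[OF y(1)] oneF in simp_all)
    then show False using v(2) by simp
  qed
  have cF: "conj_by y f = f" if y: "y \<in> C" and f: "f \<in> ?F" for y f
  proof -
    obtain u v where "u \<in> P" "v \<in> Q" "f = u \<otimes> v" using f Frat_iff by auto
    then show ?thesis using CD[OF y] cQ[OF y] by (simp add: conj_by_mult)
  qed
  define m where "m = card C div card ?F"
  have "coprime p m" "coprime q m"
    using np nq p(1) q(1) unfolding m_def by (simp_all add: prime_imp_coprime)
  then have cop: "coprime m (card ?F)"
    unfolding card_Frat P(2) Q(2) by (simp add: coprime_commute)
  interpret CG: group "G\<lparr>carrier := C\<rparr>" using sC by (simp add: subgroup.subgroup_is_group is_group)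
  have sFC: "subgroup ?F (G\<lparr>carrier := C\<rparr>)" by (rule subgroup_incl[OF sF sC FC])
  have nFC: "?F \<lhd> G\<lparr>carrier := C\<rparr>"
    by (rule CG.normal_conj_byI[OF sFC]) (use sC cF in simp)
  have finC: "finite C" using finite_subgroup[OF finite sC] .
  interpret F: abelian_normal ?F "G\<lparr>carrier := C\<rparr>"
  proof (intro abelian_normal.intro nFC abelian_normal_axioms.intro)
    show "finite (carrier (G\<lparr>carrier := C\<rparr>))" using finC by simp
    fix f g assume fg: "f \<in> ?F" "g \<in> ?F"
    then have "conj_by f g = g" using cF FC by blast
    then show "f \<otimes>\<^bsub>G\<lparr>carrier := C\<rparr>\<^esub> g = g \<otimes>\<^bsub>G\<lparr>carrier := C\<rparr>\<^esub> f"
      using fg conj_by_eq_iff[of f g] subgroup.mem_carrier[OF sF] by simp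
  qed
  have "coprime (order (G\<lparr>carrier := C\<rparr>) div card ?F) (card ?F)"
    using cop by (simp add: order_def m_def)
  then obtain K where K: "is_complement (G\<lparr>carrier := C\<rparr>) ?F K"
    using F.schur_zassenhaus_complement by blast
  have sK': "subgroup K (G\<lparr>carrier := C\<rparr>)" using K by (simp add: is_complement_def)
  have sK: "subgroup K G" by (rule incl_subgroup[OF sC sK'])
  have KC: "K \<subseteq> C" using subgroup.subset[OF sK'] by simp
  have FK: "?F \<inter> K = {\<one>}" using K by (simp add: is_complement_def)
  have CFK: "\<exists>f\<in>?F. \<exists>k\<in>K. y = f \<otimes> k" if "y \<in> C" for y using K that by (simp add: is_complement_def)
  have powF: "y [^] m \<in> ?F" if "y \<in> C" for y
    using CG.normal_index_pow[OF _ nFC, of y] finC that by (simp add: order_def m_def flip: nat_pow_consistent)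
  \<comment> \<open>The complement consists of the elements of C with trivial m-th power, because F
    is central in C and |F| is prime to m. This description is invariant under conjugation by
    G.\<close>
  have K_eq: "y \<in> K \<longleftrightarrow> y \<in> C \<and> y [^] m = \<one>" for y
  proof
    assume y: "y \<in> K"
    then have yC: "y \<in> C" using KC by blast
    have "y [^] m \<in> ?F \<inter> K" using powF[OF yC] subgroup_nat_pow_closed[OF sK y] by simp
    then show "y \<in> C \<and> y [^] m = \<one>" using FK yC by simp
  next
    assume y: "y \<in> C \<and> y [^] m = \<one>"
    obtain f k where fk: "f \<in> ?F" "k \<in> K" "y = f \<otimes> k" using CFK y by blast
    have kC: "k \<in> C" using fk(2) KC by blast
    have fc: "f \<in> carrier G" "k \<in> carrier G" using subgroup.mem_carrier[OF sF fk(1)] CD(1)[OF kC] by simp_all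
    have km: "k [^] m = \<one>"
    proof -
      have "k [^] m \<in> ?F \<inter> K" using powF[OF kC] subgroup_nat_pow_closed[OF sK fk(2)] by simp
      then show ?thesis using FK by simp
    qed
    have "k \<otimes> f = f \<otimes> k" using cF[OF kC fk(1)] conj_by_eq_iff[of k f] fc by simp
    then have "y [^] m = f [^] m \<otimes> k [^] m" unfolding fk(3) using fc by (intro pow_mult_distrib) simp_all
    then have "f [^] m = \<one>" using y km fc by simp
    moreover have "f [^] card ?F = \<one>" by (rule pow_card_subgroup[OF finite sF fk(1)])
    ultimately have "f = \<one>" using coprime_pow_one[OF fc(1) _ _ cop] by blast
    then show "y \<in> K" using fk fc by simp
  qed
  have nK: "K \<lhd> G"
  proof (rule normal_conj_byI[OF sK])
    fix g y assume g: "g \<in> carrier G" and y: "y \<in> K"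
    have yC: "y \<in> C" "y [^] m = \<one>" using y K_eq by simp_all
    then show "conj_by g y \<in> K"
      using K_eq normal_conj_by[OF nC g yC(1)] conj_by_pow[OF g CD(1)[OF yC(1)], of m] g by simp
  qed
  obtain u where u: "u \<in> P" "u \<noteq> \<one>" by (rule P_nontrivial)
  obtain v where v: "v \<in> Q" "v \<noteq> \<one>" by (rule Q_nontrivial)
  have "u \<notin> K" using FK u P_le_Frat by blast
  moreover have "v \<notin> K" using FK v Q_le_Frat by blast
  moreover have "\<one> \<in> K" using subgroup.one_closed[OF sK] .
  ultimately have "K = {\<one>}"
    using no_commuting[OF nK, of u v a b] u v pow_P pow_Q comm_PQ by fastforce
  moreover have "x \<in> C" using x by (rule CI)
  then obtain f k where "f \<in> ?F" "k \<in> K" "x = f \<otimes> k" using CFK by blast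
  ultimately show ?thesis using subgroup.mem_carrier[OF sF] by simp
qed

text \<open>Otherwise L would centralize P and so be contained in F.\<close>

lemma p_dvd_index:
  assumes L: "L \<lhd> G" "Frat G \<subseteq> L" "L \<noteq> Frat G"
  shows "p dvd card L div card (Frat G)"
proof (rule ccontr)
  assume "\<not> p dvd card L div card (Frat G)"
  then have "l \<in> Frat G" if "l \<in> L" for l
    using centralizer_P_le_Frat[of l] p'_index_centralizes[OF L(1,2)] that
      subgroup.mem_carrier[OF normal_imp_subgroup[OF L(1)] that] by blast
  then show False using L(2,3) by blast
qed

lemma q_dvd_index:
  assumes "L \<lhd> G" "Frat G \<subseteq> L" "L \<noteq> Frat G"
  shows "q dvd card L div card (Frat G)"
  using frattini_pair.p_dvd_index[OF swap assms] .

lemma gaschuetz_contradiction: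
  assumes U: "subgroup U G" "P \<subseteq> U" "is_complement (G\<lparr>carrier := U\<rparr>) P K"
  shows "p dvd order G div card U"
proof (rule ccontr)
  interpret P: abelian_normal P G by (rule abelian_normal_P)
  assume "\<not> p dvd order G div card U"
  then have "coprime (order G div card U) (card P)"
    unfolding P(2) using p(1) by (simp add: coprime_commute prime_imp_coprime)
  then show False using P.gaschuetz_complement[OF U(1,2) _ U(3)] no_complement_P by blast
qed

text \<open>P meets Frat(L) in a normal subgroup of G, so in 1 or P. In the first case a supplement
  of P in L that meets P inside Frat(L) is a complement, and as the index of L is prime to p,
  Gaschuetz's theorem would give a complement in G.\<close>

lemma P_le_Frat_of_p'_index:
  assumes L: "L \<lhd> G" "Frat G \<subseteq> L" and np: "\<not> p dvd order G div card L"
  shows "P \<subseteq> Frat (G\<lparr>carrier := L\<rparr>)"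
proof -
  let ?L = "G\<lparr>carrier := L\<rparr>"
  have sL: "subgroup L G" using L(1) by (rule normal_imp_subgroup)
  note Lc = subgroup.mem_carrier[OF sL]
  interpret LG: group ?L using sL by (simp add: subgroup.subgroup_is_group is_group)
  have PL: "P \<subseteq> L" using P_le_Frat L(2) by blast
  have "P \<lhd> ?L"
    by (rule LG.normal_conj_byI[OF subgroup_incl[OF sub_P sL PL]]) (use sL Lc in simp)
  then interpret P: abelian_normal P ?L
    by (rule abelian_normal.intro, intro abelian_normal_axioms.intro)
      (use finite_subgroup[OF finite sL] abelian_P in simp_all)
  obtain H where H: "subgroup H ?L" "\<forall>g\<in>carrier ?L. \<exists>a\<in>P. \<exists>h\<in>H. g = a \<otimes>\<^bsub>?L\<^esub> h"
    "P \<inter> H \<subseteq> Frat ?L"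
    using P.frattini_supplement_exists by (elim exE conjE)
  let ?D = "P \<inter> Frat ?L"
  have "?D \<lhd> G"
  proof (rule normal_conj_byI)
    show "subgroup ?D G"
      using subgroups_Inter_pair[OF sub_P incl_subgroup[OF sL LG.Frat_subgroup]] .
    show "conj_by g x \<in> ?D" if "g \<in> carrier G" "x \<in> ?D" for g x
      using conj_by_Frat_normal[OF L(1)] that by simp
  qed
  then consider "?D = {\<one>}" | "?D = P" using minimal_P[of ?D] by blast
  then show ?thesis
  proof cases
    case 1
    then have "P \<inter> H \<subseteq> {\<one>}" using H(3) by blast
    then have "P \<inter> H = {\<one>}"
      using subgroup.one_closed[OF sub_P] subgroup.one_closed[OF H(1)] by auto
    then have "is_complement ?L P H" using H(1,2) by (simp add: is_complement_def)
    then show ?thesis using gaschuetz_contradiction[OF sL PL] np by blast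
  qed blast
qed

end

lemma index_eq_of_product:
  fixes g h k d :: nat
  assumes "g * d = h * k" "k dvd g" "d dvd h" "0 < d" "0 < k"
  shows "g div k = h div d"
  using assms by (auto elim!: dvdE)

section \<open>Sylow subgroups modulo P and normal subgroups above the Frattini subgroup\<close>

context frattini_pair
begin

text \<open>Elements of A outside P act fixed-point-freely on Q while P acts trivially, so A / P
  contains no product of two groups of order p. As a nontrivial p-group has a central element of
  order p, there is at most one subgroup of order p, and A / P is cyclic. In a cyclic p-group one of
  any two elements is a power of the other.\<close>

lemma sylow_mod_P_cyclic:
  assumes A: "subgroup A G" "card A = p ^ n" "P \<subseteq> A" and xd: "x \<in> A" "d \<in> A"
  shows "(\<exists>k::nat. \<exists>u\<in>P. d = u \<otimes> x [^] k) \<or> (\<exists>k::nat. \<exists>u\<in>P. x = u \<otimes> d [^] k)"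
proof -
  let ?A = "G\<lparr>carrier := A\<rparr>" and ?Q = "G\<lparr>carrier := A\<rparr> Mod P"
  interpret AG: group ?A using A(1) by (simp add: subgroup.subgroup_is_group is_group)
  note Ac = subgroup.mem_carrier[OF A(1)]
  have "P \<lhd> ?A"
    by (rule AG.normal_conj_byI[OF subgroup_incl[OF sub_P A(1,3)]]) (use A(1) Ac in simp)
  then interpret N: normal P ?A .
  interpret Q: group ?Q by (rule N.factorgroup_is_group)
  have carr: "carrier ?Q = (\<lambda>y. P #> y) ` A"
    by (auto simp: FactGroup_def RCOSETS_def)
  have mult: "(P #> y) \<otimes>\<^bsub>?Q\<^esub> (P #> z) = P #> (y \<otimes> z)" if "y \<in> A" "z \<in> A" for y z
    using N.rcos_sum[of y z] that by (simp add: FactGroup_def)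
  have pow: "(P #> y) [^]\<^bsub>?Q\<^esub> (k::nat) = P #> (y [^] k)" if "y \<in> A" for y k
    using N.FactGroup_pow[of y k] that by (simp flip: nat_pow_consistent)
  have one: "\<one>\<^bsub>?Q\<^esub> = P" by (simp add: FactGroup_def)
  have eq: "P #> y = P #> z \<longleftrightarrow> y \<otimes> inv z \<in> P" if "y \<in> A" "z \<in> A" for y z
    using rcos_eq_iff[OF P(1)] that Ac by simp
  have eq_one: "P #> y = P \<longleftrightarrow> y \<in> P" if "y \<in> A" for y
    using eq[OF that subgroup.one_closed[OF A(1)]] coset_mult_one[of P] subgroup.subset[OF sub_P] Ac[OF that]
    by simp
  have oneP: "\<one> \<in> P" using subgroup.one_closed[OF sub_P] .
  have powA: "y [^] (p ^ n) = \<one>" if "y \<in> A" for y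
    using pow_card_subgroup[OF finite A(1) that] A(2) by simp
  have clA: "y [^] (k::nat) \<in> A" if "y \<in> A" for y k using subgroup_nat_pow_closed[OF A(1) that] .
  have mA: "y \<otimes> z \<in> A" if "y \<in> A" "z \<in> A" for y z using subgroup.m_closed[OF A(1) that] .
  have finA: "finite (carrier ?A)" using finite_subgroup[OF finite A(1)] by simp
  have "order ?Q * card P = p ^ n"
    using AG.lagrange[OF N.is_subgroup] A(2) by (simp add: order_def FactGroup_def)
  then have "order ?Q dvd p ^ n" by (metis dvd_triv_left)
  then obtain c where ordQ: "order ?Q = p ^ c" using divides_primepow_nat[OF p(1)] by blast
  have uniq: "\<exists>i::nat. V = Y [^]\<^bsub>?Q\<^esub> i"
    if XY: "V \<in> carrier ?Q" "Y \<in> carrier ?Q" "V [^]\<^bsub>?Q\<^esub> p = \<one>\<^bsub>?Q\<^esub>" "Y [^]\<^bsub>?Q\<^esub> p = \<one>\<^bsub>?Q\<^esub>" "Y \<noteq> \<one>\<^bsub>?Q\<^esub>"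
    for V Y
  proof -
    have "carrier ?Q \<noteq> {\<one>\<^bsub>?Q\<^esub>}" using XY(2,5) by blast
    then obtain Z' where Z': "Z' \<in> carrier ?Q" "Z' \<noteq> \<one>\<^bsub>?Q\<^esub>"
      "\<And>g. g \<in> carrier ?Q \<Longrightarrow> g \<otimes>\<^bsub>?Q\<^esub> Z' = Z' \<otimes>\<^bsub>?Q\<^esub> g"
      using Q.p_group_center_nontrivial[OF p(1) ordQ] by blast
    have "Q.ord Z' dvd p ^ c" using Q.ord_dvd_group_order[OF Z'(1)] ordQ by simp
    then obtain s where s: "Q.ord Z' = p ^ s" using divides_primepow_nat[OF p(1)] by blast
    have "Q.ord Z' \<noteq> 1" using Z'(2) Q.ord_eq_1[OF Z'(1)] by simp
    then have "s \<noteq> 0" using s by (metis power_0)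
    then have ps: "p ^ s = p ^ (s - 1) * p" by (metis power_minus_mult neq0_conv)
    \<comment> \<open>A central element of order p, a power of the central element \<open>Z'\<close>
      of order p^s.\<close>
    define Z where "Z = Z' [^]\<^bsub>?Q\<^esub> (p ^ (s - 1))"
    have Zc: "Z \<in> carrier ?Q" using Z'(1) by (simp add: Z_def)
    have Zp: "Z [^]\<^bsub>?Q\<^esub> p = \<one>\<^bsub>?Q\<^esub>"
      using Q.pow_ord_eq_1[OF Z'(1)] unfolding s ps Z_def Q.nat_pow_pow[OF Z'(1)] .
    have Zpt: "Z [^]\<^bsub>?Q\<^esub> (p * t) = \<one>\<^bsub>?Q\<^esub>" for t
      using Q.nat_pow_pow[OF Zc, of p t] Zp Q.nat_pow_one[of t] by metis
    have Z1: "Z \<noteq> \<one>\<^bsub>?Q\<^esub>"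
    proof
      assume "Z = \<one>\<^bsub>?Q\<^esub>"
      then have "p ^ s dvd p ^ (s - 1)"
        using Q.pow_eq_id[OF Z'(1)] s by (simp add: Z_def)
      then have "p ^ s \<le> p ^ (s - 1)" using prime_gt_0_nat[OF p(1)] by (intro dvd_imp_le) auto
      then show False using prime_gt_1_nat[OF p(1)] ps by simp
    qed
    obtain z where z: "z \<in> A" "Z = P #> z" using Zc carr by auto
    have Zcomm: "g \<otimes>\<^bsub>?Q\<^esub> Z = Z \<otimes>\<^bsub>?Q\<^esub> g" if "g \<in> carrier ?Q" for g
      using Q.group_commutes_pow[OF Z'(3)[OF that, symmetric] Z'(1) that] by (simp add: Z_def)
    have zP: "z \<notin> P" using Z1 z one eq_one by simp
    have zp: "z [^] p \<in> P" using Zp z pow one eq_one[OF clA[OF z(1)]] by simp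
    have claim: "\<exists>i::nat. W = Z [^]\<^bsub>?Q\<^esub> i" if W: "W \<in> carrier ?Q" "W [^]\<^bsub>?Q\<^esub> p = \<one>\<^bsub>?Q\<^esub>" for W
    proof (rule ccontr)
      assume no: "\<not> (\<exists>i::nat. W = Z [^]\<^bsub>?Q\<^esub> i)"
      obtain w where w: "w \<in> A" "W = P #> w" using W(1) carr by auto
      have wp: "w [^] p \<in> P" using W(2) w pow one eq_one[OF clA[OF w(1)]] by simp
      \<comment> \<open>Otherwise W would be Z^(-i), written as Z^(i (p - 1)) to stay with natural
        exponents.\<close>
      have wz: "w \<otimes> z [^] i \<notin> P" for i :: nat
      proof
        assume "w \<otimes> z [^] i \<in> P"
        then have "W \<otimes>\<^bsub>?Q\<^esub> Z [^]\<^bsub>?Q\<^esub> i = \<one>\<^bsub>?Q\<^esub>"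
          unfolding w(2) z(2) pow[OF z(1)] mult[OF w(1) clA[OF z(1)]] one
          using eq_one[OF mA[OF w(1) clA[OF z(1)]]] by blast
        moreover have "Z [^]\<^bsub>?Q\<^esub> i \<otimes>\<^bsub>?Q\<^esub> Z [^]\<^bsub>?Q\<^esub> (i * (p - 1)) = \<one>\<^bsub>?Q\<^esub>"
        proof -
          have "i + i * (p - 1) = p * i"
            using prime_gt_0_nat[OF p(1)] by (cases p) simp_all
          then have "Z [^]\<^bsub>?Q\<^esub> i \<otimes>\<^bsub>?Q\<^esub> Z [^]\<^bsub>?Q\<^esub> (i * (p - 1)) = Z [^]\<^bsub>?Q\<^esub> (p * i)"
            using Q.nat_pow_mult[OF Zc, of i "i * (p - 1)"] by simp
          also have "\<dots> = \<one>\<^bsub>?Q\<^esub>" by (rule Zpt)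
          finally show ?thesis .
        qed
        ultimately have "W = Z [^]\<^bsub>?Q\<^esub> (i * (p - 1))"
          using Q.m_assoc[OF W(1) Q.nat_pow_closed[OF Zc] Q.nat_pow_closed[OF Zc], of i "i * (p - 1)"]
            Q.r_one[OF W(1)] Q.l_one[OF Q.nat_pow_closed[OF Zc]] by metis
        then show False using no by blast
      qed
      interpret QN: abelian_normal Q G using frattini_pair.abelian_normal_P[OF swap] .
      obtain v where v: "v \<in> Q" "v \<noteq> \<one>" by (rule Q_nontrivial)
      have zG: "z \<in> carrier G" "w \<in> carrier G" using Ac z w by simp_all
      have "v [^] p = \<one>"
      proof (rule QN.rank_two_fixed_points[OF zG _ _ _ _ _ v(1) prime_gt_0_nat[OF p(1)]])
        fix y assume y: "y \<in> Q"
        \<comment> \<open>z and w commute only modulo P, which suffices because P centralizes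
          Q.\<close>
        have "P #> (z \<otimes> w) = P #> (w \<otimes> z)"
          using Zcomm[OF W(1)] unfolding z(2) w(2) mult[OF w(1) z(1)] mult[OF z(1) w(1)] by (rule sym)
        then have c: "z \<otimes> w \<otimes> inv (w \<otimes> z) \<in> P" using eq mA z w by blast
        have "z \<otimes> w = (z \<otimes> w \<otimes> inv (w \<otimes> z)) \<otimes> (w \<otimes> z)" using zG by (simp add: m_assoc)
        then have "conj_by (z \<otimes> w) y = conj_by (z \<otimes> w \<otimes> inv (w \<otimes> z)) (conj_by (w \<otimes> z) y)"
          using zG y by (metis conj_by_mult_left inv_closed m_closed mem_Q)
        also have "\<dots> = conj_by (w \<otimes> z) y" using c zG y by simp
        finally show "conj_by z (conj_by w y) = conj_by w (conj_by z y)"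
          using zG y by (simp add: conj_by_mult_left)
        show "conj_by (z [^] p) y = y" using zp y by simp
        show "conj_by (w [^] p) y = y" using wp y by simp
      next
        fix j :: nat and y assume j: "0 < j" "j < p" and y: "y \<in> Q" "conj_by (z [^] j) y = y"
        have "z [^] j \<notin> P"
        proof
          assume zj: "z [^] j \<in> P"
          have "coprime p j" using p(1) j by (meson dvd_imp_le leD prime_imp_coprime)
          then show False using coprime_pow_mem[OF sub_P zG(1) zp zj] zP by blast
        qed
        moreover have "(z [^] j) [^] (p ^ n) \<in> P" using powA[OF clA[OF z(1)]] oneP by simp
        ultimately show "y = \<one>" using no_fixed_Q[of "z [^] j" n y] y zG by simp
      next
        fix i :: nat and y assume y: "y \<in> Q" "conj_by (w \<otimes> z [^] i) y = y"
        have "(w \<otimes> z [^] i) [^] (p ^ n) \<in> P" using powA[OF mA[OF w(1) clA[OF z(1)]]] oneP by simp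
        then show "y = \<one>" using no_fixed_Q[of "w \<otimes> z [^] i" n y] wz y zG by simp
      qed
      then have "v = \<one>"
        using coprime_pow_one[of v p "q ^ b"] v pow_Q by simp
      then show False using v(2) by simp
    qed
    obtain i where i: "V = Z [^]\<^bsub>?Q\<^esub> (i::nat)" using claim[OF XY(1,3)] by blast
    obtain j where j: "Y = Z [^]\<^bsub>?Q\<^esub> (j::nat)" using claim[OF XY(2,4)] by blast
    \<comment> \<open>j is invertible modulo p with inverse s, so V = Z^i is recovered as Y^(s
      i).\<close>
    have "\<not> p dvd j" using XY(5) Zpt j by auto
    then have "coprime j p" using p(1) prime_imp_coprime coprime_commute by blast
    moreover have "j \<noteq> 0" using \<open>\<not> p dvd j\<close> by (metis dvd_0_right)
    ultimately obtain s t where st: "j * s = p * t + 1" using bezout_nat[of j p] by auto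
    have "Y [^]\<^bsub>?Q\<^esub> (s * i) = Z [^]\<^bsub>?Q\<^esub> (p * (t * i) + i)"
      unfolding j Q.nat_pow_pow[OF Zc] mult.assoc[symmetric] st by (simp add: algebra_simps)
    also have "\<dots> = V"
      unfolding Q.nat_pow_mult[OF Zc, symmetric] Zpt i by (rule Q.l_one[OF Q.nat_pow_closed[OF Zc]])
    finally show ?thesis by metis
  qed
  have "\<exists>g\<in>carrier ?Q. \<forall>x\<in>carrier ?Q. \<exists>i::nat. x = g [^]\<^bsub>?Q\<^esub> i"
    using p_group_cyclic[OF p Q.is_group ordQ] uniq by blast
  then obtain g where g: "g \<in> carrier ?Q" "\<And>x. x \<in> carrier ?Q \<Longrightarrow> \<exists>i::nat. x = g [^]\<^bsub>?Q\<^esub> i"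
    by blast
  have xdQ: "P #> d \<in> carrier ?Q" "P #> x \<in> carrier ?Q" using carr xd by auto
  have split: "y = (y \<otimes> inv (z [^] k)) \<otimes> z [^] k" if "y \<in> A" "z \<in> A" for y z and k :: nat
    using that Ac by (simp add: m_assoc)
  have lift: "\<exists>u\<in>P. y = u \<otimes> z [^] k" if "y \<in> A" "z \<in> A" "P #> y = (P #> z) [^]\<^bsub>?Q\<^esub> k"
    for y z and k :: nat
    using that split[of y z k] eq[OF that(1) clA[OF that(2)]] pow[OF that(2)] by auto
  show ?thesis
    using Q.cyclic_p_group_comparable[OF p(1) ordQ g xdQ] lift xd by blast
qed

text \<open>Suppose \<open>p\<close> divides \<open>|G : L|\<close> and let \<open>N\<close> normalize a Sylow \<open>q\<close>-subgroup \<open>B\<close> of \<open>L\<close>. It contains a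
  \<open>p\<close>-element \<open>x \<notin> L\<close>. If \<open>A\<close> is a Sylow \<open>p\<close>-subgroup containing \<open>x\<close>, then \<open>A / P\<close> is cyclic, whence
  \<open>A \<inter> L \<le> P \<langle>x\<rangle> \<le> P N\<close> and \<open>P N\<close> has index prime to \<open>p\<close>. But \<open>N\<close> is a complement of \<open>P\<close> in \<open>P N\<close>.\<close>

lemma p'_index_normal:
  assumes L: "L \<lhd> G" "Frat G \<subseteq> L" "L \<noteq> Frat G"
  shows "\<not> p dvd order G div card L"
proof
  assume dvd: "p dvd order G div card L"
  have sL: "subgroup L G" using L(1) by (rule normal_imp_subgroup)
  have oneF: "\<one> \<in> Frat G" using subgroup.one_closed[OF sub_F] .
  obtain B c where B: "subgroup B G" "B \<subseteq> L" "card B = q ^ c" "\<not> q dvd card L div card B"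
    using sylow_exists[OF q(1) finite sL] by metis
  note Bc = subgroup.mem_carrier[OF B(1)]
  have "\<not> B \<subseteq> Frat G"
  proof
    assume "B \<subseteq> Frat G"
    then have "card L div card (Frat G) dvd card L div card B"
      by (rule index_dvd_index[OF finite B(1) sub_F sL _ L(2)])
    then show False using q_dvd_index[OF L] B(4) dvd_trans by blast
  qed
  then obtain z where z: "z \<in> B" "z \<notin> Frat G" by blast
  have powB: "y [^] (q ^ c) = \<one>" if "y \<in> B" for y
    using pow_card_subgroup[OF finite B(1) that] B(3) by simp
  let ?N = "normalizer_of B"
  have sN: "subgroup ?N G" by (rule normalizer_of_subgroup[OF finite subgroup.subset[OF B(1)]])
  \<comment> \<open>For u in P normalizing B, the commutator of u and z lies in P and in the q-group
    B, so it is 1. Then u is fixed by z, a q-element outside F, and is therefore trivial.\<close>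
  have PN: "P \<inter> ?N = {\<one>}"
  proof -
    have "u = \<one>" if u: "u \<in> P" "u \<in> ?N" for u
    proof (rule frattini_pair.no_fixed_Q_Frat[OF swap, of z c])
      have cB: "conj_by u z \<in> B" using u(2) z(1) by (simp add: normalizer_of_def)
      have "conj_by u z \<otimes> inv z = u \<otimes> conj_by z (inv u)"
        using u(1) Bc[OF z(1)] by (simp add: conj_by_def m_assoc)
      also have "\<dots> \<in> P" using u(1) Bc[OF z(1)] sub_P by (simp add: subgroup.m_closed subgroup.m_inv_closed)
      finally have wP: "conj_by u z \<otimes> inv z \<in> P" .
      have wB: "conj_by u z \<otimes> inv z \<in> B"
        using cB z(1) B(1) by (simp add: subgroup.m_closed subgroup.m_inv_closed)
      have "conj_by u z \<otimes> inv z = \<one>"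
        using coprime_pow_one[OF Bc[OF wB] pow_P[OF wP] powB[OF wB]] by simp
      then have "conj_by u z = z" using u(1) Bc[OF z(1)] inv_equality[of "conj_by u z" "inv z"] by simp
      then have "u \<otimes> z = z \<otimes> u" using u(1) Bc[OF z(1)] conj_by_eq_iff[of u z] by simp
      then show "conj_by z u = u" using u(1) Bc[OF z(1)] conj_by_eq_iff[of z u] by simp
      show "z [^] (q ^ c) \<in> Frat G" using powB[OF z(1)] oneF by simp
    qed (use u(1) z Bc[OF z(1)] in simp_all)
    then show ?thesis using subgroup.one_closed[OF sub_P] subgroup.one_closed[OF sN] by fast
  qed
  define U where "U = {u \<otimes> n | u n. u \<in> P \<and> n \<in> ?N}"
  have sU: "subgroup U G" unfolding U_def by (rule subgroup_product[OF P(1) sN])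
  have UI: "u \<otimes> n \<in> U" if "u \<in> P" "n \<in> ?N" for u n using that by (auto simp: U_def)
  have PU: "P \<subseteq> U"
  proof
    fix u assume "u \<in> P"
    then show "u \<in> U" using UI[of u \<one>] subgroup.one_closed[OF sN] by simp
  qed
  have NU: "?N \<subseteq> U"
  proof
    fix n assume "n \<in> ?N"
    then show "n \<in> U" using UI[of \<one> n] subgroup.one_closed[OF sub_P] subgroup.mem_carrier[OF sN] by simp
  qed
  have "is_complement (G\<lparr>carrier := U\<rparr>) P ?N"
    unfolding is_complement_def using subgroup_incl[OF sN sU NU] PN by (auto simp: U_def)
  then have pU: "p dvd order G div card U" by (rule gaschuetz_contradiction[OF sU PU])
  have LN: "\<exists>l\<in>L. \<exists>n\<in>?N. g = l \<otimes> n" if "g \<in> carrier G" for g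
    by (rule frattini_argument[OF q(1) finite L(1) B that])
  have LU: "\<exists>l\<in>L. \<exists>n\<in>U. g = l \<otimes> n" if "g \<in> carrier G" for g
    using LN[OF that] NU by blast
  have sNL: "subgroup (?N \<inter> L) G" and sUL: "subgroup (U \<inter> L) G"
    using subgroups_Inter_pair sN sU sL by blast+
  have Lord: "card L dvd order G" and Uord: "card U dvd order G"
    unfolding order_def using card_subgroup_dvd[OF finite _ subgroup_self] sL sU subgroup.subset by blast+
  \<comment> \<open>G is the product of L and the normalizer, so the index of L can be read off
    inside the normalizer, which therefore has a p-element outside L.\<close>
  have "order G div card L = card ?N div card (?N \<inter> L)"
    using card_subgroup_product[OF finite sN sL LN] card_subgroup_dvd[OF finite sNL sN]
      subgroup_card_pos[OF finite sL] subgroup_card_pos[OF finite sNL] Lord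
    by (intro index_eq_of_product) auto
  then have "p dvd card ?N div card (?N \<inter> L)" using dvd by simp
  then obtain x i where x: "x \<in> ?N" "x \<notin> ?N \<inter> L" "x [^] (p ^ i) = \<one>"
    using exists_p_element_outside[OF p(1) finite sNL sN] by (metis inf_le1)
  have xG: "x \<in> carrier G" "x \<notin> L" using x subgroup.mem_carrier[OF sN] by auto
  obtain A n where A: "subgroup A G" "card A = p ^ n" "\<not> p dvd order G div card A" "x \<in> A"
    by (rule sylow_containing[OF p(1) finite xG(1) x(3)])
  have PA: "P \<subseteq> A" by (rule normal_p_subgroup_le_sylow[OF p(1) finite P(1,2) A(1,3)])
  have sAL: "subgroup (A \<inter> L) G" using subgroups_Inter_pair[OF A(1) sL] .
  have "A \<inter> L \<subseteq> U \<inter> L"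
  proof
    fix d assume d: "d \<in> A \<inter> L"
    consider k u where "u \<in> P" "d = u \<otimes> x [^] (k::nat)" | k u where "u \<in> P" "x = u \<otimes> d [^] (k::nat)"
      using sylow_mod_P_cyclic[OF A(1,2) PA A(4), of d] d by blast
    then show "d \<in> U \<inter> L"
    proof cases
      case 1
      then show ?thesis using UI subgroup_nat_pow_closed[OF sN x(1)] d by simp
    next
      \<comment> \<open>Here x would be a product of an element of P and a power of d, both in
        L.\<close>
      case 2
      have "d [^] k \<in> L" using subgroup_nat_pow_closed[OF sL] d by simp
      moreover have "u \<in> L" using 2(1) P_le_Frat L(2) by blast
      ultimately have "x \<in> L" using 2(2) subgroup.m_closed[OF sL] by simp
      then show ?thesis using xG(2) by simp
    qed
  qed
  \<comment> \<open>The index of U in G equals |L : U \<inter> L|, since G = L U, and so divides |L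
    : A \<inter> L|. The latter is prime to p because A meets the normal subgroup L in a Sylow
    p-subgroup, while p divides |G : U|.\<close>
  then have "card L div card (U \<inter> L) dvd card L div card (A \<inter> L)"
    by (rule index_dvd_index[OF finite sAL sUL sL]) simp
  moreover have "\<not> p dvd card L div card (A \<inter> L)"
    by (rule sylow_Int_normal[OF p(1) finite L(1) A(1-3)])
  moreover have "order G div card U = card L div card (U \<inter> L)"
    using card_subgroup_product[OF finite sU sL LU] card_subgroup_dvd[OF finite sUL sL]
      subgroup_card_pos[OF finite sU] subgroup_card_pos[OF finite sUL] Uord
    by (intro index_eq_of_product) (auto simp: mult.commute)
  ultimately show False using pU dvd_trans by metis
qed

lemma normal_over_Frat:
  assumes L: "L \<lhd> G" "Frat G \<subseteq> L"
  shows "L = Frat G \<or> L = carrier G"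
proof (rule ccontr)
  assume *: "\<not> (L = Frat G \<or> L = carrier G)"
  have "P \<subseteq> Frat (G\<lparr>carrier := L\<rparr>)"
    using P_le_Frat_of_p'_index[OF L] p'_index_normal[OF L] * by blast
  moreover have "Q \<subseteq> Frat (G\<lparr>carrier := L\<rparr>)"
    using frattini_pair.P_le_Frat_of_p'_index[OF swap L] frattini_pair.p'_index_normal[OF swap L] * by blast
  moreover have "subgroup (Frat (G\<lparr>carrier := L\<rparr>)) (G\<lparr>carrier := L\<rparr>)"
    using group.Frat_subgroup subgroup.subgroup_is_group[OF normal_imp_subgroup[OF L(1)] is_group] by blast
  ultimately have "Frat G \<subseteq> Frat (G\<lparr>carrier := L\<rparr>)"
    using subgroup.m_closed[of "Frat (G\<lparr>carrier := L\<rparr>)" "G\<lparr>carrier := L\<rparr>"] by (fastforce simp: Frat_iff subset_iff)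
  then show False using Frat_proper_normal[OF L] * by blast
qed

end

section \<open>Minimal examples\<close>

lemma iso_ord:
  assumes "group G" "group H" "\<phi> \<in> iso G H" "x \<in> carrier G"
  shows "group.ord H (\<phi> x) = group.ord G x"
proof -
  interpret G: group G by fact
  interpret H: group H by fact
  interpret group_hom G H \<phi>
    using assms(3) by (simp add: group_hom_def group_hom_axioms_def assms iso_imp_homomorphism)
  have inj: "inj_on \<phi> (carrier G)" using assms(3) by (simp add: iso_def bij_betw_def)
  have "\<phi> x [^]\<^bsub>H\<^esub> n = \<one>\<^bsub>H\<^esub> \<longleftrightarrow> G.ord x dvd n" for n :: nat
  proof -
    have "\<phi> x [^]\<^bsub>H\<^esub> n = \<one>\<^bsub>H\<^esub> \<longleftrightarrow> \<phi> (x [^]\<^bsub>G\<^esub> n) = \<phi> \<one>\<^bsub>G\<^esub>"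
      using assms(4) by (simp add: hom_nat_pow)
    also have "\<dots> \<longleftrightarrow> x [^]\<^bsub>G\<^esub> n = \<one>\<^bsub>G\<^esub>"
      using inj assms(4) by (intro inj_on_eq_iff) auto
    finally show ?thesis using G.pow_eq_id[OF assms(4)] by simp
  qed
  then show ?thesis using H.ord_unique[of "\<phi> x"] assms(4) by simp
qed

lemma iso_Omega:
  assumes "group G" "group H" "\<phi> \<in> iso G H"
  shows "Omega p q H = \<phi> ` Omega p q G"
proof -
  have img: "carrier H = \<phi> ` carrier G" using assms(3) by (auto simp: iso_def bij_betw_def)
  show ?thesis
    unfolding Omega_def img using iso_ord[OF assms] by auto
qed

lemma iso_Omega_star_star:
  assumes "group G" "group H" "\<phi> \<in> iso G H"
  shows "Omega_star_star p q H = \<phi> ` Omega_star_star p q G"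
proof -
  have inj: "inj_on \<phi> (carrier G)" using assms(3) by (simp add: iso_def bij_betw_def)
  have "Omega_star p q H = \<phi> ` Omega p q G - \<phi> ` Frat G"
    unfolding Omega_star_def iso_Omega[OF assms] iso_Frat[OF assms] ..
  also have "\<dots> = \<phi> ` Omega_star p q G"
    unfolding Omega_star_def
    by (rule inj_on_image_set_diff[OF inj, symmetric]) (auto simp: Omega_def Frat_def)
  finally have star: "Omega_star p q H = \<phi> ` Omega_star p q G" .
  have "x \<in> carrier G" if "x \<in> Omega_star p q G" for x
    using that by (simp add: Omega_star_def Omega_def)
  then show ?thesis
    unfolding Omega_star_star_def star using iso_ord[OF assms] by auto
qed

lemma (in group) ord_subgroup:
  assumes "subgroup H G" "x \<in> H"
  shows "group.ord (G\<lparr>carrier := H\<rparr>) x = ord x"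
proof -
  interpret H: group "G\<lparr>carrier := H\<rparr>" using assms by (simp add: subgroup.subgroup_is_group is_group)
  show ?thesis
    using H.ord_unique[of x "ord x"] assms pow_eq_id[of x] subgroup.mem_carrier[OF assms]
    by (simp flip: nat_pow_consistent)
qed

text \<open>By the Frattini argument the normalizer of R supplements the Frattini subgroup, which
  consists of non-generators; so the normalizer is all of G.\<close>

lemma (in group) sylow_of_Frat_normal:
  assumes r: "prime r" and fin: "finite (carrier G)"
  obtains R c where "R \<lhd> G" "R \<subseteq> Frat G" "card R = r ^ c" "\<not> r dvd card (Frat G) div card R"
proof -
  obtain R c where R: "subgroup R G" "R \<subseteq> Frat G" "card R = r ^ c" "\<not> r dvd card (Frat G) div card R"
    by (rule sylow_exists[OF r fin Frat_subgroup])
  have "normalizer_of R = carrier G"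
    using Frat_supplement[OF fin subset_refl normalizer_of_subgroup[OF fin subgroup.subset[OF R(1)]]]
      frattini_argument[OF r fin Frat_normal R] by blast
  then have "R \<lhd> G"
    by (intro normal_conj_byI[OF R(1)]) (auto simp: normalizer_of_def)
  then show ?thesis using R(2-4) by (rule that)
qed

lemma prime_part_decomp:
  fixes n p q :: nat
  assumes "prime p" "prime q" "p \<noteq> q" "0 < n"
  obtains m where "n = p ^ multiplicity p n * q ^ multiplicity q n * m" "\<not> p dvd m" "\<not> q dvd m"
proof -
  obtain k where k: "n = p ^ multiplicity p n * k" "\<not> p dvd k"
    using multiplicity_decompose'[of n p] assms by (metis not_prime_unit neq0_conv)
  have k0: "k \<noteq> 0" using k(2) by (metis dvd_0_right)
  have "multiplicity q n = multiplicity q k"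
  proof -
    have "multiplicity q n = multiplicity q (p ^ multiplicity p n) + multiplicity q k"
      using assms k(1) k0 by (metis prime_elem_multiplicity_mult_distrib power_eq_0_iff not_prime_0 prime_imp_prime_elem)
    then show ?thesis using assms by (simp add: multiplicity_distinct_prime_power)
  qed
  moreover obtain m where m: "k = q ^ multiplicity q k * m" "\<not> q dvd m"
    using multiplicity_decompose'[of k q] assms(2) k0 by (metis not_prime_unit)
  ultimately have "n = p ^ multiplicity p n * q ^ multiplicity q n * m" using k(1) by (metis mult.assoc)
  moreover have "\<not> p dvd m" using k(2) m(1) by (metis dvd_mult)
  ultimately show ?thesis using m(2) that by blast
qed

text \<open>If (x y)^n = 1, the power q^j removes y and leaves x^(n q^j) = 1; with n prime to p this
  would force x = 1. The argument for q is the same with x and y exchanged.\<close>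

lemma (in group) commuting_p_q_ord:
  assumes pq: "prime p" "prime q" "p \<noteq> q" and xy: "x \<in> carrier G" "y \<in> carrier G" "x \<otimes> y = y \<otimes> x"
    and pow: "x [^] (p ^ i) = \<one>" "y [^] (q ^ j) = \<one>" and "x \<noteq> \<one>" "y \<noteq> \<one>"
  shows "p * q dvd ord (x \<otimes> y)"
proof -
  have aux: "p dvd n"
    if "prime p" "prime q" "p \<noteq> q" "x \<in> carrier G" "y \<in> carrier G" "x \<otimes> y = y \<otimes> x"
      "x [^] (p ^ i) = \<one>" "y [^] (q ^ j) = \<one>" "x \<noteq> \<one>" "(x \<otimes> y) [^] n = \<one>" for p q x y i j and n :: nat
  proof (rule ccontr)
    assume "\<not> p dvd n"
    have "(x \<otimes> y) [^] (n * q ^ j) = ((x \<otimes> y) [^] n) [^] (q ^ j)"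
      using nat_pow_pow[OF m_closed[OF that(4,5)], of n "q ^ j"] by (rule sym)
    then have "(x \<otimes> y) [^] (n * q ^ j) = \<one>" unfolding that(10) by simp
    then have "x [^] (n * q ^ j) \<otimes> y [^] (n * q ^ j) = \<one>"
      unfolding pow_mult_distrib[OF that(6,4,5)] .
    moreover have "y [^] (n * q ^ j) = \<one>"
      using nat_pow_pow[OF that(5), of "q ^ j" n] that(8) by (simp add: mult.commute)
    ultimately have "x [^] (n * q ^ j) = \<one>" using that(4) by simp
    moreover have "coprime (p ^ i) (n * q ^ j)"
      using \<open>\<not> p dvd n\<close> that(1-3) prime_imp_coprime[OF that(1)] by (simp add: primes_coprime)
    ultimately have "x = \<one>" using coprime_pow_one[of x "p ^ i" "n * q ^ j"] that by simp
    then show False using that by simp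
  qed
  have o: "(x \<otimes> y) [^] ord (x \<otimes> y) = \<one>" "(y \<otimes> x) [^] ord (x \<otimes> y) = \<one>" using xy by simp_all
  have "p dvd ord (x \<otimes> y)" by (rule aux[of p q x y i j]) (use assms o in simp_all)
  moreover have "q dvd ord (x \<otimes> y)" by (rule aux[of q p y x j i]) (use assms o in simp_all)
  ultimately show ?thesis using pq by (simp add: divides_mult primes_coprime)
qed

section \<open>Consequences of minimality\<close>

locale minimal_example = group G for G (structure) +
  fixes p q :: nat
  assumes finite: "finite (carrier G)"
    and p: "prime p" "odd p" and q: "prime q" "odd q" and p_neq_q: "p \<noteq> q"
    and Omega: "Omega p q G \<noteq> {}" and Omega_star_star: "Omega_star_star p q G = {}"
    and minimal_nat: "\<And>H :: nat monoid. group H \<Longrightarrow> finite (carrier H) \<Longrightarrow> order H < order G \<Longrightarrow>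
      \<not> (Omega p q H \<noteq> {} \<and> Omega_star_star p q H = {})"
begin

text \<open>Minimality is assumed for groups of natural numbers; quotients and subgroups of G live
  on other types and are transported along an isomorphism.\<close>

lemma minimal:
  fixes H :: "('h, 'k) monoid_scheme"
  assumes H: "group H" "finite (carrier H)" "order H < order G" "Omega p q H \<noteq> {}"
  shows "Omega_star_star p q H \<noteq> {}"
proof -
  obtain K :: "nat monoid" where K: "group K" "H \<cong> K"
    using finite_group_iso_nat_monoid[OF H(1,2)] by blast
  then obtain \<phi> where \<phi>: "\<phi> \<in> iso H K" by (auto simp: is_iso_def)
  have "finite (carrier K)" using iso_finite[OF K(2)] H(2) by simp
  moreover have "order K < order G" using iso_same_card[OF K(2)] H(3) by (simp add: order_def)
  ultimately show ?thesis
    using minimal_nat[OF K(1)] H(4) iso_Omega[OF H(1) K(1) \<phi>] iso_Omega_star_star[OF H(1) K(1) \<phi>] by auto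
qed

lemma mem_Frat:
  assumes "g \<in> carrier G" "p * q dvd ord g" "\<And>r. prime r \<Longrightarrow> r dvd ord g \<Longrightarrow> r = p \<or> r = q"
  shows "g \<in> Frat G"
  using assms Omega_star_star unfolding Omega_star_star_def Omega_star_def Omega_def by blast

text \<open>Minimality would give a {p, q}-element C of G / N outside Frat(G / N). It lifts to a {p,
  q}-element of G of order divisible by p q, which lies in Frat(G) and so maps into Frat(G /
  N).\<close>

lemma Omega_quotient:
  assumes N: "N \<lhd> G" "N \<noteq> {\<one>}"
  shows "Omega p q (G Mod N) = {}"
proof (rule ccontr)
  interpret N: normal N G by (rule N(1))
  interpret Q: group "G Mod N" by (rule N.factorgroup_is_group)
  assume ne: "Omega p q (G Mod N) \<noteq> {}"
  have carr: "carrier (G Mod N) = (\<lambda>g. N #> g) ` carrier G" by (auto simp: FactGroup_def RCOSETS_def)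
  have fin: "finite (carrier (G Mod N))" using finite by (simp add: carr)
  have "card N \<noteq> 1" using N(2) N.one_closed by (metis card_1_singletonE singletonD)
  moreover have "0 < card N" using subgroup_card_pos[OF finite N.is_subgroup] .
  moreover have "order (G Mod N) * card N = order G"
    using lagrange[OF N.is_subgroup] by (simp add: order_def FactGroup_def)
  moreover have "0 < order G" using finite order_gt_0_iff_finite by simp
  ultimately have "order (G Mod N) < order G"
    by (metis One_nat_def Suc_lessI mult.right_neutral mult_less_cancel1 nat_0_less_mult_iff)
  then obtain C where C: "C \<in> Omega_star_star p q (G Mod N)"
    using minimal[OF Q.is_group fin _ ne] by blast
  then have CQ: "C \<in> carrier (G Mod N)" and dvdC: "p * q dvd Q.ord C" and nF: "C \<notin> Frat (G Mod N)"
    and prC: "\<And>r. prime r \<Longrightarrow> r dvd Q.ord C \<Longrightarrow> r = p \<or> r = q"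
    by (auto simp: Omega_star_star_def Omega_star_def Omega_def)
  obtain g where g: "g \<in> carrier G" "C = N #> g" using CQ carr by auto
  define n where "n = ord g"
  have "0 < n" using ord_ge_1[OF finite g(1)] by (simp add: n_def)
  then obtain m where m: "n = p ^ multiplicity p n * q ^ multiplicity q n * m" "\<not> p dvd m" "\<not> q dvd m"
    using prime_part_decomp[OF p(1) q(1) p_neq_q] by metis
  have "coprime m (Q.ord C)"
    using prC m(2,3) by (intro coprimeI) (metis (full_types) dvd_trans is_unit_prod_mset_iff nat_dvd_1_iff_1 prime_factor_nat)
  moreover have "m \<noteq> 0" using \<open>0 < n\<close> m(1) by (metis mult_0_right neq0_conv)
  \<comment> \<open>The exponent m k is 1 modulo the order of C, so g^(m k) still lies in the coset
    C; being a multiple of m, it removes from the order of g all primes other than p and q.\<close>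
  ultimately obtain k y where ky: "m * k = Q.ord C * y + 1" using bezout_nat[of m "Q.ord C"] by auto
  let ?g = "g [^] (m * k)"
  have gG: "?g \<in> carrier G" using g(1) by simp
  have "N #> ?g = C [^]\<^bsub>G Mod N\<^esub> (Q.ord C * y + 1)"
    unfolding g(2) N.FactGroup_pow[OF g(1)] using ky g(2) by simp
  also have "\<dots> = (C [^]\<^bsub>G Mod N\<^esub> Q.ord C) [^]\<^bsub>G Mod N\<^esub> y \<otimes>\<^bsub>G Mod N\<^esub> C"
    unfolding Q.nat_pow_pow[OF CQ] by simp
  also have "\<dots> = C" using CQ Q.pow_ord_eq_1[OF CQ] Q.nat_pow_one[of y] Q.l_one[OF CQ] by metis
  finally have NC: "N #> ?g = C" .
  have "?g [^] (p ^ multiplicity p n * q ^ multiplicity q n) = g [^] (n * k)"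
    using g(1) by (subst (3) m(1)) (simp add: nat_pow_pow ac_simps)
  also have "\<dots> = \<one>" using g(1) by (simp add: n_def flip: nat_pow_pow)
  finally have ordg: "ord ?g dvd p ^ multiplicity p n * q ^ multiplicity q n" using pow_eq_id[OF gG] by blast
  have "C [^]\<^bsub>G Mod N\<^esub> ord ?g = \<one>\<^bsub>G Mod N\<^esub>"
  proof -
    have "C [^]\<^bsub>G Mod N\<^esub> ord ?g = N #> (?g [^] ord ?g)" using N.FactGroup_pow[OF gG] NC by metis
    then show ?thesis using pow_ord_eq_1[OF gG] by (simp add: FactGroup_def N.subset)
  qed
  then have "Q.ord C dvd ord ?g" using Q.pow_eq_id[OF CQ] by blast
  then have "p * q dvd ord ?g" using dvdC dvd_trans by blast
  moreover have "r = p \<or> r = q" if "prime r" "r dvd ord ?g" for r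
  proof -
    have "r dvd p ^ multiplicity p n * q ^ multiplicity q n" using that(2) ordg dvd_trans by blast
    then have "r dvd p \<or> r dvd q" using that(1) by (metis prime_dvd_mult_iff prime_dvd_power)
    then show ?thesis using that(1) p(1) q(1) by (metis primes_dvd_imp_eq)
  qed
  ultimately have "?g \<in> Frat G" using mem_Frat[OF gG] by blast
  then show False using Frat_factor[OF N(1)] NC nF by metis
qed

lemma no_commuting_quotient:
  assumes N: "N \<lhd> G" "N \<noteq> {\<one>}" and xy: "x \<in> carrier G" "y \<in> carrier G"
    and pow: "x [^] (p ^ i) \<in> N" "y [^] (q ^ j) \<in> N" and nN: "x \<notin> N" "y \<notin> N"
    and comm: "N #> (x \<otimes> y) = N #> (y \<otimes> x)"
  shows False
proof -
  interpret N: normal N G by (rule N(1))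
  interpret Q: group "G Mod N" by (rule N.factorgroup_is_group)
  let ?x = "N #> x" and ?y = "N #> y"
  have c: "?x \<in> carrier (G Mod N)" "?y \<in> carrier (G Mod N)"
    using xy by (auto simp: FactGroup_def RCOSETS_def)
  have cm: "?x \<otimes>\<^bsub>G Mod N\<^esub> ?y = ?y \<otimes>\<^bsub>G Mod N\<^esub> ?x"
    using comm N.rcos_sum[OF xy] N.rcos_sum[OF xy(2,1)] by (simp add: FactGroup_def)
  have one: "N #> z = \<one>\<^bsub>G Mod N\<^esub> \<longleftrightarrow> z \<in> N" if "z \<in> carrier G" for z
    using rcos_eq_iff[OF N(1) that one_closed] that N.subset by (simp add: FactGroup_def)
  have "?x [^]\<^bsub>G Mod N\<^esub> (p ^ i) = \<one>\<^bsub>G Mod N\<^esub>" "?y [^]\<^bsub>G Mod N\<^esub> (q ^ j) = \<one>\<^bsub>G Mod N\<^esub>"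
    using pow one xy N.FactGroup_pow[OF xy(1)] N.FactGroup_pow[OF xy(2)] by simp_all
  moreover have "?x \<noteq> \<one>\<^bsub>G Mod N\<^esub>" "?y \<noteq> \<one>\<^bsub>G Mod N\<^esub>" using nN one xy by simp_all
  ultimately have "p * q dvd Q.ord (?x \<otimes>\<^bsub>G Mod N\<^esub> ?y)"
    using Q.commuting_p_q_ord[OF p(1) q(1) p_neq_q c cm] by blast
  then have "?x \<otimes>\<^bsub>G Mod N\<^esub> ?y \<in> Omega p q (G Mod N)"
    using c Q.m_closed by (simp add: Omega_def)
  then show False using Omega_quotient[OF N] by blast
qed

theorem frattini_pair_exists: "\<exists>P Q a b. frattini_pair G p q P Q a b"
proof -
  let ?F = "Frat G"
  have sF: "subgroup ?F G" by (rule Frat_subgroup)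
  obtain g where g: "g \<in> carrier G" "p * q dvd ord g" using Omega by (auto simp: Omega_def)
  have gpos: "0 < ord g" using ord_ge_1[OF finite g(1)] by simp
  have pq0: "0 < p" "0 < q" using p(1) q(1) by (simp_all add: prime_gt_0_nat)
  define x where "x = g [^] (ord g div (p * q))"
  have xG: "x \<in> carrier G" using g(1) by (simp add: x_def)
  have ordx: "ord x = p * q"
  proof -
    obtain k where k: "ord g = (p * q) * k" using g(2) by blast
    then have "k \<noteq> 0" using gpos by auto
    then have "ord g div (p * q) = k" using k pq0 by simp
    then show ?thesis unfolding x_def using ord_pow[OF g(1), of k] k \<open>k \<noteq> 0\<close> by simp
  qed
  have xF: "x \<in> ?F"
  proof (rule mem_Frat[OF xG])
    show "r = p \<or> r = q" if "prime r" "r dvd ord x" for r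
      using that p(1) q(1) unfolding ordx by (metis prime_dvd_mult_iff primes_dvd_imp_eq)
  qed (simp add: ordx)
  define u where "u = x [^] q"
  define v where "v = x [^] p"
  have uG: "u \<in> carrier G" "v \<in> carrier G" using xG by (simp_all add: u_def v_def)
  have ordu: "ord u = p" unfolding u_def using ord_pow[OF xG, of q] ordx pq0 by simp
  have ordv: "ord v = q" unfolding v_def using ord_pow[OF xG, of p] ordx pq0 by simp
  have up: "u [^] p = \<one>" "v [^] q = \<one>" using pow_ord_eq_1[OF uG(1)] pow_ord_eq_1[OF uG(2)] ordu ordv by simp_all
  have uv: "u \<otimes> v = v \<otimes> u" using xG by (simp add: u_def v_def nat_pow_mult add.commute)
  have uF: "u \<in> ?F" "v \<in> ?F" unfolding u_def v_def using subgroup_nat_pow_closed[OF sF xF] by simp_all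
  have u1: "u \<noteq> \<one>" "v \<noteq> \<one>" using ordu ordv ord_eq_1[OF uG(1)] ord_eq_1[OF uG(2)] p(1) q(1) by auto
  have "p dvd card ?F" "q dvd card ?F"
    using pow_card_subgroup[OF finite sF uF(1)] pow_card_subgroup[OF finite sF uF(2)]
      pow_eq_id[OF uG(1)] pow_eq_id[OF uG(2)] ordu ordv by simp_all
  have other: "r = p \<or> r = q" if r: "prime r" "r dvd card ?F" for r
  proof (rule ccontr)
    assume neq: "\<not> (r = p \<or> r = q)"
    obtain R c where R: "R \<lhd> G" "R \<subseteq> ?F" "card R = r ^ c" "\<not> r dvd card ?F div card R"
      by (rule sylow_of_Frat_normal[OF r(1) finite])
    have R1: "R \<noteq> {\<one>}" using R(4) r(2) by auto
    have powR: "y [^] (r ^ c) = \<one>" if "y \<in> R" for y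
      using pow_card_subgroup[OF finite normal_imp_subgroup[OF R(1)] that] R(3) by simp
    have "coprime (r ^ c) p" "coprime (r ^ c) q"
      using neq r(1) p(1) q(1) by (simp_all add: primes_coprime)
    then have "u \<notin> R" "v \<notin> R"
      using coprime_pow_one[OF uG(1) powR up(1)] coprime_pow_one[OF uG(2) powR up(2)] u1 by blast+
    moreover have "\<one> \<in> R" using subgroup.one_closed[OF normal_imp_subgroup[OF R(1)]] .
    ultimately show False
      using no_commuting_quotient[OF R(1) R1 uG, of 1 1] up uv by simp
  qed
  obtain P a where P: "P \<lhd> G" "P \<subseteq> ?F" "card P = p ^ a" "\<not> p dvd card ?F div card P"
    by (rule sylow_of_Frat_normal[OF p(1) finite])
  obtain Q b where Q: "Q \<lhd> G" "Q \<subseteq> ?F" "card Q = q ^ b" "\<not> q dvd card ?F div card Q"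
    by (rule sylow_of_Frat_normal[OF q(1) finite])
  have P1: "P \<noteq> {\<one>}" using P(4) \<open>p dvd card ?F\<close> by auto
  have Q1: "Q \<noteq> {\<one>}" using Q(4) \<open>q dvd card ?F\<close> by auto
  have sP: "subgroup P G" and sQ: "subgroup Q G" using P(1) Q(1) by (simp_all add: normal_imp_subgroup)
  note Pc = subgroup.mem_carrier[OF sP] and Qc = subgroup.mem_carrier[OF sQ]
  have cop: "coprime (p ^ a) (q ^ b)" using p(1) q(1) p_neq_q by (simp add: primes_coprime)
  have "y = \<one>" if "y \<in> P" "y \<in> Q" for y
    using coprime_pow_one[OF Pc[OF that(1)] _ _ cop] pow_card_subgroup[OF finite sP that(1)]
      pow_card_subgroup[OF finite sQ that(2)] P(3) Q(3) by simp
  then have PQ: "P \<inter> Q = {\<one>}" using subgroup.one_closed[OF sP] subgroup.one_closed[OF sQ] by fast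
  have cardF: "card ?F = p ^ a * q ^ b"
  proof -
    have "p ^ a * q ^ b dvd card ?F"
      using card_subgroup_dvd[OF finite sP sF P(2)] card_subgroup_dvd[OF finite sQ sF Q(2)] P(3) Q(3) cop
      by (simp add: divides_mult)
    then obtain c where c: "card ?F = p ^ a * q ^ b * c" by blast
    have "card ?F div card P = q ^ b * c" "card ?F div card Q = p ^ a * c"
      unfolding c P(3) Q(3) using pq0 by (simp_all add: mult.assoc mult.left_commute[of _ "q ^ b"])
    then have "\<not> p dvd c" "\<not> q dvd c" using P(4) Q(4) dvd_mult by metis+
    moreover have "r = p \<or> r = q" if "prime r" "r dvd c" for r using other[OF that(1)] that(2) c by simp
    ultimately have "c = 1" using prime_factor_nat by metis
    then show ?thesis using c by simp
  qed
  have img: "(\<lambda>(u, v). u \<otimes> v) ` (P \<times> Q) = ?F"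
  proof (rule card_subset_eq)
    show "finite ?F" by (rule finite_subgroup[OF finite sF])
    show "(\<lambda>(u, v). u \<otimes> v) ` (P \<times> Q) \<subseteq> ?F" using P(2) Q(2) subgroup.m_closed[OF sF] by auto
    have "inj_on (\<lambda>(u, v). u \<otimes> v) (P \<times> Q)"
    proof (rule inj_onI, clarsimp)
      fix u v u' v' assume *: "u \<in> P" "v \<in> Q" "u' \<in> P" "v' \<in> Q" "u \<otimes> v = u' \<otimes> v'"
      show "u = u' \<and> v = v'" by (rule trivial_Int_product_eq[OF sP sQ PQ *])
    qed
    then show "card ((\<lambda>(u, v). u \<otimes> v) ` (P \<times> Q)) = card ?F"
      using cardF P(3) Q(3) by (simp add: card_image card_cartesian_product)
  qed
  have "frattini_pair G p q P Q a b"
  proof (intro frattini_pair.intro frattini_pair_axioms.intro)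
    show "x \<in> ?F \<longleftrightarrow> (\<exists>u\<in>P. \<exists>v\<in>Q. x = u \<otimes> v)" for x
      unfolding img[symmetric] by force
  next
    fix L assume L: "L \<lhd> G" "?F \<subseteq> L" "L \<noteq> carrier G"
    have sL: "subgroup L G" using L(1) by (rule normal_imp_subgroup)
    interpret LG: group "G\<lparr>carrier := L\<rparr>" using sL by (simp add: subgroup.subgroup_is_group is_group)
    have "x \<in> Omega p q (G\<lparr>carrier := L\<rparr>)"
      using xF L(2) ord_subgroup[OF sL, of x] ordx by (auto simp: Omega_def)
    moreover have "order (G\<lparr>carrier := L\<rparr>) < order G"
      using L(3) subgroup.subset[OF sL] finite by (auto simp: order_def intro!: psubset_card_mono)
    ultimately obtain h where h: "h \<in> Omega_star_star p q (G\<lparr>carrier := L\<rparr>)"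
      using minimal[OF LG.is_group] finite_subgroup[OF finite sL] by fastforce
    then have hL: "h \<in> L" and hF: "h \<notin> Frat (G\<lparr>carrier := L\<rparr>)"
      by (auto simp: Omega_star_star_def Omega_star_def Omega_def)
    have "h \<in> ?F"
      using h ord_subgroup[OF sL hL] subgroup.mem_carrier[OF sL hL]
      by (intro mem_Frat) (auto simp: Omega_star_star_def Omega_star_def Omega_def)
    then show "\<not> ?F \<subseteq> Frat (G\<lparr>carrier := L\<rparr>)" using hF by blast
  next
    fix N x y i j
    assume "N \<lhd> G" "N \<noteq> {\<one>}" "x \<in> carrier G" "y \<in> carrier G" "x [^] (p ^ i) \<in> N" "y [^] (q ^ j) \<in> N"
      "x \<notin> N" "y \<notin> N" "N #> (x \<otimes> y) = N #> (y \<otimes> x)"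
    then show False by (rule no_commuting_quotient)
  qed (rule is_group finite p q P(1,3) Q(1,3) P1 Q1 p_neq_q)+
  then show ?thesis by blast
qed

end

section \<open>The modules and their cohomology\<close>

locale coset_map = normal F G + S: group S for F and G (structure) and S :: "('s, 'm) monoid_scheme" +
  fixes \<theta> :: "'a set \<Rightarrow> 's"
  assumes \<theta>: "\<theta> \<in> iso (G Mod F) S"
begin

definition \<sigma> :: "'a \<Rightarrow> 's" where "\<sigma> g = \<theta> (F #> g)"

text \<open>A set-theoretic section of \<sigma>. It is not normalized: its value at the unit of S is
  only known to lie in F.\<close>

definition \<tau> :: "'s \<Rightarrow> 'a" where "\<tau> s = (SOME g. g \<in> carrier G \<and> \<sigma> g = s)"

lemma coset_carrier: "carrier (G Mod F) = (\<lambda>g. F #> g) ` carrier G"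
  by (auto simp: FactGroup_def RCOSETS_def)

lemma \<sigma>_closed [simp]: "g \<in> carrier G \<Longrightarrow> \<sigma> g \<in> carrier S"
  using \<theta> coset_carrier unfolding \<sigma>_def iso_def hom_def by auto

lemma \<sigma>_mult: "g \<in> carrier G \<Longrightarrow> h \<in> carrier G \<Longrightarrow> \<sigma> (g \<otimes> h) = \<sigma> g \<otimes>\<^bsub>S\<^esub> \<sigma> h"
proof -
  assume gh: "g \<in> carrier G" "h \<in> carrier G"
  have "\<sigma> (g \<otimes> h) = \<theta> ((F #> g) \<otimes>\<^bsub>G Mod F\<^esub> (F #> h))"
    unfolding \<sigma>_def using gh rcos_sum by (simp add: FactGroup_def)
  also have "\<dots> = \<sigma> g \<otimes>\<^bsub>S\<^esub> \<sigma> h"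
    unfolding \<sigma>_def using \<theta> gh coset_carrier by (intro hom_mult) (auto simp: iso_def)
  finally show ?thesis .
qed

lemma \<sigma>_surj: "s \<in> carrier S \<Longrightarrow> \<exists>g\<in>carrier G. \<sigma> g = s"
proof -
  assume "s \<in> carrier S"
  also have "carrier S = \<theta> ` (\<lambda>g. F #> g) ` carrier G"
    using \<theta> coset_carrier by (simp add: iso_def bij_betw_def)
  finally show ?thesis unfolding \<sigma>_def by blast
qed

lemma \<sigma>_eq_iff: "g \<in> carrier G \<Longrightarrow> h \<in> carrier G \<Longrightarrow> \<sigma> g = \<sigma> h \<longleftrightarrow> g \<otimes> inv h \<in> F"
proof -
  assume gh: "g \<in> carrier G" "h \<in> carrier G"
  have "inj_on \<theta> (carrier (G Mod F))" using \<theta> by (simp add: iso_def bij_betw_def)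
  then have "\<sigma> g = \<sigma> h \<longleftrightarrow> F #> g = F #> h"
    unfolding \<sigma>_def using gh coset_carrier by (intro inj_on_eq_iff) auto
  then show ?thesis using rcos_eq_iff[OF normal_axioms gh] by simp
qed

sublocale \<sigma>: group_hom G S \<sigma>
  by unfold_locales (simp add: hom_def \<sigma>_mult)

lemma \<sigma>_eq_one_iff: "g \<in> carrier G \<Longrightarrow> \<sigma> g = \<one>\<^bsub>S\<^esub> \<longleftrightarrow> g \<in> F"
  using \<sigma>_eq_iff[of g \<one>] \<sigma>.hom_one by simp

lemma \<tau>: assumes "s \<in> carrier S" shows \<tau>_closed: "\<tau> s \<in> carrier G" and \<sigma>_\<tau>: "\<sigma> (\<tau> s) = s"
proof -
  have "\<tau> s \<in> carrier G \<and> \<sigma> (\<tau> s) = s"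
    unfolding \<tau>_def by (rule someI_ex) (use \<sigma>_surj[OF assms] in blast)
  then show "\<tau> s \<in> carrier G" "\<sigma> (\<tau> s) = s" by simp_all
qed

end

locale conjugation_module = coset_map F G S \<theta> for F and G (structure) and S :: "('s, 'm) monoid_scheme" and \<theta> +
  fixes P :: "'a set" and A :: "('c, 'n) monoid_scheme" and f :: "'a \<Rightarrow> 'c"
  assumes P: "P \<lhd> G" and abelian: "\<And>u v. u \<in> P \<Longrightarrow> v \<in> P \<Longrightarrow> u \<otimes> v = v \<otimes> u"
    and F_centralizes: "\<And>x u. x \<in> F \<Longrightarrow> u \<in> P \<Longrightarrow> conj_by x u = u"
    and A: "group A" and f: "f \<in> iso (G\<lparr>carrier := P\<rparr>) A"
begin

text \<open>The section does not matter, since F centralizes P and elements with the same image in S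
  conjugate P alike. The restriction makes each map extensional, as elements of
  \<open>AutoGroup A\<close> must be.\<close>

definition \<alpha> :: "'s \<Rightarrow> 'c \<Rightarrow> 'c" where
  "\<alpha> s = (\<lambda>a\<in>carrier A. f (conj_by (\<tau> s) (inv_into P f a)))"

lemma sub_P: "subgroup P G" using P by (rule normal_imp_subgroup)

lemma mem_P [simp]: "u \<in> P \<Longrightarrow> u \<in> carrier G" by (rule subgroup.mem_carrier[OF sub_P])

lemma conj_P_closed [simp]: "g \<in> carrier G \<Longrightarrow> u \<in> P \<Longrightarrow> conj_by g u \<in> P"
  by (rule normal_conj_by[OF P])

lemma f_bij: "bij_betw f P (carrier A)" using f by (simp add: iso_def)

lemma f_closed [simp]: "u \<in> P \<Longrightarrow> f u \<in> carrier A" using f_bij by (auto simp: bij_betw_def)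

lemma f_mult: "u \<in> P \<Longrightarrow> v \<in> P \<Longrightarrow> f (u \<otimes> v) = f u \<otimes>\<^bsub>A\<^esub> f v"
  using f by (simp add: iso_def hom_def)

lemma f_surj: "x \<in> carrier A \<Longrightarrow> \<exists>u\<in>P. x = f u" using f_bij by (auto simp: bij_betw_def)

lemma f_eq_iff: "u \<in> P \<Longrightarrow> v \<in> P \<Longrightarrow> f u = f v \<longleftrightarrow> u = v"
  using f_bij by (auto simp: bij_betw_def inj_on_def)

lemma inv_f [simp]: "u \<in> P \<Longrightarrow> inv_into P f (f u) = u"
  using f_bij by (simp add: bij_betw_def)

lemma f_one: "f \<one> = \<one>\<^bsub>A\<^esub>"
  using hom_one[of f "G\<lparr>carrier := P\<rparr>" A] f A sub_P by (simp add: iso_def subgroup.subgroup_is_group is_group)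

lemma conj_eq: "g \<in> carrier G \<Longrightarrow> h \<in> carrier G \<Longrightarrow> \<sigma> g = \<sigma> h \<Longrightarrow> u \<in> P \<Longrightarrow> conj_by g u = conj_by h u"
proof -
  assume gh: "g \<in> carrier G" "h \<in> carrier G" "\<sigma> g = \<sigma> h" and u: "u \<in> P"
  have n: "g \<otimes> inv h \<in> F" using gh \<sigma>_eq_iff by simp
  have "conj_by g u = conj_by (g \<otimes> inv h) (conj_by h u)"
    using gh u by (simp add: m_assoc flip: conj_by_mult_left)
  then show ?thesis using F_centralizes[OF n] gh u by simp
qed

lemma \<alpha>_\<sigma>: "g \<in> carrier G \<Longrightarrow> u \<in> P \<Longrightarrow> \<alpha> (\<sigma> g) (f u) = f (conj_by g u)"
  using conj_eq[OF \<tau>_closed _ \<sigma>_\<tau>, of g u] by (simp add: \<alpha>_def)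

lemma comm_group_A: "comm_group A"
proof (rule group.group_comm_groupI[OF A])
  fix x y assume "x \<in> carrier A" "y \<in> carrier A"
  then obtain u v where "u \<in> P" "v \<in> P" "x = f u" "y = f v" using f_surj by metis
  then show "x \<otimes>\<^bsub>A\<^esub> y = y \<otimes>\<^bsub>A\<^esub> x" using abelian[of u v] f_mult[of u v] f_mult[of v u] by simp
qed

lemma module: "group_module S A \<alpha>"
proof -
  have auto: "\<alpha> s \<in> auto A" if s: "s \<in> carrier S" for s
  proof -
    obtain g where g: "g \<in> carrier G" "\<sigma> g = s" using \<sigma>_surj[OF s] by blast
    have ag: "\<alpha> s (f u) = f (conj_by g u)" if "u \<in> P" for u using \<alpha>_\<sigma>[OF g(1) that] g(2) by simp
    have "\<alpha> s \<in> hom A A"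
    proof (rule homI)
      fix x assume "x \<in> carrier A"
      then obtain u where "u \<in> P" "x = f u" using f_surj by blast
      then show "\<alpha> s x \<in> carrier A" using ag g(1) by simp
    next
      fix x y assume "x \<in> carrier A" "y \<in> carrier A"
      then obtain u v where uv: "u \<in> P" "v \<in> P" "x = f u" "y = f v" using f_surj by metis
      have "\<alpha> s (f (u \<otimes> v)) = f (conj_by g u \<otimes> conj_by g v)"
        using ag[of "u \<otimes> v"] uv g(1) subgroup.m_closed[OF sub_P] by (simp add: conj_by_mult)
      then show "\<alpha> s (x \<otimes>\<^bsub>A\<^esub> y) = \<alpha> s x \<otimes>\<^bsub>A\<^esub> \<alpha> s y"
        using uv ag g(1) by (simp add: f_mult)
    qed
    moreover have "bij_betw (\<alpha> s) (carrier A) (carrier A)"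
      unfolding bij_betw_def
    proof
      show "inj_on (\<alpha> s) (carrier A)"
      proof (rule inj_onI)
        fix x y assume "x \<in> carrier A" "y \<in> carrier A" and eq: "\<alpha> s x = \<alpha> s y"
        then obtain u v where uv: "u \<in> P" "v \<in> P" "x = f u" "y = f v" using f_surj by metis
        then have "conj_by g u = conj_by g v" using eq ag g(1) f_eq_iff by simp
        then show "x = y" using uv g(1) conj_by_inj[of g u v] by simp
      qed
      show "\<alpha> s ` carrier A = carrier A"
      proof (intro equalityI subsetI)
        fix y assume "y \<in> carrier A"
        then obtain v where v: "v \<in> P" "y = f v" using f_surj by blast
        then have "y = \<alpha> s (f (conj_by (inv g) v))" using ag[of "conj_by (inv g) v"] g(1) by simp
        then show "y \<in> \<alpha> s ` carrier A" using v g(1) by simp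
      next
        fix y assume "y \<in> \<alpha> s ` carrier A"
        then obtain u where "u \<in> P" "y = \<alpha> s (f u)" using f_surj by auto
        then show "y \<in> carrier A" using ag g(1) by simp
      qed
    qed
    ultimately show ?thesis by (simp add: auto_def Bij_def \<alpha>_def)
  qed
  have "\<alpha> \<in> hom S (AutoGroup A)"
  proof (rule homI)
    show "\<alpha> s \<in> carrier (AutoGroup A)" if "s \<in> carrier S" for s
      using auto[OF that] by (simp add: AutoGroup_def)
    fix s t assume st: "s \<in> carrier S" "t \<in> carrier S"
    obtain g where g: "g \<in> carrier G" "\<sigma> g = s" using \<sigma>_surj[OF st(1)] by blast
    obtain h where h: "h \<in> carrier G" "\<sigma> h = t" using \<sigma>_surj[OF st(2)] by blast
    have "\<alpha> (s \<otimes>\<^bsub>S\<^esub> t) = compose (carrier A) (\<alpha> s) (\<alpha> t)"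
    proof (rule extensionalityI[of _ "carrier A"])
      fix x assume "x \<in> carrier A"
      then obtain u where u: "u \<in> P" "x = f u" using f_surj by blast
      have "\<alpha> (s \<otimes>\<^bsub>S\<^esub> t) x = \<alpha> s (\<alpha> t x)"
        using \<alpha>_\<sigma>[of "g \<otimes> h" u] \<alpha>_\<sigma>[of h u] \<alpha>_\<sigma>[of g "conj_by h u"] g h u
        by (simp add: \<sigma>_mult conj_by_mult_left)
      then show "\<alpha> (s \<otimes>\<^bsub>S\<^esub> t) x = compose (carrier A) (\<alpha> s) (\<alpha> t) x"
        using u by (simp add: compose_def)
    qed (simp_all add: \<alpha>_def)
    moreover have "\<alpha> s \<in> Bij (carrier A)" "\<alpha> t \<in> Bij (carrier A)" using auto st by (simp_all add: auto_def)
    ultimately show "\<alpha> (s \<otimes>\<^bsub>S\<^esub> t) = \<alpha> s \<otimes>\<^bsub>AutoGroup A\<^esub> \<alpha> t"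
      by (simp add: AutoGroup_def BijGroup_def)
  qed
  then show ?thesis using S.is_group comm_group_A by (simp add: group_module_def)
qed

lemma faithful:
  assumes "\<And>x. x \<in> carrier G \<Longrightarrow> (\<And>u. u \<in> P \<Longrightarrow> conj_by x u = u) \<Longrightarrow> x \<in> F"
  shows "faithful_module S A \<alpha>"
  unfolding faithful_module_def
proof (intro conjI module inj_onI)
  fix s t assume st: "s \<in> carrier S" "t \<in> carrier S" "\<alpha> s = \<alpha> t"
  obtain g where g: "g \<in> carrier G" "\<sigma> g = s" using \<sigma>_surj[OF st(1)] by blast
  obtain h where h: "h \<in> carrier G" "\<sigma> h = t" using \<sigma>_surj[OF st(2)] by blast
  have gh: "conj_by g u = conj_by h u" if "u \<in> P" for u
    using \<alpha>_\<sigma>[OF g(1) that] \<alpha>_\<sigma>[OF h(1) that] st(3) g h that f_eq_iff by simp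
  have "g \<otimes> inv h \<in> F"
  proof (rule assms)
    fix u assume u: "u \<in> P"
    then show "conj_by (g \<otimes> inv h) u = u" using gh[of "conj_by (inv h) u"] g h by (simp add: conj_by_mult_left)
  qed (use g h in simp)
  then show "s = t" using \<sigma>_eq_iff g h by blast
qed

text \<open>The preimage under f of a submodule is invariant under conjugation, hence a normal
  subgroup of G inside P.\<close>

lemma irreducible:
  assumes "P \<noteq> {\<one>}" "\<And>N. N \<lhd> G \<Longrightarrow> N \<subseteq> P \<Longrightarrow> N = {\<one>} \<or> N = P"
  shows "irreducible_module S A \<alpha>"
  unfolding irreducible_module_def
proof (intro conjI module allI impI)
  have img: "f ` P = carrier A" using f_bij by (simp add: bij_betw_def)
  show "carrier A \<noteq> {\<one>\<^bsub>A\<^esub>}"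
  proof
    assume *: "carrier A = {\<one>\<^bsub>A\<^esub>}"
    have "u = \<one>" if "u \<in> P" for u
      using f_eq_iff[OF that subgroup.one_closed[OF sub_P]] f_closed[OF that] * f_one by simp
    then show False using assms(1) subgroup.one_closed[OF sub_P] by fast
  qed
  fix B assume B: "submodule_of B S A \<alpha>"
  then have sB: "subgroup B A" and inv: "\<And>s x. s \<in> carrier S \<Longrightarrow> x \<in> B \<Longrightarrow> \<alpha> s x \<in> B"
    by (auto simp: submodule_of_def)
  let ?N = "{u \<in> P. f u \<in> B}"
  have finv: "f (inv u) = inv\<^bsub>A\<^esub> f u" if "u \<in> P" for u
  proof -
    have "inv u \<in> P" using that subgroup.m_inv_closed[OF sub_P] by simp
    then have "f (inv u) \<otimes>\<^bsub>A\<^esub> f u = \<one>\<^bsub>A\<^esub>" using that by (simp add: f_one flip: f_mult)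
    then show ?thesis using group.inv_equality[OF A] that \<open>inv u \<in> P\<close> by simp
  qed
  have "?N \<lhd> G"
  proof (rule normal_conj_byI)
    show "subgroup ?N G"
    proof (rule subgroupI)
      show "?N \<noteq> {}" using f_one subgroup.one_closed[OF sub_P] subgroup.one_closed[OF sB] by auto
    qed (use sub_P sB in \<open>auto simp: f_mult finv subgroup.m_closed subgroup.m_inv_closed\<close>)
    show "conj_by g u \<in> ?N" if "g \<in> carrier G" "u \<in> ?N" for g u
      using \<alpha>_\<sigma>[of g u] inv[of "\<sigma> g" "f u"] that by simp
  qed
  then have "?N = {\<one>} \<or> ?N = P" by (intro assms(2)) auto
  moreover have "f ` ?N = B" using subgroup.subset[OF sB] img by auto
  ultimately show "B = {\<one>\<^bsub>A\<^esub>} \<or> B = carrier A"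
    using img f_one by auto
qed

lemma order_A: "order A = card P" "finite P \<Longrightarrow> finite (carrier A)"
  using bij_betw_same_card[OF f_bij] bij_betw_finite[OF f_bij] by (simp_all add: order_def)

lemma fixed_trivial:
  assumes "g \<in> carrier G" "\<And>u. u \<in> P \<Longrightarrow> conj_by g u = u \<Longrightarrow> u = \<one>"
  shows "module_fixed A \<alpha> (\<sigma> g) = {\<one>\<^bsub>A\<^esub>}"
proof -
  have *: "x = \<one>\<^bsub>A\<^esub>" if x: "x \<in> carrier A" "\<alpha> (\<sigma> g) x = x" for x
  proof -
    obtain u where u: "u \<in> P" "x = f u" using f_surj[OF x(1)] by blast
    then have "conj_by g u = u" using \<alpha>_\<sigma>[OF assms(1) u(1)] x(2) f_eq_iff assms(1) by simp
    then show ?thesis using assms(2) u f_one by simp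
  qed
  have "\<alpha> (\<sigma> g) \<one>\<^bsub>A\<^esub> = \<one>\<^bsub>A\<^esub>"
    using group_module_act_one[OF module] assms(1) by simp
  moreover have "\<one>\<^bsub>A\<^esub> \<in> carrier A" using monoid.one_closed[OF group.is_monoid[OF A]] .
  ultimately have "\<one>\<^bsub>A\<^esub> \<in> module_fixed A \<alpha> (\<sigma> g)" by (simp add: module_fixed_def)
  moreover have "module_fixed A \<alpha> (\<sigma> g) \<subseteq> {\<one>\<^bsub>A\<^esub>}"
    unfolding module_fixed_def using * by fast
  ultimately show ?thesis by blast
qed

text \<open>If the 2-cocycle of a section of \<open>G \<rightarrow> S\<close>, projected to \<open>P\<close>, is the coboundary of \<open>c\<close>, then correcting
  the projection of \<open>g \<tau>(\<sigma> g)\<^sup>-\<^sup>1\<close> by \<open>c (\<sigma> g)\<close> gives a crossed homomorphism that is injective on \<open>P\<close>.\<close>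

lemma cohomology2_nontrivial:
  assumes fin: "finite (carrier G)" and PF: "P \<subseteq> F"
    and no_compl: "\<And>H. \<not> is_complement G P H"
    and proj: "\<And>x. x \<in> F \<Longrightarrow> \<pi> x \<in> P" "\<And>x y. x \<in> F \<Longrightarrow> y \<in> F \<Longrightarrow> \<pi> (x \<otimes> y) = \<pi> x \<otimes> \<pi> y"
      "\<And>g x. g \<in> carrier G \<Longrightarrow> x \<in> F \<Longrightarrow> \<pi> (conj_by g x) = conj_by g (\<pi> x)"
      "\<And>u. u \<in> P \<Longrightarrow> \<pi> u = u"
  shows "\<not> trivial_group (cohomology2 S A \<alpha>)"
proof
  assume triv: "trivial_group (cohomology2 S A \<alpha>)"
  interpret A: comm_group A by (rule comm_group_A)
  interpret Z: comm_group "cocycles2 S A \<alpha>" by (rule comm_group_cocycles2[OF module])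
  let ?B = "coboundaries2 S A \<alpha>"
  have sB: "subgroup ?B (cocycles2 S A \<alpha>)" by (rule subgroup_coboundaries2[OF module])
  have cob: "z \<in> ?B" if z: "z \<in> carrier (cocycles2 S A \<alpha>)" for z
  proof -
    have "?B #>\<^bsub>cocycles2 S A \<alpha>\<^esub> z \<in> carrier (cohomology2 S A \<alpha>)"
      using z by (auto simp: cohomology2_def FactGroup_def RCOSETS_def)
    then have "?B #>\<^bsub>cocycles2 S A \<alpha>\<^esub> z = ?B"
      using triv by (simp add: trivial_group_def cohomology2_def FactGroup_def)
    then show ?thesis using Z.rcos_self[OF z sB] by simp
  qed
  note \<tau>c = \<tau>_closed
  \<comment> \<open>The factor set of the extension, with values in F.\<close>
  define e where "e s t = \<tau> s \<otimes> \<tau> t \<otimes> inv (\<tau> (s \<otimes>\<^bsub>S\<^esub> t))" for s t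
  have eF: "e s t \<in> F" if "s \<in> carrier S" "t \<in> carrier S" for s t
    using \<sigma>_eq_iff[of "\<tau> s \<otimes> \<tau> t" "\<tau> (s \<otimes>\<^bsub>S\<^esub> t)"] that \<tau>c by (simp add: e_def \<sigma>_mult \<sigma>_\<tau>)
  have eeq: "\<tau> s \<otimes> \<tau> t = e s t \<otimes> \<tau> (s \<otimes>\<^bsub>S\<^esub> t)" if "s \<in> carrier S" "t \<in> carrier S" for s t
    using that \<tau>c by (simp add: e_def m_assoc)
  \<comment> \<open>Both sides come from the two bracketings of \<tau> s, \<tau> t, \<tau>
    u.\<close>
  have ecoc: "conj_by (\<tau> s) (e t u) \<otimes> e s (t \<otimes>\<^bsub>S\<^esub> u) = e s t \<otimes> e (s \<otimes>\<^bsub>S\<^esub> t) u"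
    if st: "s \<in> carrier S" "t \<in> carrier S" "u \<in> carrier S" for s t u
  proof -
    have E: "e t u \<in> carrier G" "e s (t \<otimes>\<^bsub>S\<^esub> u) \<in> carrier G" "e s t \<in> carrier G" "e (s \<otimes>\<^bsub>S\<^esub> t) u \<in> carrier G"
      using eF st by simp_all
    have T: "\<tau> s \<in> carrier G" "\<tau> t \<in> carrier G" "\<tau> u \<in> carrier G" "\<tau> (s \<otimes>\<^bsub>S\<^esub> t) \<in> carrier G"
      "\<tau> (t \<otimes>\<^bsub>S\<^esub> u) \<in> carrier G" "\<tau> (s \<otimes>\<^bsub>S\<^esub> t \<otimes>\<^bsub>S\<^esub> u) \<in> carrier G"
      using \<tau>c st by simp_all
    have "conj_by (\<tau> s) (e t u) \<otimes> e s (t \<otimes>\<^bsub>S\<^esub> u) \<otimes> \<tau> (s \<otimes>\<^bsub>S\<^esub> t \<otimes>\<^bsub>S\<^esub> u) =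
        conj_by (\<tau> s) (e t u) \<otimes> (\<tau> s \<otimes> \<tau> (t \<otimes>\<^bsub>S\<^esub> u))"
      using eeq[of s "t \<otimes>\<^bsub>S\<^esub> u"] st E T by (simp add: m_assoc S.m_assoc)
    also have "\<dots> = \<tau> s \<otimes> (e t u \<otimes> \<tau> (t \<otimes>\<^bsub>S\<^esub> u))" using E T by (simp add: conj_by_def m_assoc)
    also have "\<dots> = \<tau> s \<otimes> \<tau> t \<otimes> \<tau> u" using eeq[OF st(2,3)] T by (simp add: m_assoc)
    also have "\<dots> = e s t \<otimes> (\<tau> (s \<otimes>\<^bsub>S\<^esub> t) \<otimes> \<tau> u)" using eeq[OF st(1,2)] E T by (simp add: m_assoc)
    also have "\<dots> = e s t \<otimes> e (s \<otimes>\<^bsub>S\<^esub> t) u \<otimes> \<tau> (s \<otimes>\<^bsub>S\<^esub> t \<otimes>\<^bsub>S\<^esub> u)"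
      using eeq[of "s \<otimes>\<^bsub>S\<^esub> t" u] st E T by (simp add: m_assoc)
    finally show ?thesis using E T by simp
  qed
  \<comment> \<open>The projection from F to P is a homomorphism that commutes with conjugation, so
    it turns the factor set into a cocycle with values in A.\<close>
  define z where "z = (\<lambda>(s, t)\<in>carrier S \<times> carrier S. f (\<pi> (e s t)))"
  have cF: "conj_by g x \<in> F" if "g \<in> carrier G" "x \<in> F" for g x using normal_conj_by[OF normal_axioms that] .
  have "z \<in> carrier (cocycles2 S A \<alpha>)"
  proof -
    have "\<alpha> s (f (\<pi> (e t u))) \<otimes>\<^bsub>A\<^esub> f (\<pi> (e s (t \<otimes>\<^bsub>S\<^esub> u))) =
        f (\<pi> (e (s \<otimes>\<^bsub>S\<^esub> t) u)) \<otimes>\<^bsub>A\<^esub> f (\<pi> (e s t))"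
      if st: "s \<in> carrier S" "t \<in> carrier S" "u \<in> carrier S" for s t u
    proof -
      have E: "e t u \<in> F" "e s (t \<otimes>\<^bsub>S\<^esub> u) \<in> F" "e s t \<in> F" "e (s \<otimes>\<^bsub>S\<^esub> t) u \<in> F"
        using eF st by simp_all
      have "\<alpha> s (f (\<pi> (e t u))) = f (\<pi> (conj_by (\<tau> s) (e t u)))"
        using \<alpha>_\<sigma>[OF \<tau>c[OF st(1)] proj(1)[OF E(1)]] \<sigma>_\<tau>[OF st(1)] proj(3)[OF \<tau>c[OF st(1)] E(1)] by simp
      then have "\<alpha> s (f (\<pi> (e t u))) \<otimes>\<^bsub>A\<^esub> f (\<pi> (e s (t \<otimes>\<^bsub>S\<^esub> u))) =
          f (\<pi> (conj_by (\<tau> s) (e t u) \<otimes> e s (t \<otimes>\<^bsub>S\<^esub> u)))"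
        using E proj(1,2) cF[OF \<tau>c[OF st(1)] E(1)] by (simp add: f_mult)
      also have "\<dots> = f (\<pi> (e s t)) \<otimes>\<^bsub>A\<^esub> f (\<pi> (e (s \<otimes>\<^bsub>S\<^esub> t) u))"
        unfolding ecoc[OF st] using E proj(1,2) by (simp add: f_mult)
      finally show ?thesis using E proj(1) by (simp add: A.m_comm)
    qed
    then show ?thesis unfolding cocycles2_def z_def using eF proj(1) by auto
  qed
  then have "z \<in> ?B" by (rule cob)
  then obtain c where c: "c \<in> carrier S \<rightarrow> carrier A" "z = coboundary2 S A \<alpha> c"
    by (auto simp: coboundaries2_def)
  define c' where "c' s = inv_into P f (c s)" for s
  have c': "c' s \<in> P" "f (c' s) = c s" if "s \<in> carrier S" for s
  proof -
    have "c s \<in> carrier A" using c(1) that by auto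
    then obtain u where "u \<in> P" "c s = f u" using f_surj by blast
    then show "c' s \<in> P" "f (c' s) = c s" by (simp_all add: c'_def)
  qed
  have zc: "\<pi> (e s t) \<otimes> c' (s \<otimes>\<^bsub>S\<^esub> t) = conj_by (\<tau> s) (c' t) \<otimes> c' s"
    if st: "s \<in> carrier S" "t \<in> carrier S" for s t
  proof -
    have cl: "c s \<in> carrier A" "c t \<in> carrier A" "c (s \<otimes>\<^bsub>S\<^esub> t) \<in> carrier A" "\<alpha> s (c t) \<in> carrier A"
      using c(1) st group_module_act_closed[OF module st(1)] by auto
    have "f (\<pi> (e s t)) = \<alpha> s (c t) \<otimes>\<^bsub>A\<^esub> inv\<^bsub>A\<^esub> c (s \<otimes>\<^bsub>S\<^esub> t) \<otimes>\<^bsub>A\<^esub> c s"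
      using fun_cong[OF c(2), of "(s, t)"] st by (simp add: z_def coboundary2_def)
    then have "f (\<pi> (e s t)) \<otimes>\<^bsub>A\<^esub> c (s \<otimes>\<^bsub>S\<^esub> t) =
        (inv\<^bsub>A\<^esub> c (s \<otimes>\<^bsub>S\<^esub> t) \<otimes>\<^bsub>A\<^esub> c (s \<otimes>\<^bsub>S\<^esub> t)) \<otimes>\<^bsub>A\<^esub> (\<alpha> s (c t) \<otimes>\<^bsub>A\<^esub> c s)"
      using cl by (simp only: A.m_ac A.m_closed A.inv_closed)
    also have "\<dots> = \<alpha> s (c t) \<otimes>\<^bsub>A\<^esub> c s" using cl by simp
    also have "\<alpha> s (c t) = f (conj_by (\<tau> s) (c' t))"
      using \<alpha>_\<sigma>[OF \<tau>c[OF st(1)] c'(1)[OF st(2)]] \<sigma>_\<tau>[OF st(1)] c'(2)[OF st(2)] by simp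
    finally have "f (\<pi> (e s t) \<otimes> c' (s \<otimes>\<^bsub>S\<^esub> t)) = f (conj_by (\<tau> s) (c' t) \<otimes> c' s)"
      using c' st \<tau>c proj(1)[OF eF[OF st]] by (simp add: f_mult)
    moreover have "\<pi> (e s t) \<otimes> c' (s \<otimes>\<^bsub>S\<^esub> t) \<in> P" "conj_by (\<tau> s) (c' t) \<otimes> c' s \<in> P"
      using c' st \<tau>c proj(1)[OF eF[OF st]] subgroup.m_closed[OF sub_P] by simp_all
    ultimately show ?thesis using f_eq_iff by simp
  qed
  define n where "n g = g \<otimes> inv (\<tau> (\<sigma> g))" for g
  have nF: "n g \<in> F" if "g \<in> carrier G" for g
    using \<sigma>_eq_iff[of g "\<tau> (\<sigma> g)"] that \<tau>c \<sigma>_\<tau> by (simp add: n_def)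
  have gn: "g = n g \<otimes> \<tau> (\<sigma> g)" if "g \<in> carrier G" for g
    using that \<tau>c by (simp add: n_def m_assoc)
  define C where "C g = \<pi> (n g) \<otimes> c' (\<sigma> g)" for g
  have CP: "C g \<in> P" if "g \<in> carrier G" for g
    using that nF proj(1) c'(1) subgroup.m_closed[OF sub_P] by (simp add: C_def)
  \<comment> \<open>The F-part of g h is n(g), times the conjugate of n(h) by \<tau> (\<sigma> g),
    times a value of e; \<open>zc\<close> trades the projected value of e for values of
    \<open>c'\<close>.\<close>
  have Cmult: "C (g \<otimes> h) = conj_by g (C h) \<otimes> C g" if gh: "g \<in> carrier G" "h \<in> carrier G" for g h
  proof -
    let ?s = "\<sigma> g" and ?t = "\<sigma> h"
    have T: "\<tau> ?s \<in> carrier G" "\<tau> ?t \<in> carrier G" "\<tau> (?s \<otimes>\<^bsub>S\<^esub> ?t) \<in> carrier G" using \<tau>c gh by simp_all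
    have N: "n g \<in> F" "n h \<in> F" "e ?s ?t \<in> F" "conj_by (\<tau> ?s) (n h) \<in> F"
      using nF gh eF cF T by simp_all
    have "g \<otimes> h = (n g \<otimes> \<tau> ?s) \<otimes> (n h \<otimes> \<tau> ?t)" using gn gh by metis
    also have "\<dots> = (n g \<otimes> conj_by (\<tau> ?s) (n h)) \<otimes> (\<tau> ?s \<otimes> \<tau> ?t)"
      using N T by (simp add: conj_by_def m_assoc)
    also have "\<dots> = (n g \<otimes> conj_by (\<tau> ?s) (n h) \<otimes> e ?s ?t) \<otimes> \<tau> (?s \<otimes>\<^bsub>S\<^esub> ?t)"
      using eeq[of ?s ?t] gh N T by (simp add: m_assoc)
    finally have eq: "g \<otimes> h = n g \<otimes> conj_by (\<tau> ?s) (n h) \<otimes> e ?s ?t \<otimes> \<tau> (?s \<otimes>\<^bsub>S\<^esub> ?t)" .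
    have "n g \<otimes> conj_by (\<tau> ?s) (n h) \<otimes> e ?s ?t \<in> carrier G" using N by simp
    then have "g \<otimes> h \<otimes> inv (\<tau> (?s \<otimes>\<^bsub>S\<^esub> ?t)) = n g \<otimes> conj_by (\<tau> ?s) (n h) \<otimes> e ?s ?t"
      using eq T(3) gh inv_solve_right' by simp
    then have "n (g \<otimes> h) = n g \<otimes> conj_by (\<tau> ?s) (n h) \<otimes> e ?s ?t"
      unfolding n_def[of "g \<otimes> h"] \<sigma>_mult[OF gh] .
    then have "\<pi> (n (g \<otimes> h)) = \<pi> (n g) \<otimes> conj_by (\<tau> ?s) (\<pi> (n h)) \<otimes> \<pi> (e ?s ?t)"
      using N T proj(2,3) by simp
    then have "C (g \<otimes> h) = \<pi> (n g) \<otimes> conj_by (\<tau> ?s) (\<pi> (n h)) \<otimes> (\<pi> (e ?s ?t) \<otimes> c' (?s \<otimes>\<^bsub>S\<^esub> ?t))"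
      using gh N T proj(1) c'(1) by (simp add: C_def \<sigma>_mult m_assoc)
    also have "\<dots> = \<pi> (n g) \<otimes> conj_by (\<tau> ?s) (C h) \<otimes> c' ?s"
      unfolding zc[OF \<sigma>_closed[OF gh(1)] \<sigma>_closed[OF gh(2)]]
      using gh N T proj(1) c'(1) by (simp add: C_def conj_by_mult m_assoc)
    also have "\<dots> = conj_by (\<tau> ?s) (C h) \<otimes> C g"
      using abelian[of "\<pi> (n g)" "conj_by (\<tau> ?s) (C h)"] gh N T proj(1) c'(1) CP by (simp add: C_def m_assoc)
    also have "conj_by (\<tau> ?s) (C h) = conj_by g (C h)"
      using conj_eq[OF T(1) gh(1) \<sigma>_\<tau> CP[OF gh(2)]] gh by simp
    finally show ?thesis .
  qed
  have Cinj: "inj_on C P"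
  proof (rule inj_onI)
    fix u v assume uv: "u \<in> P" "v \<in> P" "C u = C v"
    have s1: "\<sigma> w = \<one>\<^bsub>S\<^esub>" if "w \<in> P" for w using \<sigma>_eq_one_iff PF that by auto
    \<comment> \<open>On P the map C is multiplication by one fixed element of P, built from the
      values of \<tau> and \<open>c'\<close> at the unit of S; this is all that injectivity
      requires.\<close>
    have "inv (\<tau> \<one>\<^bsub>S\<^esub>) \<in> F"
      using \<sigma>_eq_one_iff[OF \<tau>c[OF S.one_closed]] \<sigma>_\<tau>[OF S.one_closed] by simp
    then have "\<pi> (n w) = w \<otimes> \<pi> (inv (\<tau> \<one>\<^bsub>S\<^esub>))" if "w \<in> P" for w
      using that PF s1[OF that] proj(2,4) by (auto simp: n_def)
    then have "u \<otimes> (\<pi> (inv (\<tau> \<one>\<^bsub>S\<^esub>)) \<otimes> c' \<one>\<^bsub>S\<^esub>) = v \<otimes> (\<pi> (inv (\<tau> \<one>\<^bsub>S\<^esub>)) \<otimes> c' \<one>\<^bsub>S\<^esub>)"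
      using uv s1 proj(1)[OF \<open>inv (\<tau> \<one>\<^bsub>S\<^esub>) \<in> F\<close>] c'(1)[OF S.one_closed] by (simp add: C_def m_assoc)
    then show "u = v" using uv proj(1)[OF \<open>inv (\<tau> \<one>\<^bsub>S\<^esub>) \<in> F\<close>] c'(1)[OF S.one_closed] by simp
  qed
  have "abelian_normal P G"
    using P fin abelian by (simp add: abelian_normal_def abelian_normal_axioms_def)
  moreover have "crossed_hom G P C" using CP Cmult by (simp add: crossed_hom_def)
  ultimately show False using abelian_normal.crossed_hom_complement Cinj no_compl by blast
qed

end

section \<open>The Frattini triple and the extension\<close>

context frattini_pair
begin

text \<open>The P-coordinate in F = P x Q. In the interpretation with the roles exchanged the same
  definition gives the Q-coordinate.\<close>

definition proj :: "'a \<Rightarrow> 'a" where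
  "proj x = (THE u. u \<in> P \<and> (\<exists>v\<in>Q. x = u \<otimes> v))"

lemma proj_mult [simp]: "u \<in> P \<Longrightarrow> v \<in> Q \<Longrightarrow> proj (u \<otimes> v) = u"
  unfolding proj_def
proof (rule the_equality)
  fix w assume uv: "u \<in> P" "v \<in> Q" and "w \<in> P \<and> (\<exists>v'\<in>Q. u \<otimes> v = w \<otimes> v')"
  then obtain v' where "w \<in> P" "v' \<in> Q" "u \<otimes> v = w \<otimes> v'" by blast
  then show "w = u" using trivial_Int_product_eq[OF sub_P sub_Q Int_PQ uv, of w v'] by simp
qed blast

lemma proj_mult_swap [simp]: "u \<in> P \<Longrightarrow> v \<in> Q \<Longrightarrow> frattini_pair.proj G Q P (u \<otimes> v) = v"
  using frattini_pair.proj_mult[OF swap, of v u] comm_PQ[of u v] by simp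

lemma FratE:
  assumes "x \<in> Frat G"
  obtains u v where "u \<in> P" "v \<in> Q" "x = u \<otimes> v"
  using assms Frat_iff by auto

lemma proj_closed: "x \<in> Frat G \<Longrightarrow> proj x \<in> P"
  by (erule FratE) simp

lemma Frat_mult:
  assumes "u \<in> P" "v \<in> Q" "u' \<in> P" "v' \<in> Q"
  shows "(u \<otimes> v) \<otimes> (u' \<otimes> v') = (u \<otimes> u') \<otimes> (v \<otimes> v')" "u \<otimes> u' \<in> P" "v \<otimes> v' \<in> Q"
proof -
  have "(u \<otimes> v) \<otimes> (u' \<otimes> v') = u \<otimes> (v \<otimes> u') \<otimes> v'" using assms by (simp add: m_assoc)
  also have "v \<otimes> u' = u' \<otimes> v" using comm_PQ[OF assms(3,2)] by (rule sym)
  finally show "(u \<otimes> v) \<otimes> (u' \<otimes> v') = (u \<otimes> u') \<otimes> (v \<otimes> v')" using assms by (simp add: m_assoc)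
qed (use assms in \<open>simp_all add: subgroup.m_closed[OF sub_P] subgroup.m_closed[OF sub_Q]\<close>)

lemma proj_hom: "x \<in> Frat G \<Longrightarrow> y \<in> Frat G \<Longrightarrow> proj (x \<otimes> y) = proj x \<otimes> proj y"
  by (elim FratE) (simp add: Frat_mult)

lemma proj_conj: "g \<in> carrier G \<Longrightarrow> x \<in> Frat G \<Longrightarrow> proj (conj_by g x) = conj_by g (proj x)"
  by (elim FratE) (simp add: conj_by_mult)

lemma proj_P: "u \<in> P \<Longrightarrow> proj u = u"
  using proj_mult[of u \<one>] subgroup.one_closed[OF sub_Q] by simp

lemma conjugation_module_P:
  assumes "group S" "\<theta> \<in> iso (G Mod Frat G) S" "group A" "f \<in> iso (G\<lparr>carrier := P\<rparr>) A"
  shows "conjugation_module (Frat G) G S \<theta> P A f"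
  by (intro conjugation_module.intro coset_map.intro coset_map_axioms.intro
      conjugation_module_axioms.intro normal_Frat P(1) assms abelian_P conj_Frat_P)

theorem frattini_triple_extension:
  assumes Omega_quot: "Omega p q (G Mod Frat G) = {}"
  shows "\<exists>(S :: nat monoid) (A :: nat monoid) \<phi> (B :: nat monoid) \<psi>.
    frattini_triple p q S A \<phi> B \<psi> \<and> frattini_extension G S (A \<times>\<times> B) (prod_action A \<phi> B \<psi>)"
proof -
  interpret SW: frattini_pair G q p Q P b a by (rule swap)
  let ?F = "Frat G"
  interpret F: normal ?F G by (rule normal_Frat)
  have grp: "group (G Mod ?F)" "group (G\<lparr>carrier := P\<rparr>)" "group (G\<lparr>carrier := Q\<rparr>)"
    using F.factorgroup_is_group sub_P sub_Q by (simp_all add: subgroup.subgroup_is_group is_group)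
  have finP: "finite P" and finQ: "finite Q"
    using finite_subgroup[OF finite sub_P] finite_subgroup[OF finite sub_Q] .
  have finM: "finite (carrier (G Mod ?F))" using finite by (simp add: FactGroup_def RCOSETS_def)
  obtain S :: "nat monoid" where S: "group S" "G Mod ?F \<cong> S"
    using finite_group_iso_nat_monoid[OF grp(1) finM] by blast
  obtain A :: "nat monoid" where A: "group A" "G\<lparr>carrier := P\<rparr> \<cong> A"
    using finite_group_iso_nat_monoid[OF grp(2)] finP by auto
  obtain B :: "nat monoid" where B: "group B" "G\<lparr>carrier := Q\<rparr> \<cong> B"
    using finite_group_iso_nat_monoid[OF grp(3)] finQ by auto
  obtain \<theta> where \<theta>: "\<theta> \<in> iso (G Mod ?F) S" using S(2) by (auto simp: is_iso_def)
  obtain f where f: "f \<in> iso (G\<lparr>carrier := P\<rparr>) A" using A(2) by (auto simp: is_iso_def)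
  obtain h where h: "h \<in> iso (G\<lparr>carrier := Q\<rparr>) B" using B(2) by (auto simp: is_iso_def)
  interpret S: group S by (rule S(1))
  interpret MP: conjugation_module ?F G S \<theta> P A f
    by (rule conjugation_module_P[OF S(1) \<theta> A(1) f])
  interpret MQ: conjugation_module ?F G S \<theta> Q B h
    by (rule SW.conjugation_module_P[OF S(1) \<theta> B(1) h])
  have finS: "finite (carrier S)" using iso_finite[OF S(2)] finM by simp
  have \<sigma>F: "MP.\<sigma> x = \<one>\<^bsub>S\<^esub>" if "x \<in> ?F" for x
    using MP.\<sigma>_eq_one_iff that subgroup.mem_carrier[OF sub_F] by simp
  have lift: "\<exists>g\<in>carrier G. s = MP.\<sigma> g \<and> g \<notin> ?F \<and> g [^] n \<in> ?F"
    if s: "s \<in> carrier S" "s \<noteq> \<one>\<^bsub>S\<^esub>" "S.ord s = n" for s n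
  proof -
    obtain g where g: "g \<in> carrier G" "MP.\<sigma> g = s" using MP.\<sigma>_surj[OF s(1)] by blast
    have "MP.\<sigma> (g [^] n) = s [^]\<^bsub>S\<^esub> n" using g MP.\<sigma>.hom_nat_pow by simp
    then have "MP.\<sigma> (g [^] n) = \<one>\<^bsub>S\<^esub>" using s S.pow_ord_eq_1 by auto
    then have "g [^] n \<in> ?F" using MP.\<sigma>_eq_one_iff g(1) by simp
    then show ?thesis using g s(2) \<sigma>F by blast
  qed
  \<comment> \<open>Normal subgroups of S pull back to normal subgroups of G above F, and
    \<open>normal_over_Frat\<close> leaves only F and G.\<close>
  have simple: "simple_group S"
  proof (intro simple_group.intro S(1) simple_group_axioms.intro)
    have "carrier S \<noteq> {\<one>\<^bsub>S\<^esub>}"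
    proof
      assume triv: "carrier S = {\<one>\<^bsub>S\<^esub>}"
      have "g \<in> ?F" if "g \<in> carrier G" for g
        using MP.\<sigma>_eq_one_iff[OF that] MP.\<sigma>_closed[OF that] triv by simp
      then show False using Frat_not_carrier subgroup.subset[OF sub_F] by blast
    qed
    then have "order S \<noteq> 1" using S.order_one_triv_iff by simp
    moreover have "0 < order S" using finS S.order_gt_0_iff_finite by simp
    ultimately show "1 < order S" by linarith
  next
    fix H assume H: "H \<lhd> S"
    have sH: "subgroup H S" using H by (rule normal_imp_subgroup)
    let ?L = "{g \<in> carrier G. MP.\<sigma> g \<in> H}"
    have FL: "?F \<subseteq> ?L"
    proof
      fix x assume "x \<in> ?F"
      then show "x \<in> ?L" using \<sigma>F subgroup.one_closed[OF sH] subgroup.mem_carrier[OF sub_F] by simp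
    qed
    have img: "H = MP.\<sigma> ` ?L"
    proof (intro equalityI subsetI)
      fix s assume s: "s \<in> H"
      then obtain g where "g \<in> carrier G" "MP.\<sigma> g = s"
        using MP.\<sigma>_surj[OF subgroup.mem_carrier[OF sH]] by blast
      then show "s \<in> MP.\<sigma> ` ?L" using s by blast
    qed blast
    have "?L \<lhd> G"
    proof (rule normal_conj_byI)
      show "subgroup ?L G"
      proof (rule subgroupI)
        show "?L \<noteq> {}" using FL subgroup.one_closed[OF sub_F] by blast
      qed (use sH in \<open>auto simp: MP.\<sigma>_mult subgroup.m_closed subgroup.m_inv_closed\<close>)
      show "conj_by g x \<in> ?L" if "g \<in> carrier G" "x \<in> ?L" for g x
        using that normal.inv_op_closed2[OF H, of "MP.\<sigma> g" "MP.\<sigma> x"]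
        by (simp add: conj_by_def MP.\<sigma>_mult)
    qed
    then have "?L = ?F \<or> ?L = carrier G" using FL by (rule normal_over_Frat)
    then show "H = carrier S \<or> H = {\<one>\<^bsub>S\<^esub>}"
    proof
      assume "?L = ?F"
      then have HF: "H = MP.\<sigma> ` ?F" using img by simp
      have "H \<subseteq> {\<one>\<^bsub>S\<^esub>}" unfolding HF using \<sigma>F by (intro image_subsetI) simp
      then show ?thesis using subgroup.one_closed[OF sH] by fast
    next
      assume "?L = carrier G"
      then have "H = MP.\<sigma> ` carrier G" using img by simp
      moreover have "carrier S \<subseteq> MP.\<sigma> ` carrier G" using MP.\<sigma>_surj by fast
      ultimately show ?thesis using subgroup.subset[OF sH] by fast
    qed
  qed
  \<comment> \<open>Both p and q divide |G : F|. In an abelian S the elements killed by p^i would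
    form a nontrivial normal subgroup, hence all of S by simplicity, including the image of y, a
    nontrivial q-element.\<close>
  have nonabelian: "\<not> comm_group S"
  proof
    assume "comm_group S"
    then interpret SC: comm_group S .
    have oneF: "\<one> \<in> ?F" using subgroup.one_closed[OF sub_F] .
    note cG = self_normal subgroup.subset[OF sub_F] Frat_not_carrier[symmetric]
    obtain x i where x: "x \<in> carrier G" "x \<notin> ?F" "x [^] (p ^ i) = \<one>"
      by (rule exists_p_element_outside[OF p(1) finite sub_F subgroup_self cG(2) p_dvd_index[OF cG]])
    obtain y j where y: "y \<in> carrier G" "y \<notin> ?F" "y [^] (q ^ j) = \<one>"
      by (rule exists_p_element_outside[OF q(1) finite sub_F subgroup_self cG(2) q_dvd_index[OF cG]])
    let ?H = "{s \<in> carrier S. s [^]\<^bsub>S\<^esub> (p ^ i) = \<one>\<^bsub>S\<^esub>}"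
    have "subgroup ?H S"
    proof (rule S.subgroupI)
      show "?H \<noteq> {}" using S.one_closed S.nat_pow_one by blast
    qed (auto simp: S.nat_pow_inv SC.nat_pow_distrib)
    then have "?H \<lhd> S" by (rule SC.subgroup_imp_normal)
    then have "?H = carrier S \<or> ?H = {\<one>\<^bsub>S\<^esub>}"
      using simple_group.no_real_normal_subgroup[OF simple] by blast
    moreover have "MP.\<sigma> x \<in> ?H"
      using x \<sigma>F[OF oneF] by (simp flip: MP.\<sigma>.hom_nat_pow)
    moreover have "MP.\<sigma> x \<noteq> \<one>\<^bsub>S\<^esub>" using MP.\<sigma>_eq_one_iff x by simp
    ultimately have "?H = carrier S" by blast
    then have "MP.\<sigma> y [^]\<^bsub>S\<^esub> (p ^ i) = \<one>\<^bsub>S\<^esub>" using MP.\<sigma>_closed[OF y(1)] by blast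
    moreover have "MP.\<sigma> y [^]\<^bsub>S\<^esub> (q ^ j) = \<one>\<^bsub>S\<^esub>"
      using y \<sigma>F[OF oneF] by (simp flip: MP.\<sigma>.hom_nat_pow)
    ultimately have "MP.\<sigma> y = \<one>\<^bsub>S\<^esub>"
      using S.coprime_pow_one[of "MP.\<sigma> y" "p ^ i" "q ^ j"] y(1) by simp
    then show False using MP.\<sigma>_eq_one_iff y by simp
  qed
  have cohP: "\<not> trivial_group (cohomology2 S A MP.\<alpha>)"
    by (rule MP.cohomology2_nontrivial[where \<pi> = proj])
      (rule finite P_le_Frat no_complement_P proj_closed proj_hom proj_conj proj_P | assumption)+
  have cohQ: "\<not> trivial_group (cohomology2 S B MQ.\<alpha>)"
    by (rule MQ.cohomology2_nontrivial[where \<pi> = SW.proj])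
      (rule finite Q_le_Frat SW.no_complement_P SW.proj_closed SW.proj_hom SW.proj_conj SW.proj_P | assumption)+
  have fixP: "module_fixed A MP.\<alpha> s = {\<one>\<^bsub>A\<^esub>}"
    if s: "s \<in> carrier S" "s \<noteq> \<one>\<^bsub>S\<^esub>" "S.ord s = q ^ k" for s k
  proof -
    obtain g where g: "g \<in> carrier G" "s = MP.\<sigma> g" "g \<notin> ?F" "g [^] (q ^ k) \<in> ?F"
      using lift[OF s] by blast
    show ?thesis unfolding g(2)
      by (rule MP.fixed_trivial[OF g(1)]) (rule SW.no_fixed_Q_Frat[OF g(1,4,3)])
  qed
  have fixQ: "module_fixed B MQ.\<alpha> s = {\<one>\<^bsub>B\<^esub>}"
    if s: "s \<in> carrier S" "s \<noteq> \<one>\<^bsub>S\<^esub>" "S.ord s = p ^ k" for s k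
  proof -
    obtain g where g: "g \<in> carrier G" "s = MP.\<sigma> g" "g \<notin> ?F" "g [^] (p ^ k) \<in> ?F"
      using lift[OF s] by blast
    show ?thesis unfolding g(2)
      by (rule MQ.fixed_trivial[OF g(1)]) (rule no_fixed_Q_Frat[OF g(1,4,3)])
  qed
  have OmS: "Omega p q S = {}" using iso_Omega[OF grp(1) S(1) \<theta>] Omega_quot by simp
  have ord: "\<exists>k. order A = p ^ k" "\<exists>k. order B = q ^ k" using MP.order_A(1) MQ.order_A(1) P(2) Q(2) by auto
  have "frattini_triple p q S A MP.\<alpha> B MQ.\<alpha>"
    unfolding frattini_triple_def
  proof (intro conjI ballI impI)
    show "faithful_module S A MP.\<alpha>" by (rule MP.faithful) (rule centralizer_P_le_Frat)
    show "faithful_module S B MQ.\<alpha>" by (rule MQ.faithful) (rule SW.centralizer_P_le_Frat)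
    show "irreducible_module S A MP.\<alpha>" by (rule MP.irreducible[OF P(3)]) (rule minimal_P)
    show "irreducible_module S B MQ.\<alpha>" by (rule MQ.irreducible[OF Q(3)]) (rule SW.minimal_P)
  qed (rule simple finS nonabelian ord MP.order_A(2)[OF finP] MQ.order_A(2)[OF finQ] OmS cohP cohQ
      | elim conjE exE, erule (2) fixP fixQ)+
  moreover have "frattini_extension G S (A \<times>\<times> B) (prod_action A MP.\<alpha> B MQ.\<alpha>)"
    unfolding frattini_extension_def
  proof (intro conjI exI is_group finite ballI)
    let ?h = "\<lambda>x. (f (proj x), h (SW.proj x))"
    show "?h \<in> iso (G\<lparr>carrier := ?F\<rparr>) (A \<times>\<times> B)"
    proof (rule isoI)
      show "?h \<in> hom (G\<lparr>carrier := ?F\<rparr>) (A \<times>\<times> B)"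
        using proj_closed SW.proj_closed
        by (auto simp: hom_def proj_hom SW.proj_hom MP.f_mult MQ.f_mult)
      have "inj_on ?h ?F"
      proof (rule inj_onI)
        fix x y assume xy: "x \<in> ?F" "y \<in> ?F" "?h x = ?h y"
        have eq: "proj x = proj y" "SW.proj x = SW.proj y"
          using xy proj_closed SW.proj_closed MP.f_eq_iff MQ.f_eq_iff by simp_all
        have "z = proj z \<otimes> SW.proj z" if "z \<in> ?F" for z
          using that by (elim FratE) simp
        from this[OF xy(1)] this[OF xy(2)] show "x = y" unfolding eq by simp
      qed
      moreover have "?h ` ?F = carrier A \<times> carrier B"
      proof (intro equalityI subsetI)
        fix z assume "z \<in> carrier A \<times> carrier B"
        then obtain u v where uv: "u \<in> P" "v \<in> Q" "z = (f u, h v)"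
          using MP.f_surj MQ.f_surj by (metis mem_Sigma_iff surj_pair)
        then have "z = ?h (u \<otimes> v)" by simp
        moreover have "u \<otimes> v \<in> ?F" using uv Frat_iff by blast
        ultimately show "z \<in> ?h ` ?F" by (rule image_eqI)
      next
        fix z assume "z \<in> ?h ` ?F"
        then show "z \<in> carrier A \<times> carrier B" using proj_closed SW.proj_closed by auto
      qed
      ultimately show "bij_betw ?h (carrier (G\<lparr>carrier := ?F\<rparr>)) (carrier (A \<times>\<times> B))"
        by (simp add: bij_betw_def)
    qed
    fix g n assume g: "g \<in> carrier G" and n: "n \<in> ?F"
    have \<sigma>: "\<theta> (?F #> g) = MP.\<sigma> g" by (simp add: MP.\<sigma>_def)
    show "?h (g \<otimes> n \<otimes> inv g) = prod_action A MP.\<alpha> B MQ.\<alpha> (\<theta> (?F #> g)) (?h n)"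
      unfolding \<sigma> conj_by_def[symmetric] prod_action_def
      using g n proj_closed SW.proj_closed
      by (simp add: proj_conj SW.proj_conj MP.\<alpha>_\<sigma> MQ.\<alpha>_\<sigma>)
  qed (rule normal_Frat subset_refl \<theta>)+
  ultimately show ?thesis by blast
qed

end

theorem proposition5:
  fixes G :: "'a monoid" and p q :: nat
  assumes "prime p" and "prime q" and "odd p" and "odd q" and "p \<noteq> q"
    and "group G" and "finite (carrier G)"
    and "Omega p q G \<noteq> {}" and "Omega_star_star p q G = {}"
    and "\<And>H :: nat monoid. \<lbrakk>group H; finite (carrier H); order H < order G\<rbrakk>
           \<Longrightarrow> \<not> (Omega p q H \<noteq> {} \<and> Omega_star_star p q H = {})"
  shows "\<exists>(S :: nat monoid) (P :: nat monoid) \<phi> (Q :: nat monoid) \<psi>.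
           frattini_triple p q S P \<phi> Q \<psi> \<and>
           frattini_extension G S (P \<times>\<times> Q) (prod_action P \<phi> Q \<psi>)"
proof -
  interpret minimal_example G p q
    by (intro minimal_example.intro minimal_example_axioms.intro assms)
  obtain P Q a b where "frattini_pair G p q P Q a b" using frattini_pair_exists by blast
  then interpret F: frattini_pair G p q P Q a b .
  have "Frat G \<noteq> {\<one>\<^bsub>G\<^esub>}" using F.P_le_Frat F.P_nontrivial by blast
  then have "Omega p q (G Mod Frat G) = {}" by (rule Omega_quotient[OF Frat_normal])
  then show ?thesis by (rule F.frattini_triple_extension)
qed

end
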